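(* Let $N\ge 2$ be an integer and $\alpha>-1$. The equation $$-\Delta_N u=|x|^{N\alpha}e^{u}\quad\text{in }\mathbb{R}^N$$ has, up to scalings, a unique radial solution $u\in W^{1,N}_{loc}(\mathbb{R}^N)$. More precisely, the radial (about the origin) solutions are exactly the functions $$U_{\lambda,\alpha}(x)=\ln\frac{C_{N,\alpha}\,\lambda^{N(\alpha+1)}}{\left(1+(\lambda|x|)^{\frac{N(\alpha+1)}{N-1}}\right)^N},\qquad \lambda>0,$$ where $C_{N,\alpha}=N(\alpha+1)\left(\frac{N^2(\alpha+1)}{N-1}\right)^{N-1}$.
   Context: $\Delta_N u=\operatorname{div}(|\nabla u|^{N-2}\nabla u)$. A solution of $-\Delta_N u=|x|^{N\alpha}e^u$ in $\mathbb{R}^N$ is a function $u\in W^{1,N}_{loc}(\mathbb{R}^N)$ with $\int_{\mathbb{R}^N}|\nabla u|^{N-2}\nabla u\cdot\nabla\varphi\,dx=\int_{\mathbb{R}^N}|x|^{N\alpha}e^u\varphi\,dx$ for all $\varphi\in C_0^1(\mathbb{R}^N)$. The equation is invariant under the scalings $u\mapsto u(\lambda\,\cdot)+N(\alpha+1)\ln\lambda$, $\lambda>0$. *)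

theory Defs
  imports "HOL-Analysis.Analysis"
begin

definition compact_C1 :: "('a::euclidean_space \<Rightarrow> real) \<Rightarrow> ('a \<Rightarrow> 'a) \<Rightarrow> bool" where
  "compact_C1 \<phi> d\<phi> \<longleftrightarrow>
     (\<forall>x. GDERIV \<phi> x :> d\<phi> x) \<and> continuous_on UNIV d\<phi> \<and> compact (closure {x. \<phi> x \<noteq> 0})"

definition Lp_loc :: "real \<Rightarrow> ('a::euclidean_space \<Rightarrow> 'b::euclidean_space) \<Rightarrow> bool" where
  "Lp_loc p f \<longleftrightarrow> f \<in> borel_measurable lebesgue \<and>
     (\<forall>K. compact K \<longrightarrow> set_integrable lebesgue K (\<lambda>x. norm (f x) powr p))"

text \<open>
  The integration by parts formula is vector valued; its components are the usual
  identities for the individual weak partial derivatives. Testing with \<open>C\<^sup>1\<close> functions of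
  compact support is equivalent to testing with smooth ones.
\<close>

definition has_weak_gradient :: "('a::euclidean_space \<Rightarrow> real) \<Rightarrow> ('a \<Rightarrow> 'a) \<Rightarrow> bool" where
  "has_weak_gradient u G \<longleftrightarrow> Lp_loc 1 u \<and> Lp_loc 1 G \<and>
     (\<forall>\<phi> d\<phi>. compact_C1 \<phi> d\<phi> \<longrightarrow>
        (LINT x|lebesgue. u x *\<^sub>R d\<phi> x) = - (LINT x|lebesgue. \<phi> x *\<^sub>R G x))"

definition W1p_loc :: "real \<Rightarrow> ('a::euclidean_space \<Rightarrow> real) set" where
  "W1p_loc p = {u. Lp_loc p u \<and> (\<exists>G. has_weak_gradient u G \<and> Lp_loc p G)}"

text \<open>
  Weak solutions of \<open>-\<Delta>\<^sub>N u = |x|\<^bsup>N\<alpha>\<^esup> e\<^sup>u\<close> on the whole of \<open>\<real>\<^sup>N\<close>, \<open>N = CARD('n)\<close>. The weak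
  gradient is unique up to null sets, so the choice of \<open>G\<close> is immaterial.
  Integrability of both sides is stated because the Bochner integral of a
  non-integrable function is 0 by convention.
  The exponent \<open>CARD('n) - 2\<close> is a natural number, so it is meaningful for \<open>N \<ge> 2\<close> only.
\<close>

definition liouville_solution :: "real \<Rightarrow> (real ^ 'n \<Rightarrow> real) \<Rightarrow> bool" where
  "liouville_solution \<alpha> u \<longleftrightarrow> u \<in> W1p_loc (real CARD('n)) \<and>
     (\<exists>G. has_weak_gradient u G \<and>
       (\<forall>\<phi> d\<phi>. compact_C1 \<phi> d\<phi> \<longrightarrow>
          integrable lebesgue (\<lambda>x. (norm (G x) ^ (CARD('n) - 2) *\<^sub>R G x) \<bullet> d\<phi> x) \<and>
          integrable lebesgue (\<lambda>x. norm x powr (real CARD('n) * \<alpha>) * exp (u x) * \<phi> x) \<and>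
          (LINT x|lebesgue. (norm (G x) ^ (CARD('n) - 2) *\<^sub>R G x) \<bullet> d\<phi> x) =
          (LINT x|lebesgue. norm x powr (real CARD('n) * \<alpha>) * exp (u x) * \<phi> x)))"

text \<open>Elements of Sobolev spaces are functions modulo null sets, hence the almost
  everywhere quantifier.\<close>

definition radial :: "('a::euclidean_space \<Rightarrow> real) \<Rightarrow> bool" where
  "radial u \<longleftrightarrow> (\<exists>v. AE x in lebesgue. u x = v (norm x))"

definition rescale :: "real \<Rightarrow> real \<Rightarrow> (real ^ 'n \<Rightarrow> real) \<Rightarrow> real ^ 'n \<Rightarrow> real" where
  "rescale \<alpha> \<mu> u x = u (\<mu> *\<^sub>R x) + real CARD('n) * (\<alpha> + 1) * ln \<mu>"

definition bubble_const :: "nat \<Rightarrow> real \<Rightarrow> real" where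
  "bubble_const N \<alpha> =
     real N * (\<alpha> + 1) * ((real N)\<^sup>2 * (\<alpha> + 1) / (real N - 1)) ^ (N - 1)"

definition bubble :: "real \<Rightarrow> real \<Rightarrow> real ^ 'n \<Rightarrow> real" where
  "bubble \<mu> \<alpha> x =
     ln (bubble_const CARD('n) \<alpha> * \<mu> powr (real CARD('n) * (\<alpha> + 1)) /
         (1 + (\<mu> * norm x) powr (real CARD('n) * (\<alpha> + 1) / (real CARD('n) - 1))) ^ CARD('n))"

end

theory Submission imports Defs begin

text \<open>
  Write \<open>N\<close> for the dimension and \<open>\<kappa> = N (\<alpha> + 1) > 0\<close>. For a smooth radial function
  \<open>u = V(|x|)\<close> with \<open>V' < 0\<close> the equation integrates once to
  \<open>r\<^sup>N\<^sup>-\<^sup>1 |V'|\<^sup>N\<^sup>-\<^sup>2 V' = - m(r)\<close>, where \<open>m(r)\<close> is the integral of \<open>s\<^sup>\<kappa>\<^sup>-\<^sup>1 e\<^sup>V\<^sup>(\<^sup>s\<^sup>)\<close> over \<open>(0, r)\<close>. In the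
  variables \<open>t = ln r\<close> and \<open>Y = V + \<kappa> t\<close> this is the autonomous system \<open>m' = e\<^sup>Y\<close>,
  \<open>Y' = \<kappa> - q\<close> with \<open>q = m\<^sup>1\<^sup>/\<^sup>(\<^sup>N\<^sup>-\<^sup>1\<^sup>)\<close>. It conserves \<open>e\<^sup>Y - \<kappa> m + (N - 1)/N m q\<close>, and because \<open>m\<close> vanishes at
  the origin the conserved value is 0. What is left is a Bernoulli equation for \<open>q\<close>, linear in
  \<open>1/q\<close>; the solutions with \<open>m' > 0\<close> form a one-parameter family, the bubbles, on which the
  parameter acts by scaling (\<open>autonomous_liouville_system\<close>, \<open>liouville_profile_unique\<close>).

  The analytic content is the passage between the weak formulation on the space and this
  equation on the half-line, for functions that are only locally integrable.

  From the space to the half-line. A function on the space has a radial marginal, the density on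
  the half-line that gives the same integrals against functions of \<open>|x|\<close>
  (\<open>radial_marginal\<close>, by the theorem of Radon and Nikodym). Testing the weak gradient
  \<open>G\<close> of a radial function with the fields \<open>\<psi>(|x|) x\<close> shows that its profile has a weak
  derivative \<open>h\<close> on the half-line, namely the marginal of \<open>x \<bullet> G\<close> suitably normalised; by the lemma of
  du Bois-Reymond the profile is a primitive \<open>V\<close> of \<open>h\<close>. Conversely \<open>V(|x|)\<close> has the weak gradient
  \<open>h(|x|) x/|x|\<close> (\<open>has_weak_gradient_radial\<close>), and weak gradients are unique, so \<open>G\<close> is this radial
  field (\<open>radial_weak_gradient_structure\<close>). The weak equation, tested with radial
  functions, then becomes the integrated equation above (\<open>radial_flux_identity\<close>). These test functions may
  be constant and nonzero near the origin, which is why no constant of integration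
  appears: a constant would be a point mass at the origin.

  From the half-line to the space. That \<open>V(|x|)\<close> has the expected weak gradient, and that the
  bubbles satisfy the weak equation against test functions that are not radial
  (\<open>flux_radial\<close>), are both integrations by parts in the radial direction. They follow from one
  principle, \<open>radial_transport\<close>: an identity known for smooth radial cutoffs, where it is
  the vanishing of the integral of a divergence, extends to every integrable radial weight.
\<close>

section \<open>Test functions\<close>

text \<open>
  Pairs of a function and its gradient: the companion of \<open>compact_C1\<close> without the condition on
  the support, for cutoffs and coordinate functions.
\<close>

definition C1 :: "('a::euclidean_space \<Rightarrow> real) \<Rightarrow> ('a \<Rightarrow> 'a) \<Rightarrow> bool" where
  "C1 f df \<longleftrightarrow> (\<forall>x. GDERIV f x :> df x) \<and> continuous_on UNIV df"

lemma GDERIV_imp_isCont: "GDERIV f x :> d \<Longrightarrow> isCont f x"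
  unfolding gderiv_def by (rule has_derivative_continuous)

lemma C1_continuous: "C1 f df \<Longrightarrow> continuous_on UNIV f"
  unfolding C1_def using GDERIV_imp_isCont by (auto simp: continuous_on_eq_continuous_at)

lemma compact_C1_imp_C1: "compact_C1 f df \<Longrightarrow> C1 f df"
  unfolding compact_C1_def C1_def by simp

lemma compact_C1_continuous:
  assumes "compact_C1 f df"
  shows "continuous_on UNIV f" "continuous_on UNIV df"
  using C1_continuous[OF compact_C1_imp_C1[OF assms]] assms unfolding compact_C1_def by auto

lemma compact_C1I:
  assumes "C1 f df" "compact K" "\<And>x. x \<notin> K \<Longrightarrow> f x = 0"
  shows "compact_C1 f df" "closure {x. f x \<noteq> 0} \<subseteq> K"
proof -
  have "{x. f x \<noteq> 0} \<subseteq> K" using assms(3) by auto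
  then show "closure {x. f x \<noteq> 0} \<subseteq> K"
    using assms(2) by (simp add: closure_minimal compact_imp_closed)
  then have "compact (closure {x. f x \<noteq> 0})"
    using assms(2) closed_closure by (metis inf.absorb_iff2 compact_Int_closed)
  then show "compact_C1 f df" using assms(1) unfolding compact_C1_def C1_def by auto
qed

lemma C1_const: "C1 (\<lambda>x. c) (\<lambda>x. 0)"
  unfolding C1_def by (simp add: GDERIV_const)

lemma C1_inner: "C1 (\<lambda>x. x \<bullet> i) (\<lambda>x. i)"
  unfolding C1_def gderiv_def by (auto intro!: derivative_eq_intros)

lemma C1_mult:
  assumes "C1 f df" "C1 g dg"
  shows "C1 (\<lambda>x. f x * g x) (\<lambda>x. f x *\<^sub>R dg x + g x *\<^sub>R df x)"
  using assms C1_continuous[OF assms(1)] C1_continuous[OF assms(2)]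
  unfolding C1_def by (auto intro!: GDERIV_mult continuous_intros)

lemma C1_compose:
  assumes "C1 f df" "C1 g dg"
  shows "C1 (\<lambda>x. g (f x)) (\<lambda>x. dg (f x) *\<^sub>R df x)"
proof -
  have "continuous_on UNIV (\<lambda>x. dg (f x))"
    using assms C1_continuous[OF assms(1)] unfolding C1_def
    by (metis (full_types) continuous_on_compose2 subset_UNIV)
  then show ?thesis
    using assms GDERIV_DERIV_compose[of f _ _ g] unfolding C1_def by (auto intro!: continuous_intros)
qed

lemma C1_prod:
  assumes "finite I" "\<And>i. i \<in> I \<Longrightarrow> \<exists>d. C1 (f i) d"
  shows "\<exists>d. C1 (\<lambda>x. \<Prod>i\<in>I. f i x) d"
  using assms
proof (induction I)
  case empty
  then show ?case using C1_const by auto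
next
  case (insert i I)
  obtain d where d: "C1 (f i) d" using insert by blast
  obtain e where e: "C1 (\<lambda>x. \<Prod>i\<in>I. f i x) e" using insert by blast
  from C1_mult[OF d e] insert(1,2) show ?case by auto
qed

lemma compact_C1_mult:
  assumes "compact_C1 f df" "C1 g dg"
  shows "compact_C1 (\<lambda>x. g x * f x) (\<lambda>x. g x *\<^sub>R df x + f x *\<^sub>R dg x)"
proof (rule compact_C1I(1))
  show "C1 (\<lambda>x. g x * f x) (\<lambda>x. g x *\<^sub>R df x + f x *\<^sub>R dg x)"
    using C1_mult assms compact_C1_imp_C1 by blast
  show "compact (closure {x. f x \<noteq> 0})" using assms compact_C1_def by blast
  fix x assume "x \<notin> closure {x. f x \<noteq> 0}"
  then show "g x * f x = 0" using closure_subset[of "{x. f x \<noteq> 0}"] by auto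
qed

text \<open>
  The support is closed, so around a point outside it the function vanishes identically.
\<close>

lemma compact_C1_gradient_outside:
  fixes x :: "'a::euclidean_space"
  assumes "compact_C1 f df" "x \<notin> closure {x. f x \<noteq> 0}"
  shows "f x = 0" "df x = 0"
proof -
  let ?U = "- closure {x. f x \<noteq> 0}"
  show "f x = 0" using assms(2) closure_subset[of "{x. f x \<noteq> 0}"] by blast
  have "GDERIV f x :> 0"
    unfolding gderiv_def
  proof (rule has_derivative_transform_within_open[of "\<lambda>x. 0" _ x UNIV "?U"])
    show "((\<lambda>x. 0) has_derivative (\<lambda>h. h \<bullet> 0)) (at x)" by simp
    show "x \<in> ?U" using assms(2) by simp
    show "0 = f y" if "y \<in> ?U" for y
      using that closure_subset[of "{x. f x \<noteq> 0}"] by auto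
  qed auto
  moreover have "GDERIV f x :> df x" using assms(1) compact_C1_def by blast
  ultimately have "(\<lambda>h. h \<bullet> 0) = (\<lambda>h. h \<bullet> df x)"
    unfolding gderiv_def by (rule has_derivative_unique)
  then have "df x \<bullet> 0 = df x \<bullet> df x" by metis
  then show "df x = 0" by simp
qed

lemma compact_C1_bounded_support:
  assumes "compact_C1 f df"
  obtains R where "R > 0" "\<And>x. norm x \<ge> R \<Longrightarrow> f x = 0 \<and> df x = 0"
proof -
  have "bounded (closure {x. f x \<noteq> 0})"
    using assms compact_C1_def compact_imp_bounded by blast
  then obtain R where R: "R > 0" "closure {x. f x \<noteq> 0} \<subseteq> ball 0 R"
    using bounded_subset_ballD by blast
  have "f x = 0 \<and> df x = 0" if "norm x \<ge> R" for x
  proof -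
    have "x \<notin> closure {x. f x \<noteq> 0}" using R that by auto
    then show ?thesis using compact_C1_gradient_outside[OF assms] by blast
  qed
  then show ?thesis using that R(1) by blast
qed

lemma compact_C1_bounded:
  assumes "compact_C1 f df"
  obtains B where "B \<ge> 0" "\<And>x. \<bar>f x\<bar> \<le> B" "\<And>x. norm (df x) \<le> B"
proof -
  obtain R where R: "R > 0" "\<And>x. norm x \<ge> R \<Longrightarrow> f x = 0 \<and> df x = 0"
    using compact_C1_bounded_support[OF assms] by blast
  have c: "continuous_on UNIV f" "continuous_on UNIV df"
    using compact_C1_continuous[OF assms] by auto
  have "bounded (f ` cball 0 R)" "bounded (df ` cball 0 R)"
    using c by (metis compact_cball compact_continuous_image compact_imp_bounded continuous_on_subset subset_UNIV)+
  then obtain B1 B2 where B: "\<And>x. x \<in> cball 0 R \<Longrightarrow> norm (f x) \<le> B1"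
     "\<And>x. x \<in> cball 0 R \<Longrightarrow> norm (df x) \<le> B2"
    unfolding bounded_iff by (metis image_eqI)
  show ?thesis
  proof (rule that[of "max 0 (max B1 B2)"])
    fix x show "\<bar>f x\<bar> \<le> max 0 (max B1 B2)"
      using B(1)[of x] R(2)[of x] by (cases "norm x \<le> R") auto
    show "norm (df x) \<le> max 0 (max B1 B2)"
      using B(2)[of x] R(2)[of x] by (cases "norm x \<le> R") auto
  qed simp
qed

lemma borel_measurable_lebesgueI:
  "f \<in> borel_measurable borel \<Longrightarrow> f \<in> borel_measurable lebesgue"
  by (simp add: measurable_completion)

lemma continuous_measurable_lebesgue:
  fixes f :: "'a::euclidean_space \<Rightarrow> 'b::topological_space"
  shows "continuous_on UNIV f \<Longrightarrow> f \<in> borel_measurable lebesgue"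
  by (intro borel_measurable_lebesgueI borel_measurable_continuous_onI)

lemma integrable_bounded_support:
  fixes f :: "'a::euclidean_space \<Rightarrow> 'b::{banach, second_countable_topology}"
  assumes "f \<in> borel_measurable lebesgue" "\<And>x. norm (f x) \<le> B" "\<And>x. norm x \<ge> R \<Longrightarrow> f x = 0"
  shows "integrable lebesgue f"
proof (rule Bochner_Integration.integrable_bound)
  show "integrable lebesgue (\<lambda>x. B * indicator (cball (0::'a) R) x)"
    by (intro integrable_mult_right)
       (simp add: integrable_indicator_iff emeasure_lborel_cball_finite[unfolded infinity_ennreal_def])
  have "B \<ge> 0" using order_trans[OF norm_ge_zero assms(2)] .
  then show "AE x in lebesgue. norm (f x) \<le> norm (B * indicator (cball (0::'a) R) x)"
  proof (intro AE_I2)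
    fix x
    show "norm (f x) \<le> norm (B * indicator (cball 0 R) x)"
      using assms(2)[of x] assms(3)[of x] \<open>B \<ge> 0\<close> by (cases "norm x \<le> R") auto
  qed
qed (rule assms(1))

lemma compact_C1_integrable:
  assumes "compact_C1 f df"
  shows "integrable lebesgue f" "integrable lebesgue df"
proof -
  obtain R where R: "R > 0" "\<And>x. norm x \<ge> R \<Longrightarrow> f x = 0 \<and> df x = 0"
    using compact_C1_bounded_support[OF assms] by blast
  obtain B where B: "B \<ge> 0" "\<And>x. \<bar>f x\<bar> \<le> B" "\<And>x. norm (df x) \<le> B"
    using compact_C1_bounded[OF assms] by blast
  have c: "continuous_on UNIV f" "continuous_on UNIV df"
    using compact_C1_continuous[OF assms] by auto
  show "integrable lebesgue f"
    by (rule integrable_bounded_support[OF continuous_measurable_lebesgue[OF c(1)], where R = R])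
      (simp only: real_norm_def, rule B(2), simp add: R(2))
  show "integrable lebesgue df"
    by (rule integrable_bounded_support[OF continuous_measurable_lebesgue[OF c(2)], where R = R])
      (rule B(3), simp add: R(2))
qed

lemma integral_translate:
  fixes f :: "'a::euclidean_space \<Rightarrow> real"
  assumes "f \<in> borel_measurable borel"
  shows "(LINT x|lebesgue. f (a + x)) = (LINT x|lebesgue. f x)"
    "integrable lebesgue f \<Longrightarrow> integrable lebesgue (\<lambda>x. f (a + x))"
proof -
  have [measurable]: "f \<in> borel_measurable borel" using assms .
  have "(LINT x|lebesgue. f x) = (LINT x|lborel. f x)" by (simp add: integral_completion)
  also have "\<dots> = (LINT x|distr lborel borel ((+) a). f x)"
    by (subst lborel_distr_plus) simp
  also have "\<dots> = (LINT x|lborel. f (a + x))" by (subst integral_distr) auto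
  also have "\<dots> = (LINT x|lebesgue. f (a + x))" by (subst integral_completion) auto
  finally show "(LINT x|lebesgue. f (a + x)) = (LINT x|lebesgue. f x)" ..
  assume "integrable lebesgue f"
  then have "integrable lborel f" by (simp add: integrable_completion)
  then have "integrable (distr lborel borel ((+) a)) f" by (subst lborel_distr_plus) simp
  then have "integrable lborel (\<lambda>x. f (a + x))" by (subst (asm) integrable_distr_eq) auto
  then show "integrable lebesgue (\<lambda>x. f (a + x))" by (subst integrable_completion) auto
qed

text \<open>
  Translation invariance of Lebesgue measure: the difference quotients of \<open>f\<close> in direction \<open>e\<close>
  have integral 0, and they converge boundedly, on a common bounded set, to the directional
  derivative. Every integration by parts on the space goes back to this fact.
\<close>

lemma integral_gradient_eq_0:
  assumes "compact_C1 f df"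
  shows "(LINT x|lebesgue. df x \<bullet> e) = 0"
proof -
  obtain R where R: "R > 0" "\<And>x. norm x \<ge> R \<Longrightarrow> f x = 0 \<and> df x = 0"
    using compact_C1_bounded_support[OF assms] by blast
  obtain B where B: "B \<ge> 0" "\<And>x. \<bar>f x\<bar> \<le> B" "\<And>x. norm (df x) \<le> B"
    using compact_C1_bounded[OF assms] by blast
  have c: "continuous_on UNIV f" "continuous_on UNIV df"
    using compact_C1_continuous[OF assms] by auto
  have fm[measurable]: "f \<in> borel_measurable borel" "df \<in> borel_measurable borel"
    using c by (auto intro: borel_measurable_continuous_onI)
  have D: "(f has_derivative (\<lambda>h. h \<bullet> df x)) (at x)" for x
    using assms unfolding compact_C1_def gderiv_def by blast
  define t where "t n = inverse (real (Suc n))" for n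
  have tpos: "t n > 0" "t n \<le> 1" for n by (auto simp: t_def field_simps)
  have tlim: "t \<longlonglongrightarrow> 0" unfolding t_def by (rule LIMSEQ_inverse_real_of_nat)
  define q where "q n x = (f (t n *\<^sub>R e + x) - f x) / t n" for n x
  have lin: "((\<lambda>s. f (s *\<^sub>R e + x)) has_real_derivative (e \<bullet> df (s *\<^sub>R e + x))) (at s)" for s x
  proof -
    have "((\<lambda>s. f (s *\<^sub>R e + x)) has_derivative (\<lambda>h. (h *\<^sub>R e) \<bullet> df (s *\<^sub>R e + x))) (at s)"
    proof -
      have "((\<lambda>s. s *\<^sub>R e + x) has_derivative (\<lambda>h. h *\<^sub>R e)) (at s)"
        by (auto intro!: derivative_eq_intros)
      from has_derivative_compose[OF this D] show ?thesis .
    qed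
    then show ?thesis unfolding has_field_derivative_def by (simp add: mult_commute_abs)
  qed
  have lim: "(\<lambda>n. q n x) \<longlonglongrightarrow> df x \<bullet> e" for x
  proof -
    have "((\<lambda>h. (f (h *\<^sub>R e + x) - f (0 *\<^sub>R e + x)) / h) \<longlongrightarrow> e \<bullet> df (0 *\<^sub>R e + x)) (at 0)"
      using lin[of x 0] unfolding DERIV_def by simp
    moreover have "filterlim t (at 0) sequentially"
      using tlim tpos by (auto simp: filterlim_at less_imp_neq[symmetric] intro!: always_eventually)
    ultimately show ?thesis unfolding q_def
      using filterlim_compose[of _ _ "at 0" t sequentially] by (simp add: inner_commute[of e])
  qed
  have bound: "\<bar>q n x\<bar> \<le> B * norm e" for n x
  proof -
    obtain z where "0 < z" "z < t n"
      "f (t n *\<^sub>R e + x) - f (0 *\<^sub>R e + x) = (t n - 0) * (e \<bullet> df (z *\<^sub>R e + x))"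
      using MVT2[of 0 "t n" "\<lambda>s. f (s *\<^sub>R e + x)" "\<lambda>s. e \<bullet> df (s *\<^sub>R e + x)"] tpos lin by blast
    then have "q n x = e \<bullet> df (z *\<^sub>R e + x)" unfolding q_def using tpos[of n] by (simp add: field_simps)
    moreover have "\<bar>e \<bullet> df (z *\<^sub>R e + x)\<bar> \<le> norm e * norm (df (z *\<^sub>R e + x))"
      by (rule Cauchy_Schwarz_ineq2)
    moreover have "norm e * norm (df (z *\<^sub>R e + x)) \<le> norm e * B"
      by (intro mult_left_mono B) auto
    ultimately show ?thesis by (simp add: mult.commute)
  qed
  have outside: "q n x = 0" if "norm x \<ge> R + norm e" for n x
  proof -
    have "norm (t n *\<^sub>R e) \<le> norm e"
      using tpos[of n] by (simp add: mult_left_le_one_le)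
    moreover have "norm x \<le> norm (t n *\<^sub>R e + x) + norm (t n *\<^sub>R e)"
      by (metis add.commute add_diff_cancel_right' norm_triangle_ineq4)
    ultimately have "norm (t n *\<^sub>R e + x) \<ge> R" "norm x \<ge> R" using that norm_ge_zero[of e] by linarith+
    then show ?thesis unfolding q_def using R by simp
  qed
  have "(\<lambda>n. LINT x|lebesgue. q n x) \<longlonglongrightarrow> (LINT x|lebesgue. df x \<bullet> e)"
  proof (rule integral_dominated_convergence[where w = "\<lambda>x. B * norm e * indicator (cball 0 (R + norm e)) x"])
    show "integrable lebesgue (\<lambda>x. B * norm e * indicator (cball (0::'a) (R + norm e)) x)"
      by (intro integrable_mult_right)
       (simp add: integrable_indicator_iff emeasure_lborel_cball_finite[unfolded infinity_ennreal_def])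
    show "AE x in lebesgue. norm (q n x) \<le> B * norm e * indicator (cball 0 (R + norm e)) x" for n
    proof (intro AE_I2)
      fix x
      show "norm (q n x) \<le> B * norm e * indicator (cball 0 (R + norm e)) x"
        using bound[of n x] outside[of x n] by (cases "norm x \<le> R + norm e") auto
    qed
    show "(\<lambda>x. df x \<bullet> e) \<in> borel_measurable lebesgue"
      by (rule borel_measurable_lebesgueI) simp
    show "(\<lambda>x. q n x) \<in> borel_measurable lebesgue" for n
      unfolding q_def by (rule borel_measurable_lebesgueI) simp
  qed (use lim in auto)
  moreover have "(LINT x|lebesgue. q n x) = 0" for n
  proof -
    have "(LINT x|lebesgue. q n x) = ((LINT x|lebesgue. f (t n *\<^sub>R e + x)) - (LINT x|lebesgue. f x)) / t n"
      unfolding q_def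
      using compact_C1_integrable(1)[OF assms] integral_translate(2)[OF fm(1)]
      by simp
    then show ?thesis using integral_translate(1)[OF fm(1)] by simp
  qed
  ultimately have "(\<lambda>n. 0) \<longlonglongrightarrow> (LINT x|lebesgue. df x \<bullet> e)" by simp
  then show ?thesis by (rule LIMSEQ_unique[OF _ tendsto_const])
qed

section \<open>The fundamental lemma of the calculus of variations\<close>

text \<open>
  The sets over which \<open>g\<close> has integral 0 contain the boxes, a generator of the Borel sets that is
  closed under intersections, and they are closed under complements and disjoint unions. Hence
  \<open>g\<close> has integral 0 over every Borel set.
\<close>

lemma AE_zero_if_box_integrals_zero:
  fixes g :: "'a::euclidean_space \<Rightarrow> real"
  assumes g: "integrable lebesgue g"
    and box: "\<And>a b. (LINT x|lebesgue. indicator (box a b) x * g x) = 0"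
  shows "AE x in lebesgue. g x = 0"
proof -
  obtain g' where g'[measurable]: "g' \<in> borel_measurable lborel" and eq: "AE x in lborel. g x = g' x"
    using completion_ex_borel_measurable_real[OF borel_measurable_integrable[OF g]] by blast
  have eq': "AE x in lebesgue. g x = g' x" using eq AE_completion by blast
  have gm[measurable]: "g \<in> borel_measurable lebesgue" by (rule borel_measurable_integrable[OF g])
  have int': "integrable lborel g'"
  proof -
    have "integrable lebesgue g'"
      by (rule integrable_cong_AE_imp[OF g borel_measurable_lebesgueI]) (use eq' g' in auto)
    then show ?thesis by (simp add: integrable_completion)
  qed
  have seti: "integrable lborel (\<lambda>x. indicator A x * g' x)" if "A \<in> sets borel" for A
    using integrable_mult_indicator[of A lborel g'] int' that by simp
  have box': "(LINT x|lborel. indicator (box a b) x * g' x) = 0" for a b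
  proof -
    have "(LINT x|lborel. indicator (box a b) x * g' x) = (LINT x|lebesgue. indicator (box a b) x * g' x)"
      by (subst integral_completion) auto
    also have "\<dots> = (LINT x|lebesgue. indicator (box a b) x * g x)"
    proof (rule integral_cong_AE)
      show "(\<lambda>x. indicator (box a b) x * g' x) \<in> borel_measurable lebesgue"
        by (rule borel_measurable_lebesgueI) (use g' in simp)
      show "(\<lambda>x. indicator (box a b) x * g x) \<in> borel_measurable lebesgue"
        by (intro borel_measurable_times gm borel_measurable_lebesgueI[of "indicator (box a b)"]) simp
      show "AE x in lebesgue. indicator (box a b) x * g' x = indicator (box a b) x * g x"
        using eq' by eventually_elim simp
    qed
    finally show ?thesis using box by simp
  qed
  \<comment> \<open>the whole space is an increasing union of boxes; this starts the closure under complements\<close>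
  have total: "(LINT x|lborel. g' x) = 0"
  proof -
    define A where "A n = box (- real n *\<^sub>R One) (real n *\<^sub>R (One::'a))" for n
    have "(\<lambda>n. LINT x|lborel. indicator (A n) x * g' x) \<longlonglongrightarrow> (LINT x|lborel. g' x)"
    proof (rule integral_dominated_convergence[where w = "\<lambda>x. norm (g' x)"])
      show "AE x in lborel. (\<lambda>n. indicator (A n) x * g' x) \<longlonglongrightarrow> g' x"
      proof (rule AE_I2)
        fix x
        have "x \<in> (\<Union>n. A n)" unfolding A_def using UN_box_eq_UNIV by auto
        then obtain n where n: "x \<in> A n" by auto
        have "A n \<subseteq> A m" if "n \<le> m" for m unfolding A_def using that
          by (auto simp: subset_box)
        then have "eventually (\<lambda>m. indicator (A m) x * g' x = g' x) sequentially"
          using n by (auto simp: eventually_sequentially indicator_def intro!: exI[of _ n])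
        then show "(\<lambda>n. indicator (A n) x * g' x) \<longlonglongrightarrow> g' x"
          by (rule tendsto_eventually)
      qed
      show "integrable lborel (\<lambda>x. norm (g' x))" using int' by simp
    qed (auto simp: A_def indicator_def)
    then show ?thesis using box' unfolding A_def by (simp add: LIMSEQ_const_iff)
  qed
  have "(LINT x|lborel. indicator A x * g' x) = 0" if "A \<in> sets borel" for A
  proof -
    have sb: "sets borel = sigma_sets UNIV (range (\<lambda>(a, b). box a (b::'a)))"
      unfolding borel_eq_box by simp
    have "Int_stable (range (\<lambda>(a, b). box a (b::'a)))"
    proof (rule Int_stableI)
      fix A B :: "'a set" assume "A \<in> range (\<lambda>(a, b). box a b)" "B \<in> range (\<lambda>(a, b). box a b)"
      then obtain a b c d where "A = box a b" "B = box c d" by auto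
      then obtain p q where "A \<inter> B = box p q" using box_Int_box[of a b c d] by blast
      then show "A \<inter> B \<in> range (\<lambda>(a, b). box a b)" by (auto intro!: image_eqI[of _ _ "(p, q)"])
    qed
    moreover have "range (\<lambda>(a, b). box a (b::'a)) \<subseteq> Pow UNIV" by simp
    moreover have "A \<in> sigma_sets UNIV (range (\<lambda>(a, b). box a (b::'a)))" using that sb by simp
    ultimately show ?thesis
    proof (induction rule: sigma_sets_induct_disjoint)
      case (basic A)
      then show ?case using box' by auto
    next
      case empty
      then show ?case by simp
    next
      case (compl A)
      then have "A \<in> sets borel" using sb by simp
      then have "(LINT x|lborel. g' x - indicator A x * g' x) = 0"
        using int' seti compl total by (subst Bochner_Integration.integral_diff) auto
      moreover have "indicator (UNIV - A) x * g' x = g' x - indicator A x * g' x" for x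
        by (simp add: indicator_def)
      ultimately show ?case by simp
    next
      case (union A)
      then have Ab: "\<And>i. A i \<in> sets borel" using sb by auto
      have "(\<lambda>n. LINT x|lborel. indicator (\<Union>i<n. A i) x * g' x) \<longlonglongrightarrow> (LINT x|lborel. indicator (\<Union>i. A i) x * g' x)"
      proof (rule integral_dominated_convergence[where w = "\<lambda>x. norm (g' x)"])
        show "AE x in lborel. (\<lambda>n. indicator (\<Union>i<n. A i) x * g' x) \<longlonglongrightarrow> indicator (\<Union>i. A i) x * g' x"
          by (intro AE_I2 tendsto_mult LIMSEQ_indicator_UN tendsto_const)
        show "integrable lborel (\<lambda>x. norm (g' x))" using int' by simp
      qed (use Ab in \<open>auto simp: indicator_def\<close>)
      moreover have "(LINT x|lborel. indicator (\<Union>i<n. A i) x * g' x) = 0" for n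
      proof -
        have "indicator (\<Union>i<n. A i) x = (\<Sum>i<n. indicator (A i) x :: real)" for x
          using union(1) by (subst indicator_UN_disjoint) (auto simp: disjoint_family_on_def)
        then have "(LINT x|lborel. indicator (\<Union>i<n. A i) x * g' x) = (LINT x|lborel. (\<Sum>i<n. indicator (A i) x * g' x))"
          by (simp add: sum_distrib_right)
        also have "\<dots> = (\<Sum>i<n. LINT x|lborel. indicator (A i) x * g' x)"
          using seti Ab by (intro Bochner_Integration.integral_sum) auto
        finally show ?thesis using union by simp
      qed
      ultimately show ?case by (simp add: LIMSEQ_const_iff)
    qed
  qed
  then have "AE x in lborel. g' x = 0"
    using int' by (intro density_unique_real) (auto simp: set_lebesgue_integral_def)
  then have "AE x in lebesgue. g' x = 0" by (rule AE_completion)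
  then show ?thesis using eq' by auto
qed

text \<open>
  The squared positive part is the simplest function that is C1 and vanishes exactly on a
  half-line; all bump functions below are built from it.
\<close>

lemma C1_max_square: "C1 (\<lambda>t. (max 0 t)\<^sup>2) (\<lambda>t::real. 2 * max 0 t)"
proof -
  have "((\<lambda>t. (max 0 t)\<^sup>2) has_real_derivative 2 * max 0 t) (at t)" for t :: real
  proof (cases t "0::real" rule: linorder_cases)
    case less
    show ?thesis
      by (rule has_field_derivative_transform_within_open[where f = "\<lambda>t. 0" and S = "{..<0}"])
         (use less in auto)
  next
    case greater
    show ?thesis
      by (rule has_field_derivative_transform_within_open[where f = "\<lambda>t. t\<^sup>2" and S = "{0<..}"])
         (use greater in \<open>auto intro!: derivative_eq_intros\<close>)
  next
    case equal
    have "((\<lambda>h. ((max 0 (0 + h))\<^sup>2 - (max 0 0)\<^sup>2) / h) \<longlongrightarrow> (0::real)) (at 0)"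
    proof (rule Lim_null_comparison)
      show "\<forall>\<^sub>F h in at 0. norm (((max 0 (0 + h))\<^sup>2 - (max 0 0)\<^sup>2) / h) \<le> \<bar>h::real\<bar>"
        by (rule always_eventually) (auto simp: max_def power2_eq_square)
      show "((\<lambda>h::real. \<bar>h\<bar>) \<longlongrightarrow> 0) (at 0)"
        by (rule tendsto_eq_intros | simp)+
    qed
    then show ?thesis using equal unfolding DERIV_def by simp
  qed
  then show ?thesis unfolding C1_def by (auto intro!: continuous_intros)
qed

lemma box_bump:
  fixes a b :: "'a::euclidean_space"
  obtains m dm where "C1 m dm" "\<And>x. m x \<ge> 0" "\<And>x. m x > 0 \<longleftrightarrow> x \<in> box a b"
proof -
  define p where "p i x = (max 0 ((x \<bullet> i - a \<bullet> i) * (b \<bullet> i - x \<bullet> i)))\<^sup>2" for i and x :: 'a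
  have c1: "\<exists>d. C1 (p i) d" for i
  proof -
    have 1: "C1 (\<lambda>x::'a. x \<bullet> i + (- (a \<bullet> i))) (\<lambda>x. i)" "C1 (\<lambda>x::'a. b \<bullet> i - x \<bullet> i) (\<lambda>x. - i)"
      unfolding C1_def gderiv_def by (auto intro!: derivative_eq_intros)
    from C1_compose[OF C1_mult[OF this] C1_max_square] show ?thesis
      unfolding p_def by auto
  qed
  then obtain d where d: "C1 (\<lambda>x. \<Prod>i\<in>Basis. p i x) d" using C1_prod[of Basis p] by auto
  have nn: "p i x \<ge> 0" for i x by (simp add: p_def)
  have pos: "p i x > 0 \<longleftrightarrow> a \<bullet> i < x \<bullet> i \<and> x \<bullet> i < b \<bullet> i" if "box a b \<noteq> {}" "i \<in> Basis" for i x
  proof -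
    have ab: "a \<bullet> i < b \<bullet> i" using that box_ne_empty(2) by blast
    have "p i x > 0 \<longleftrightarrow> (x \<bullet> i - a \<bullet> i) * (b \<bullet> i - x \<bullet> i) > 0"
    proof -
      have "(max 0 t)\<^sup>2 > 0 \<longleftrightarrow> t > 0" for t :: real by (auto simp: max_def)
      then show ?thesis by (simp add: p_def)
    qed
    also have "\<dots> \<longleftrightarrow> a \<bullet> i < x \<bullet> i \<and> x \<bullet> i < b \<bullet> i" using ab by (auto simp: zero_less_mult_iff)
    finally show ?thesis .
  qed
  show ?thesis
  proof (cases "box a b = {}")
    case True
    show ?thesis by (rule that[OF C1_const[of 0]]) (use True in auto)
  next
    case False
    show ?thesis
    proof (rule that[OF d])
      fix x show "0 \<le> (\<Prod>i\<in>Basis. p i x)" by (intro prod_nonneg nn)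
      have "0 < (\<Prod>i\<in>Basis. p i x) \<longleftrightarrow> (\<forall>i\<in>Basis. p i x > 0)"
      proof
        assume "0 < (\<Prod>i\<in>Basis. p i x)"
        then have "\<forall>i\<in>Basis. p i x \<noteq> 0" by (metis finite_Basis less_irrefl prod_zero)
        then show "\<forall>i\<in>Basis. p i x > 0" using nn by (simp add: order_less_le)
      qed (auto intro!: prod_pos)
      then show "0 < (\<Prod>i\<in>Basis. p i x) \<longleftrightarrow> x \<in> box a b"
        using pos[OF False] by (auto simp: mem_box)
    qed
  qed
qed

text \<open>
  With \<open>m\<close> a C1 function that is positive exactly on a box, the functions \<open>k m\<^sup>2 / (1 + k m\<^sup>2)\<close> are
  C1, take values in \<open>[0, 1]\<close> and converge to the indicator of the box as \<open>k\<close> grows. So the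
  hypothesis passes to indicators of boxes whose closure lies in \<open>S\<close>, and countably many such
  boxes cover \<open>S\<close>.
\<close>

lemma fundamental_lemma_of_variations:
  fixes f :: "'a::euclidean_space \<Rightarrow> real"
  assumes S: "open S"
    and f: "\<And>K. compact K \<Longrightarrow> K \<subseteq> S \<Longrightarrow> set_integrable lebesgue K f"
    and zero: "\<And>\<phi> d\<phi>. compact_C1 \<phi> d\<phi> \<Longrightarrow> closure {x. \<phi> x \<noteq> 0} \<subseteq> S \<Longrightarrow> (LINT x|lebesgue. f x * \<phi> x) = 0"
  shows "AE x in lebesgue. x \<in> S \<longrightarrow> f x = 0"
proof -
  have box0: "(LINT x|lebesgue. indicator (box a b) x * f x) = 0" if sub: "cbox a b \<subseteq> S" for a b
  proof -
    obtain m dm where m: "C1 m dm" "\<And>x. m x \<ge> 0" "\<And>x. m x > 0 \<longleftrightarrow> x \<in> box a b"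
      using box_bump[of a b] by blast
    have \<theta>: "C1 (\<lambda>s. real k * s\<^sup>2 / (1 + real k * s\<^sup>2)) (\<lambda>s. 2 * real k * s / (1 + real k * s\<^sup>2)\<^sup>2)" for k
    proof -
      have nz: "1 + real k * s\<^sup>2 \<noteq> 0" for s by (metis add_pos_nonneg less_irrefl mult_nonneg_nonneg of_nat_0_le_iff zero_le_power2 zero_less_one)
      have "((\<lambda>s. real k * s\<^sup>2 / (1 + real k * s\<^sup>2)) has_real_derivative 2 * real k * s / (1 + real k * s\<^sup>2)\<^sup>2) (at s)" for s
      proof -
        have "((\<lambda>s. real k * s\<^sup>2 / (1 + real k * s\<^sup>2)) has_real_derivative
            ((2 * real k * s) * (1 + real k * s\<^sup>2) - (real k * s\<^sup>2) * (2 * real k * s)) / ((1 + real k * s\<^sup>2) * (1 + real k * s\<^sup>2))) (at s)"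
          by (rule DERIV_divide) (auto intro!: derivative_eq_intros simp: nz)
        moreover have "(2 * real k * s) * (1 + real k * s\<^sup>2) - (real k * s\<^sup>2) * (2 * real k * s) = 2 * real k * s"
          by (simp add: algebra_simps)
        ultimately show ?thesis by (simp add: power2_eq_square[of "1 + real k * s\<^sup>2"])
      qed
      then show ?thesis unfolding C1_def
        using nz by (auto intro!: continuous_intros)
    qed
    define \<phi> where "\<phi> k x = real k * (m x)\<^sup>2 / (1 + real k * (m x)\<^sup>2)" for k x
    have out: "\<phi> k x = 0" if "x \<notin> box a b" for k x
    proof -
      have "m x = 0" using m(2)[of x] m(3)[of x] that by simp
      then show ?thesis by (simp add: \<phi>_def)
    qed
    have den: "1 + real k * s\<^sup>2 \<ge> 1" for k s by simp
    have bd: "0 \<le> \<phi> k x" "\<phi> k x \<le> 1" for k x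
    proof -
      have "1 + real k * (m x)\<^sup>2 > 0" using den[of k "m x"] by linarith
      then show "0 \<le> \<phi> k x" "\<phi> k x \<le> 1" unfolding \<phi>_def by auto
    qed
    have c1: "C1 (\<phi> k) (\<lambda>x. (2 * real k * m x / (1 + real k * (m x)\<^sup>2)\<^sup>2) *\<^sub>R dm x)" for k
      using C1_compose[OF m(1) \<theta>] unfolding \<phi>_def .
    have z: "(LINT x|lebesgue. f x * \<phi> k x) = 0" for k
    proof (rule zero)
      show "compact_C1 (\<phi> k) (\<lambda>x. (2 * real k * m x / (1 + real k * (m x)\<^sup>2)\<^sup>2) *\<^sub>R dm x)"
        by (rule compact_C1I(1)[OF c1 compact_cbox[of a b]]) (use out box_subset_cbox in blast)
      have "closure {x. \<phi> k x \<noteq> 0} \<subseteq> cbox a b"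
        by (rule compact_C1I(2)[OF c1 compact_cbox[of a b]]) (use out box_subset_cbox in blast)
      then show "closure {x. \<phi> k x \<noteq> 0} \<subseteq> S" using sub by blast
    qed
    have fi: "set_integrable lebesgue (cbox a b) f" using f[OF compact_cbox sub] .
    have fm[measurable]: "(\<lambda>x. indicator (cbox a b) x * f x) \<in> borel_measurable lebesgue"
      using fi unfolding set_integrable_def by auto
    have [measurable]: "\<phi> k \<in> borel_measurable lebesgue" for k
      using C1_continuous[OF c1] by (rule continuous_measurable_lebesgue)
    have e1: "f x * \<phi> k x = (indicator (cbox a b) x * f x) * \<phi> k x" for k x
      using out[of x k] box_subset_cbox[of a b] by (auto simp: indicator_def)
    have e2: "indicator (box a b) x * f x = indicator (box a b) x * (indicator (cbox a b) x * f x)" for x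
      using box_subset_cbox[of a b] by (auto simp: indicator_def)
    have "(\<lambda>k. LINT x|lebesgue. f x * \<phi> k x) \<longlonglongrightarrow> (LINT x|lebesgue. indicator (box a b) x * f x)"
    proof (rule integral_dominated_convergence[where w = "\<lambda>x. norm (indicator (cbox a b) x * f x)"])
      show "(\<lambda>x. f x * \<phi> k x) \<in> borel_measurable lebesgue" for k
        unfolding e1 by measurable
      show "(\<lambda>x. indicator (box a b) x * f x) \<in> borel_measurable lebesgue"
        unfolding e2 by (intro borel_measurable_times borel_measurable_indicator fm) auto
      show "integrable lebesgue (\<lambda>x. norm (indicator (cbox a b) x * f x))"
        using fi unfolding set_integrable_def by (intro integrable_norm) simp
      show "AE x in lebesgue. norm (f x * \<phi> k x) \<le> norm (indicator (cbox a b) x * f x)" for k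
        unfolding e1 using bd[of k] by (intro AE_I2) (simp add: abs_mult mult_left_le)
      show "AE x in lebesgue. (\<lambda>k. f x * \<phi> k x) \<longlonglongrightarrow> indicator (box a b) x * f x"
      proof (rule AE_I2)
        fix x
        have "(\<lambda>k. \<phi> k x) \<longlonglongrightarrow> indicator (box a b) x"
        proof (cases "x \<in> box a b")
          case False
          then show ?thesis using out by simp
        next
          case True
          then have p: "(m x)\<^sup>2 > 0" using m(3)[of x] by simp
          have "(\<lambda>k. 1 - 1 / (1 + real k * (m x)\<^sup>2)) \<longlonglongrightarrow> 1 - 0"
          proof (intro tendsto_diff tendsto_const tendsto_divide_0[OF tendsto_const] filterlim_at_top_imp_at_infinity)
            show "filterlim (\<lambda>k. 1 + real k * (m x)\<^sup>2) at_top sequentially"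
              by (intro filterlim_tendsto_add_at_top[OF tendsto_const]
                  filterlim_at_top_mult_tendsto_pos[OF tendsto_const p] filterlim_real_sequentially)
          qed
          moreover have "1 - 1 / (1 + real k * (m x)\<^sup>2) = \<phi> k x" for k
          proof -
            have "1 + real k * (m x)\<^sup>2 \<noteq> 0" using den[of k "m x"] by linarith
            then show ?thesis unfolding \<phi>_def by (simp add: field_simps)
          qed
          ultimately show ?thesis using True by simp
        qed
        from tendsto_mult[OF tendsto_const[of "f x"] this]
        show "(\<lambda>k. f x * \<phi> k x) \<longlonglongrightarrow> indicator (box a b) x * f x" by (simp add: mult.commute)
      qed
    qed
    then show ?thesis using z by (simp add: LIMSEQ_const_iff)
  qed
  have local: "AE x in lebesgue. x \<in> box a b \<longrightarrow> f x = 0" if sub: "cbox a b \<subseteq> S" for a b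
  proof -
    have "AE x in lebesgue. indicator (box a b) x * f x = 0"
    proof (rule AE_zero_if_box_integrals_zero)
      have "set_integrable lebesgue (box a b) f"
        using f[OF compact_cbox sub] by (rule set_integrable_subset) (auto simp: box_subset_cbox)
      then show "integrable lebesgue (\<lambda>x. indicator (box a b) x * f x)"
        by (simp add: set_integrable_def)
      fix c d
      obtain p q where pq: "box c d \<inter> box a b = box p q" using box_Int_box[of c d a b] by blast
      have "indicator (box c d) x * (indicator (box a b) x * f x) = indicator (box p q) x * f x" for x
        using pq[symmetric] by (auto simp: indicator_def)
      moreover have "(LINT x|lebesgue. indicator (box p q) x * f x) = 0"
      proof (cases "box p q = {}")
        case False
        have "closure (box p q) \<subseteq> closure (box a b)" using pq by (intro closure_mono) auto
        moreover have "box a b \<noteq> {}" using False pq by auto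
        ultimately have "cbox p q \<subseteq> cbox a b" using False by (simp add: closure_box)
        then show ?thesis using box0 sub by blast
      qed simp
      ultimately show "(LINT x|lebesgue. indicator (box c d) x * (indicator (box a b) x * f x)) = 0" by (simp only:)
    qed
    then show ?thesis by (auto simp: indicator_def elim!: eventually_mono split: if_splits)
  qed
  define F where "F = {box a b | a b. cbox a b \<subseteq> S}"
  obtain \<D> where \<D>: "\<D> \<subseteq> F" "countable \<D>" "\<Union>\<D> = \<Union>F"
    by (rule Lindelof[of F]) (auto simp: F_def)
  have "S \<subseteq> \<Union>F"
  proof
    fix x assume "x \<in> S"
    then obtain a b where "cbox a b \<subseteq> S" "x \<in> box a b"
      using open_contains_cbox[OF S] by metis
    then show "x \<in> \<Union>F" unfolding F_def by blast
  qed
  have "AE x in lebesgue. \<forall>X\<in>\<D>. x \<in> X \<longrightarrow> f x = 0"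
    using \<D>(1,2) local unfolding F_def by (intro AE_ball_countable[THEN iffD2]) blast+
  then show ?thesis using \<D>(3) \<open>S \<subseteq> \<Union>F\<close> by (rule_tac eventually_mono) blast+
qed

section \<open>Polar coordinates for radial weights\<close>

text \<open>
  The area of the sphere of radius \<open>r\<close> in dimension \<open>N\<close>, that is the derivative of the volume of
  the ball. It is set to 0 for \<open>r \<le> 0\<close>, so that integrals over the whole line see the half-line only.
\<close>

definition sphere_density :: "nat \<Rightarrow> real \<Rightarrow> real" where
  "sphere_density N r = (if 0 < r then real N * unit_ball_vol (real N) * r ^ (N - 1) else 0)"

lemma sphere_density_nonneg: "0 \<le> sphere_density N r"
  by (simp add: sphere_density_def)

lemma sphere_density_measurable [measurable]: "sphere_density N \<in> borel_measurable borel"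
  unfolding sphere_density_def by measurable

lemma norm_measurable_lebesgue [measurable]:
  "(norm :: 'a::euclidean_space \<Rightarrow> real) \<in> lebesgue \<rightarrow>\<^sub>M borel"
  by (rule borel_measurable_lebesgueI) simp

text \<open>
  Both measures give the half-line up to \<open>r\<close> the volume of the ball of radius \<open>r\<close>, and such half-lines
  generate the Borel sets. Every later use of polar coordinates goes through this identity.
\<close>

lemma distr_norm_lebesgue:
  "distr lebesgue borel (norm :: 'a::euclidean_space \<Rightarrow> real) =
   density lborel (\<lambda>r. ennreal (sphere_density DIM('a) r))"
proof -
  define N where "N = DIM('a)"
  define \<omega> where "\<omega> = unit_ball_vol (real N)"
  have N: "N \<ge> 1" by (simp add: N_def Suc_leI)
  let ?M = "distr lebesgue borel (norm :: 'a \<Rightarrow> real)"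
  let ?D = "density lborel (\<lambda>r. ennreal (sphere_density DIM('a) r))"
  have M: "emeasure ?M {..r} = (if 0 \<le> r then ennreal (\<omega> * r ^ N) else 0)" for r
  proof -
    have "emeasure ?M {..r} = emeasure lebesgue (norm -` {..r} \<inter> space lebesgue :: 'a set)"
      by (rule emeasure_distr) auto
    also have "norm -` {..r} \<inter> space lebesgue = (cball 0 r :: 'a set)" by auto
    finally have "emeasure ?M {..r} = emeasure lborel (cball 0 r :: 'a set)" by simp
    then show ?thesis by (simp add: emeasure_cball N_def \<omega>_def)
  qed
  have D: "emeasure ?D {..r} = (if 0 \<le> r then ennreal (\<omega> * r ^ N) else 0)" for r
  proof -
    have "emeasure ?D {..r} = (\<integral>\<^sup>+s. ennreal (sphere_density N s) * indicator {..r} s \<partial>lborel)"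
      by (subst emeasure_density) (auto simp: N_def)
    also have "\<dots> = (\<integral>\<^sup>+s. ennreal (real N * \<omega> * s ^ (N - 1)) * indicator {0..r} s \<partial>lborel)"
    proof (rule nn_integral_cong_AE)
      have "AE s in lborel. s \<noteq> (0::real)" by (rule AE_lborel_singleton)
      then show "AE s in lborel. ennreal (sphere_density N s) * indicator {..r} s =
          ennreal (real N * \<omega> * s ^ (N - 1)) * indicator {0..r} s"
        by eventually_elim (auto simp: sphere_density_def \<omega>_def indicator_def)
    qed
    also have "\<dots> = (if 0 \<le> r then ennreal (\<omega> * r ^ N) else 0)"
    proof (cases "0 \<le> r")
      case True
      have "(\<integral>\<^sup>+s. ennreal (real N * \<omega> * s ^ (N - 1)) * indicator {0..r} s \<partial>lborel) = \<omega> * r ^ N - \<omega> * 0 ^ N"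
        by (rule nn_integral_FTC_Icc)
           (use True N in \<open>auto intro!: derivative_eq_intros simp: \<omega>_def\<close>)
      then show ?thesis using True N by (simp add: zero_power)
    next
      case False
      then have "{0..r} = {}" by simp
      then show ?thesis using False by simp
    qed
    finally show ?thesis .
  qed
  show ?thesis
  proof (rule measure_eqI_generator_eq[where \<Omega> = UNIV and E = "range (\<lambda>r::real. {..r})" and A = "\<lambda>n. {..real n}"])
    show "Int_stable (range (\<lambda>r::real. {..r}))"
    proof (rule Int_stableI)
      fix a b :: "real set" assume "a \<in> range (\<lambda>r::real. {..r})" "b \<in> range (\<lambda>r::real. {..r})"
      then obtain r s where "a = {..r}" "b = {..s}" by auto
      then have "a \<inter> b = {..min r s}" by auto
      then show "a \<inter> b \<in> range (\<lambda>r::real. {..r})" by blast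
    qed
    show "(\<Union>i. {..real i}) = UNIV" by (auto intro: real_nat_ceiling_ge)
    show "sets ?M = sigma_sets UNIV (range (\<lambda>r::real. {..r}))"
      by (simp add: borel_eq_atMost)
    show "sets ?D = sigma_sets UNIV (range (\<lambda>r::real. {..r}))"
      by (simp add: borel_eq_atMost)
    show "emeasure ?M {..real i} \<noteq> \<infinity>" for i unfolding M by simp
    show "emeasure ?M X = emeasure ?D X" if "X \<in> range (\<lambda>r::real. {..r})" for X
      using that M D by auto
  qed auto
qed

lemma integral_radial:
  fixes f :: "real \<Rightarrow> real"
  assumes [measurable]: "f \<in> borel_measurable borel"
  shows integrable_radial_iff: "integrable lebesgue (\<lambda>x::'a::euclidean_space. f (norm x)) \<longleftrightarrow>
           integrable lborel (\<lambda>r. sphere_density DIM('a) r * f r)"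
    and "(LINT x|lebesgue. f (norm (x::'a))) = (LINT r|lborel. sphere_density DIM('a) r * f r)"
proof -
  have "integrable lebesgue (\<lambda>x::'a. f (norm x)) \<longleftrightarrow> integrable (distr lebesgue borel (norm :: 'a \<Rightarrow> real)) f"
    by (subst integrable_distr_eq) auto
  also have "\<dots> \<longleftrightarrow> integrable lborel (\<lambda>r. sphere_density DIM('a) r *\<^sub>R f r)"
    unfolding distr_norm_lebesgue by (subst integrable_density) (auto simp: sphere_density_nonneg)
  finally show "integrable lebesgue (\<lambda>x::'a. f (norm x)) \<longleftrightarrow>
           integrable lborel (\<lambda>r. sphere_density DIM('a) r * f r)" by simp
  have "(LINT x|lebesgue. f (norm (x::'a))) = (LINT r|distr lebesgue borel (norm :: 'a \<Rightarrow> real). f r)"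
    by (subst integral_distr) auto
  also have "\<dots> = (LINT r|lborel. sphere_density DIM('a) r *\<^sub>R f r)"
    unfolding distr_norm_lebesgue by (subst integral_density) (auto simp: sphere_density_nonneg)
  finally show "(LINT x|lebesgue. f (norm (x::'a))) = (LINT r|lborel. sphere_density DIM('a) r * f r)" by simp
qed

lemma emeasure_norm_vimage_null:
  assumes "A \<in> null_sets lborel"
  shows "norm -` A \<in> null_sets (lebesgue :: 'a::euclidean_space measure)"
proof -
  have A[measurable]: "A \<in> sets borel" using assms by auto
  have "emeasure lebesgue (norm -` A \<inter> space lebesgue :: 'a set) = emeasure (distr lebesgue borel (norm :: 'a \<Rightarrow> real)) A"
    by (subst emeasure_distr) auto
  also have "\<dots> = (\<integral>\<^sup>+r. ennreal (sphere_density DIM('a) r) * indicator A r \<partial>lborel)"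
    unfolding distr_norm_lebesgue by (subst emeasure_density) auto
  also have "\<dots> = (\<integral>\<^sup>+r. 0 \<partial>(lborel :: real measure))"
  proof (rule nn_integral_cong_AE)
    have "AE r in lborel. r \<notin> A" using assms by (rule AE_not_in)
    then show "AE r in lborel. ennreal (sphere_density DIM('a) r) * indicator A r = 0"
      by eventually_elim simp
  qed
  finally have "emeasure lebesgue (norm -` A :: 'a set) = 0" by simp
  moreover have "norm -` A \<in> sets (lebesgue :: 'a measure)"
    using measurable_sets[OF norm_measurable_lebesgue A] by simp
  ultimately show ?thesis by auto
qed

lemma AE_norm:
  assumes "AE r in lborel. P r"
  shows "AE x in lebesgue. P (norm (x::'a::euclidean_space))"
proof -
  obtain A where A: "A \<in> null_sets lborel" "{r \<in> space lborel. \<not> P r} \<subseteq> A"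
    using assms unfolding eventually_ae_filter by auto
  then show ?thesis
    using emeasure_norm_vimage_null[OF A(1), where 'a = 'a]
    by (auto simp: eventually_ae_filter intro!: bexI[of _ "norm -` A"])
qed

lemma AE_nonzero_lebesgue: "AE x in lebesgue. x \<noteq> (0::'a::euclidean_space)"
  by (rule AE_completion) (rule AE_lborel_singleton)

text \<open>
  The image under the norm of the measure with density \<open>f\<close> is absolutely continuous, because the
  norm pulls null sets back to null sets. Its Radon-Nikodym derivative is finite almost everywhere
  since \<open>f\<close> is integrable on balls.
\<close>

lemma radial_marginal_nonneg:
  fixes f :: "'a::euclidean_space \<Rightarrow> real"
  assumes f [measurable]: "f \<in> borel_measurable lebesgue" and nn: "\<And>x. f x \<ge> 0"
    and fin: "\<And>R. set_integrable lebesgue (cball 0 R) f"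
  obtains q where "q \<in> borel_measurable borel" "\<And>r. q r \<ge> 0"
    "\<And>\<psi>::real \<Rightarrow> ennreal. \<psi> \<in> borel_measurable borel \<Longrightarrow>
       (\<integral>\<^sup>+x. \<psi> (norm x) * ennreal (f x) \<partial>lebesgue) = (\<integral>\<^sup>+r. \<psi> r * ennreal (q r) \<partial>lborel)"
proof -
  let ?F = "density lebesgue (\<lambda>x. ennreal (f x))"
  let ?N = "distr ?F borel (norm :: 'a \<Rightarrow> real)"
  have nm[measurable]: "(norm :: 'a \<Rightarrow> real) \<in> ?F \<rightarrow>\<^sub>M borel" by simp
  have N_int: "(\<integral>\<^sup>+r. \<psi> r \<partial>?N) = (\<integral>\<^sup>+x. \<psi> (norm x) * ennreal (f x) \<partial>lebesgue)"
    if [measurable]: "\<psi> \<in> borel_measurable borel" for \<psi> :: "real \<Rightarrow> ennreal"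
  proof -
    have "(\<integral>\<^sup>+r. \<psi> r \<partial>?N) = (\<integral>\<^sup>+x. \<psi> (norm x) \<partial>?F)" by (rule nn_integral_distr[OF nm]) simp
    also have "\<dots> = (\<integral>\<^sup>+x. ennreal (f x) * \<psi> (norm x) \<partial>lebesgue)"
      by (rule nn_integral_density) auto
    finally show ?thesis by (simp add: mult.commute)
  qed
  have ac: "absolutely_continuous lborel ?N"
    unfolding absolutely_continuous_def
  proof
    fix A :: "real set" assume A: "A \<in> null_sets lborel"
    then have Ab[measurable]: "A \<in> sets borel" by auto
    have "emeasure ?N A = (\<integral>\<^sup>+r. indicator A r \<partial>?N)" by simp
    also have "\<dots> = (\<integral>\<^sup>+x. indicator A (norm x) * ennreal (f x) \<partial>lebesgue)" by (rule N_int) simp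
    also have "\<dots> = (\<integral>\<^sup>+x. 0 \<partial>(lebesgue :: 'a measure))"
    proof (rule nn_integral_cong_AE)
      have "AE x in lebesgue. x \<notin> norm -` A" using emeasure_norm_vimage_null[OF A] by (rule AE_not_in)
      then show "AE x in lebesgue. indicator A (norm x) * ennreal (f (x::'a)) = 0"
        by eventually_elim simp
    qed
    finally show "A \<in> null_sets ?N" by (simp add: null_sets_def)
  qed
  obtain g where g[measurable]: "g \<in> borel_measurable lborel" and gN: "density lborel g = ?N"
    using sigma_finite_measure.Radon_Nikodym[OF sigma_finite_lborel ac] by auto
  have g_int: "(\<integral>\<^sup>+x. \<psi> (norm x) * ennreal (f x) \<partial>lebesgue) = (\<integral>\<^sup>+r. \<psi> r * g r \<partial>lborel)"
    if [measurable]: "\<psi> \<in> borel_measurable borel" for \<psi> :: "real \<Rightarrow> ennreal"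
  proof -
    have "(\<integral>\<^sup>+x. \<psi> (norm x) * ennreal (f x) \<partial>lebesgue) = (\<integral>\<^sup>+r. \<psi> r \<partial>density lborel g)"
      unfolding gN by (rule N_int[symmetric]) simp
    also have "\<dots> = (\<integral>\<^sup>+r. g r * \<psi> r \<partial>lborel)" by (rule nn_integral_density) auto
    finally show ?thesis by (simp add: mult.commute)
  qed
  have "AE r in lborel. \<forall>n::nat. indicator {..real n} r * g r \<noteq> \<infinity>"
  proof (subst AE_all_countable, intro allI)
    fix n
    have "(\<integral>\<^sup>+r. indicator {..real n} r * g r \<partial>lborel) = (\<integral>\<^sup>+x. indicator {..real n} (norm x) * ennreal (f x) \<partial>lebesgue)"
      by (rule g_int[symmetric]) simp
    also have "\<dots> = (\<integral>\<^sup>+x. ennreal (norm (indicator (cball 0 (real n)) x *\<^sub>R f x)) \<partial>lebesgue)"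
      by (rule nn_integral_cong) (auto simp: indicator_def nn)
    also have "\<dots> < \<infinity>"
      using fin[of "real n"] unfolding set_integrable_def integrable_iff_bounded by blast
    finally show "AE r in lborel. indicator {..real n} r * g r \<noteq> \<infinity>"
      by (intro nn_integral_PInf_AE) auto
  qed
  then have "AE r in lborel. g r \<noteq> \<infinity>"
  proof eventually_elim
    case (elim r)
    have "r \<le> real (nat \<lceil>r\<rceil>)" by (rule real_nat_ceiling_ge)
    then show ?case using elim[rule_format, of "nat \<lceil>r\<rceil>"] by simp
  qed
  then have gfin: "AE r in lborel. ennreal (enn2real (g r)) = g r"
    by eventually_elim (simp add: less_top)
  show ?thesis
  proof (rule that[of "\<lambda>r. enn2real (g r)"])
    fix \<psi> :: "real \<Rightarrow> ennreal" assume [measurable]: "\<psi> \<in> borel_measurable borel"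
    have "(\<integral>\<^sup>+r. \<psi> r * g r \<partial>lborel) = (\<integral>\<^sup>+r. \<psi> r * ennreal (enn2real (g r)) \<partial>lborel)"
      by (rule nn_integral_cong_AE) (use gfin in \<open>eventually_elim, simp\<close>)
    then show "(\<integral>\<^sup>+x. \<psi> (norm x) * ennreal (f x) \<partial>lebesgue) = (\<integral>\<^sup>+r. \<psi> r * ennreal (enn2real (g r)) \<partial>lborel)"
      using g_int by simp
  qed auto
qed

lemma radial_marginal_integral_nonneg:
  fixes f :: "'a::euclidean_space \<Rightarrow> real" and \<psi> q :: "real \<Rightarrow> real"
  assumes [measurable]: "f \<in> borel_measurable lebesgue" "q \<in> borel_measurable borel" "\<psi> \<in> borel_measurable borel"
    and nn: "\<And>x. f x \<ge> 0" "\<And>r. q r \<ge> 0"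
    and eq: "\<And>\<psi>::real \<Rightarrow> ennreal. \<psi> \<in> borel_measurable borel \<Longrightarrow>
       (\<integral>\<^sup>+x. \<psi> (norm x) * ennreal (f x) \<partial>lebesgue) = (\<integral>\<^sup>+r. \<psi> r * ennreal (q r) \<partial>lborel)"
    and int: "integrable lebesgue (\<lambda>x. \<psi> (norm x) * f x)"
  shows "integrable lborel (\<lambda>r. \<psi> r * q r)"
    "(LINT x|lebesgue. \<psi> (norm x) * f x) = (LINT r|lborel. \<psi> r * q r)"
proof -
  have e: "(\<integral>\<^sup>+x. ennreal (\<psi>' (norm x) * f x) \<partial>lebesgue) = (\<integral>\<^sup>+r. ennreal (\<psi>' r * q r) \<partial>lborel)"
    if "\<psi>' \<in> borel_measurable borel" for \<psi>' :: "real \<Rightarrow> real"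
    using eq[of "\<lambda>r. ennreal (\<psi>' r)"] that by (simp add: ennreal_mult'' nn)
  have "(\<integral>\<^sup>+r. ennreal (norm (\<psi> r * q r)) \<partial>lborel) = (\<integral>\<^sup>+r. ennreal (\<bar>\<psi> r\<bar> * q r) \<partial>lborel)"
    by (simp add: abs_mult nn)
  also have "\<dots> = (\<integral>\<^sup>+x. ennreal (\<bar>\<psi> (norm x)\<bar> * f x) \<partial>lebesgue)"
    by (rule e[of "\<lambda>r. \<bar>\<psi> r\<bar>", symmetric]) simp
  also have "\<dots> = (\<integral>\<^sup>+x. ennreal (norm (\<psi> (norm x) * f x)) \<partial>lebesgue)"
    by (simp add: abs_mult nn)
  also have "\<dots> < \<infinity>" using int unfolding integrable_iff_bounded by blast
  finally show i: "integrable lborel (\<lambda>r. \<psi> r * q r)"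
    unfolding integrable_iff_bounded by simp
  show "(LINT x|lebesgue. \<psi> (norm x) * f x) = (LINT r|lborel. \<psi> r * q r)"
    using e[of \<psi>] e[of "\<lambda>r. - \<psi> r"]
    unfolding real_lebesgue_integral_def[OF int] real_lebesgue_integral_def[OF i] by simp
qed

text \<open>
  The marginal replaces the average over spheres: it is defined without a measure on the sphere,
  for functions known only almost everywhere, and it turns integrals over the space against radial
  weights into integrals over the half-line.
\<close>

lemma radial_marginal:
  fixes f :: "'a::euclidean_space \<Rightarrow> real"
  assumes f [measurable]: "f \<in> borel_measurable lebesgue"
    and fin: "\<And>R. set_integrable lebesgue (cball 0 R) f"
  obtains q where "q \<in> borel_measurable borel"
    "\<And>\<psi>::real \<Rightarrow> real. \<psi> \<in> borel_measurable borel \<Longrightarrow> integrable lebesgue (\<lambda>x. \<psi> (norm x) * f x) \<Longrightarrow>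
       integrable lborel (\<lambda>r. \<psi> r * q r) \<and>
       (LINT x|lebesgue. \<psi> (norm x) * f x) = (LINT r|lborel. \<psi> r * q r)"
proof -
  let ?p = "\<lambda>x. max 0 (f x)" and ?n = "\<lambda>x. max 0 (- f x)"
  have fp: "set_integrable lebesgue (cball 0 R) ?p" for R
    by (rule set_integrable_bound[OF fin]) (auto simp: set_borel_measurable_def intro!: borel_measurable_times borel_measurable_indicator)
  have fn: "set_integrable lebesgue (cball 0 R) ?n" for R
    by (rule set_integrable_bound[OF fin]) (auto simp: set_borel_measurable_def intro!: borel_measurable_times borel_measurable_indicator)
  obtain q1 where q1[measurable]: "q1 \<in> borel_measurable borel" and q1': "\<And>r. q1 r \<ge> 0"
    "\<And>\<psi>::real \<Rightarrow> ennreal. \<psi> \<in> borel_measurable borel \<Longrightarrow>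
       (\<integral>\<^sup>+x. \<psi> (norm x) * ennreal (?p x) \<partial>lebesgue) = (\<integral>\<^sup>+r. \<psi> r * ennreal (q1 r) \<partial>lborel)"
    by (rule radial_marginal_nonneg[of ?p]) (use fp in auto)
  obtain q2 where q2[measurable]: "q2 \<in> borel_measurable borel" and q2': "\<And>r. q2 r \<ge> 0"
    "\<And>\<psi>::real \<Rightarrow> ennreal. \<psi> \<in> borel_measurable borel \<Longrightarrow>
       (\<integral>\<^sup>+x. \<psi> (norm x) * ennreal (?n x) \<partial>lebesgue) = (\<integral>\<^sup>+r. \<psi> r * ennreal (q2 r) \<partial>lborel)"
    by (rule radial_marginal_nonneg[of ?n]) (use fn in auto)
  show ?thesis
  proof (rule that[of "\<lambda>r. q1 r - q2 r"])
    fix \<psi> :: "real \<Rightarrow> real"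
    assume \<psi>[measurable]: "\<psi> \<in> borel_measurable borel" and int: "integrable lebesgue (\<lambda>x. \<psi> (norm x) * f x)"
    have bd: "\<bar>max 0 y\<bar> \<le> \<bar>y\<bar>" "\<bar>max 0 (- y)\<bar> \<le> \<bar>y\<bar>" for y :: real by auto
    have ip: "integrable lebesgue (\<lambda>x. \<psi> (norm x) * ?p x)"
      by (rule Bochner_Integration.integrable_bound[OF int])
         (auto simp only: real_norm_def abs_mult intro!: AE_I2 mult_left_mono bd abs_ge_zero, measurable)
    have in': "integrable lebesgue (\<lambda>x. \<psi> (norm x) * ?n x)"
      by (rule Bochner_Integration.integrable_bound[OF int])
         (auto simp only: real_norm_def abs_mult intro!: AE_I2 mult_left_mono bd abs_ge_zero, measurable)
    note a = radial_marginal_integral_nonneg[of ?p q1 \<psi>, OF _ q1 \<psi> _ q1' ip, simplified]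
    note b = radial_marginal_integral_nonneg[of ?n q2 \<psi>, OF _ q2 \<psi> _ q2' in', simplified]
    have "(LINT x|lebesgue. \<psi> (norm x) * f x) = (LINT x|lebesgue. \<psi> (norm x) * ?p x - \<psi> (norm x) * ?n x)"
      by (rule Bochner_Integration.integral_cong) (auto simp: max_def)
    also have "\<dots> = (LINT r|lborel. \<psi> r * q1 r) - (LINT r|lborel. \<psi> r * q2 r)"
      by (subst Bochner_Integration.integral_diff[OF ip in']) (use a b in simp)
    also have "\<dots> = (LINT r|lborel. \<psi> r * (q1 r - q2 r))"
      by (subst Bochner_Integration.integral_diff[symmetric]) (use a b in \<open>auto simp: algebra_simps\<close>)
    finally show "integrable lborel (\<lambda>r. \<psi> r * (q1 r - q2 r)) \<and>
       (LINT x|lebesgue. \<psi> (norm x) * f x) = (LINT r|lborel. \<psi> r * (q1 r - q2 r))"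
      using a b by (auto simp: right_diff_distrib)
  qed auto
qed

section \<open>Radial test functions\<close>

text \<open>
  Test functions on the open half-line. Composed with the norm they are C1 on the whole space,
  since the singularity of the norm at the origin lies outside their support.
\<close>

definition pos_test :: "(real \<Rightarrow> real) \<Rightarrow> (real \<Rightarrow> real) \<Rightarrow> bool" where
  "pos_test g dg \<longleftrightarrow> compact_C1 g dg \<and> closure {r. g r \<noteq> 0} \<subseteq> {0<..}"

lemma pos_test_support:
  assumes "pos_test g dg"
  obtains \<delta> R where "0 < \<delta>" "\<delta> < R" "\<And>r. r < \<delta> \<Longrightarrow> g r = 0" "\<And>r. r > R \<Longrightarrow> g r = 0"
    "\<And>r. r < \<delta> \<Longrightarrow> dg r = 0" "\<And>r. r > R \<Longrightarrow> dg r = 0"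
proof -
  let ?K = "closure {r. g r \<noteq> 0}"
  have c: "compact_C1 g dg" and K: "compact ?K" "?K \<subseteq> {0<..}"
    using assms unfolding pos_test_def compact_C1_def by auto
  have "\<exists>\<delta> R. 0 < \<delta> \<and> \<delta> < R \<and> ?K \<subseteq> {\<delta>..R}"
  proof (cases "?K = {}")
    case True
    show ?thesis by (rule exI[of _ 1], rule exI[of _ 2]) (use True in auto)
  next
    case False
    obtain a where a: "a \<in> ?K" "\<And>t. t \<in> ?K \<Longrightarrow> a \<le> t" using compact_attains_inf[OF K(1) False] by blast
    obtain b where b: "b \<in> ?K" "\<And>t. t \<in> ?K \<Longrightarrow> t \<le> b" using compact_attains_sup[OF K(1) False] by blast
    have "a > 0" "a \<le> b" using a b K(2) by auto
    then show ?thesis using a b by (intro exI[of _ a] exI[of _ "b + 1"]) force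
  qed
  then obtain \<delta> R where dR: "0 < \<delta>" "\<delta> < R" "?K \<subseteq> {\<delta>..R}" by blast
  have out: "g r = 0 \<and> dg r = 0" if "r < \<delta> \<or> r > R" for r
  proof -
    have "r \<notin> ?K" using that dR(3) by auto
    then show ?thesis using compact_C1_gradient_outside[OF c] by blast
  qed
  show ?thesis by (rule that[OF dR(1,2)]) (use out in auto)
qed

lemma pos_testI:
  assumes "C1 g dg" "0 < \<delta>" "\<And>r. r < \<delta> \<Longrightarrow> g r = 0" "\<And>r. r > R \<Longrightarrow> g r = 0"
  shows "pos_test g dg"
proof -
  have o: "g r = 0" if "r \<notin> {\<delta>..R}" for r
  proof (cases "r < \<delta>")
    case True then show ?thesis by (rule assms(3))
  next
    case False then show ?thesis using that by (intro assms(4)) auto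
  qed
  have "compact_C1 g dg" "closure {r. g r \<noteq> 0} \<subseteq> {\<delta>..R}"
    using compact_C1I[OF assms(1) compact_Icc o] by auto
  then show ?thesis unfolding pos_test_def using assms(2) by auto
qed

lemma pos_test_continuous: "pos_test g dg \<Longrightarrow> continuous_on UNIV g"
  unfolding pos_test_def by (blast intro: compact_C1_continuous)

lemma continuous_antiderivative:
  fixes g :: "real \<Rightarrow> real"
  assumes "continuous_on UNIV g"
  obtains F where "\<And>r. (F has_real_derivative g r) (at r)"
proof -
  have "\<exists>F. \<forall>x. - \<infinity> < ereal x \<longrightarrow> ereal x < \<infinity> \<longrightarrow> (F has_vector_derivative g x) (at x)"
    using assms by (intro einterval_antiderivative) (auto simp: continuous_on_eq_continuous_at)
  then show ?thesis using that by (auto simp: has_real_derivative_iff_has_vector_derivative)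
qed

lemma integral_FTC_C1:
  fixes F g :: "real \<Rightarrow> real"
  assumes "a \<le> b" "\<And>r. a \<le> r \<Longrightarrow> r \<le> b \<Longrightarrow> (F has_real_derivative g r) (at r)" "continuous_on {a..b} g"
  shows "(LINT s|lborel. indicator {a..b} s * g s) = F b - F a"
    "integrable lborel (\<lambda>s. indicator {a..b} s * g s)"
proof -
  have "(LINT s|lborel. indicator {a..b} s *\<^sub>R g s) = F b - F a"
    by (rule integral_FTC_atLeastAtMost[OF assms(1) _ assms(3)])
       (use assms(2) in \<open>auto simp flip: has_real_derivative_iff_has_vector_derivative intro: has_field_derivative_at_within\<close>)
  then show "(LINT s|lborel. indicator {a..b} s * g s) = F b - F a" by simp
  show "integrable lborel (\<lambda>s. indicator {a..b} s * g s)"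
    using borel_integrable_atLeastAtMost'[OF assms(3)] by (simp add: set_integrable_def)
qed

text \<open>
  The primitive vanishing near 0 is the typical radial cutoff: it is constant near the origin and
  near infinity, and composed with the norm it is C1 although it need not have compact support.
\<close>

lemma pos_test_primitive:
  assumes "pos_test g dg"
  obtains \<xi> where "C1 \<xi> g" "\<And>r. (\<xi> has_real_derivative g r) (at r)"
    "\<And>r. \<xi> r = (LINT s|lborel. indicator {0<..<r} s * g s)"
proof -
  obtain \<delta> R where dR: "0 < \<delta>" "\<delta> < R" "\<And>r. r < \<delta> \<Longrightarrow> g r = 0" "\<And>r. r > R \<Longrightarrow> g r = 0"
    using pos_test_support[OF assms] by metis
  have cg: "continuous_on UNIV g" using pos_test_continuous[OF assms] .
  obtain F where F: "\<And>r. (F has_real_derivative g r) (at r)"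
    using continuous_antiderivative[OF cg] by metis
  define \<xi> where "\<xi> r = F r - F 0" for r
  have d: "(\<xi> has_real_derivative g r) (at r)" for r
    unfolding \<xi>_def by (auto intro!: derivative_eq_intros F)
  have "\<xi> r = (LINT s|lborel. indicator {0<..<r} s * g s)" for r
  proof (cases "0 \<le> r")
    case True
    have "(LINT s|lborel. indicator {0<..<r} s * g s) = (LINT s|lborel. indicator {0..r} s * g s)"
    proof (rule integral_cong_AE)
      show "(\<lambda>s. indicator {0<..<r} s * g s) \<in> borel_measurable lborel"
        "(\<lambda>s. indicator {0..r} s * g s) \<in> borel_measurable lborel"
        using borel_measurable_continuous_onI[OF cg] by auto
      have "AE s in lborel. s \<noteq> 0 \<and> s \<noteq> r" using AE_lborel_singleton[of 0] AE_lborel_singleton[of r] by eventually_elim simp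
      then show "AE s in lborel. indicator {0<..<r} s * g s = indicator {0..r} s * g s"
        by eventually_elim (auto simp: indicator_def)
    qed
    also have "\<dots> = F r - F 0"
      by (rule integral_FTC_C1(1)[OF True F]) (use cg continuous_on_subset in blast)
    finally show ?thesis by (simp add: \<xi>_def)
  next
    case False
    have "\<exists>c. \<forall>s\<in>{..<\<delta>}. \<xi> s = c"
      by (rule has_field_derivative_zero_constant)
         (use d dR(3) has_field_derivative_at_within[of \<xi>] in \<open>auto, metis\<close>)
    then have "\<xi> r = \<xi> 0" using False dR(1) by auto
    then have "\<xi> r = 0" by (simp add: \<xi>_def)
    moreover have "{0<..<r} = {}" using False by auto
    ultimately show ?thesis by simp
  qed
  then show ?thesis using that[of \<xi>] d cg unfolding C1_def by simp
qed

lemma C1_radial: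
  fixes \<eta> d\<eta> :: "real \<Rightarrow> real"
  assumes \<eta>: "C1 \<eta> d\<eta>" and "\<delta> > 0" and zero: "\<And>r. r < \<delta> \<Longrightarrow> d\<eta> r = 0"
  shows "C1 (\<lambda>x::'a::euclidean_space. \<eta> (norm x)) (\<lambda>x. d\<eta> (norm x) *\<^sub>R sgn x)"
proof -
  have D: "(\<eta> has_real_derivative d\<eta> r) (at r)" for r using \<eta> unfolding C1_def by simp
  have cd: "isCont d\<eta> r" for r using \<eta> unfolding C1_def by (simp add: continuous_on_eq_continuous_at)
  have "\<exists>c. \<forall>s\<in>{..<\<delta>}. \<eta> s = c"
  proof (rule has_field_derivative_zero_constant)
    fix s assume "s \<in> {..<\<delta>}"
    then show "(\<eta> has_field_derivative 0) (at s within {..<\<delta>})"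
      using D[of s] zero[of s] has_field_derivative_at_within[of \<eta> "d\<eta> s" s "{..<\<delta>}"] by simp
  qed simp
  then obtain c where c: "\<And>s. s < \<delta> \<Longrightarrow> \<eta> s = c" by auto
  show ?thesis unfolding C1_def
  proof
    show "\<forall>x::'a. GDERIV (\<lambda>x. \<eta> (norm x)) x :> d\<eta> (norm x) *\<^sub>R sgn x"
    proof
      fix x :: 'a
      show "GDERIV (\<lambda>x. \<eta> (norm x)) x :> d\<eta> (norm x) *\<^sub>R sgn x"
      proof (cases "x = 0")
        case False
        then show ?thesis by (rule GDERIV_DERIV_compose[OF GDERIV_norm D])
      next
        case True
        have "GDERIV (\<lambda>x::'a. \<eta> (norm x)) 0 :> 0" unfolding gderiv_def
        proof (rule has_derivative_transform_within_open[of "\<lambda>x. c" _ 0 UNIV "ball 0 \<delta>"])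
          show "((\<lambda>x. c) has_derivative (\<lambda>h. h \<bullet> 0)) (at 0)" by simp
        qed (use \<open>\<delta> > 0\<close> c in auto)
        then show ?thesis using True by simp
      qed
    qed
    have "isCont (\<lambda>x::'a. d\<eta> (norm x) *\<^sub>R sgn x) x" for x
    proof (cases "x = 0")
      case False
      have "isCont (\<lambda>x::'a. d\<eta> (norm x)) x"
        by (rule isCont_o2[OF _ cd]) (auto intro: continuous_intros)
      then show ?thesis using False by (intro continuous_intros)
    next
      case True
      have "eventually (\<lambda>y. y \<in> ball (0::'a) \<delta>) (nhds 0)"
        using \<open>\<delta> > 0\<close> by (intro eventually_nhds_in_open) auto
      then have "eventually (\<lambda>y. d\<eta> (norm y) *\<^sub>R sgn y = 0) (nhds (0::'a))"
        by eventually_elim (simp add: zero)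
      then show ?thesis using True by (subst isCont_cong[where g = "\<lambda>x. 0"]) auto
    qed
    then show "continuous_on UNIV (\<lambda>x::'a. d\<eta> (norm x) *\<^sub>R sgn x)"
      by (simp add: continuous_on_eq_continuous_at)
  qed
qed

lemma compact_C1_radial:
  fixes \<eta> d\<eta> :: "real \<Rightarrow> real"
  assumes "C1 \<eta> d\<eta>" "\<delta> > 0" "\<And>r. r < \<delta> \<Longrightarrow> d\<eta> r = 0" "\<And>r. r > R \<Longrightarrow> \<eta> r = 0"
  shows "compact_C1 (\<lambda>x::'a::euclidean_space. \<eta> (norm x)) (\<lambda>x. d\<eta> (norm x) *\<^sub>R sgn x)"
  by (rule compact_C1I(1)[OF C1_radial[OF assms(1-3)] compact_cball[of 0 R]]) (use assms(4) in auto)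

text \<open>
  The integrand is the divergence of the vector field \<open>\<zeta>(x) x\<close>.
\<close>

lemma integral_divergence_position:
  fixes \<zeta> :: "'a::euclidean_space \<Rightarrow> real"
  assumes "compact_C1 \<zeta> d\<zeta>"
  shows "(LINT x|lebesgue. real DIM('a) * \<zeta> x + x \<bullet> d\<zeta> x) = 0"
proof -
  have c: "compact_C1 (\<lambda>x. (x \<bullet> i) * \<zeta> x) (\<lambda>x. (x \<bullet> i) *\<^sub>R d\<zeta> x + \<zeta> x *\<^sub>R i)" for i
    by (rule compact_C1_mult[OF assms C1_inner])
  have "(LINT x|lebesgue. real DIM('a) * \<zeta> x + x \<bullet> d\<zeta> x) =
      (LINT x|lebesgue. (\<Sum>i\<in>Basis. ((x \<bullet> i) *\<^sub>R d\<zeta> x + \<zeta> x *\<^sub>R i) \<bullet> i))"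
    by (rule Bochner_Integration.integral_cong)
       (auto simp: inner_add_left sum.distrib euclidean_inner[of _ "d\<zeta> _"])
  also have "\<dots> = (\<Sum>i\<in>Basis. LINT x|lebesgue. ((x \<bullet> i) *\<^sub>R d\<zeta> x + \<zeta> x *\<^sub>R i) \<bullet> i)"
    using compact_C1_integrable(2)[OF c] by (intro Bochner_Integration.integral_sum integrable_inner_left) auto
  also have "\<dots> = 0" using integral_gradient_eq_0[OF c] by simp
  finally show ?thesis .
qed

section \<open>Transport between the space and the radial variable\<close>

lemma sigma_finite_lebesgue: "sigma_finite_measure (lebesgue :: 'a::euclidean_space measure)"
proof
  show "\<exists>A::'a set set. countable A \<and> A \<subseteq> sets lebesgue \<and> \<Union>A = space lebesgue \<and> (\<forall>a\<in>A. emeasure lebesgue a \<noteq> \<infinity>)"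
  proof (intro exI[of _ "range (\<lambda>n::nat. cball (0::'a) (real n))"] conjI ballI)
    show "\<Union>(range (\<lambda>n::nat. cball (0::'a) (real n))) = space lebesgue"
    proof -
      have "x \<in> cball 0 (real (nat \<lceil>norm x\<rceil>))" for x :: 'a by (simp add: real_nat_ceiling_ge)
      then show ?thesis by (simp, blast)
    qed
    fix a assume "a \<in> range (\<lambda>n::nat. cball (0::'a) (real n))"
    then obtain n :: nat where a: "a = cball 0 (real n)" by auto
    show "emeasure lebesgue a \<noteq> \<infinity>"
      using emeasure_lborel_cball_finite[of "0::'a" "real n"] unfolding a by simp
  qed auto
qed

text \<open>
  Every exchange of integrals in this development has this form: a function of one real variable
  is integrated over sections of \<open>K\<close> (mostly \<open>s < |x|\<close> or \<open>|x| \<le> s\<close>), giving a primitive, and the primitive is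
  integrated against \<open>b\<close>. Of \<open>h\<close> only the iterated integral of the absolute values is required to be finite, so it
  may be singular at 0 when the sections compensate for it.
\<close>

lemma integral_kernel_swap:
  fixes h :: "real \<Rightarrow> real" and b :: "'b \<Rightarrow> real"
  assumes N: "sigma_finite_measure N"
    and h [measurable]: "h \<in> borel_measurable borel" and K [measurable]: "K \<in> sets (lborel \<Otimes>\<^sub>M N)"
    and b: "integrable N b"
    and int: "integrable lborel (\<lambda>s. h s * (LINT x|N. indicator K (s, x) * \<bar>b x\<bar>))"
  shows "integrable N (\<lambda>x. (LINT s|lborel. indicator K (s, x) * h s) * b x)"
    and "integrable lborel (\<lambda>s. h s * (LINT x|N. indicator K (s, x) * b x))"
    and "(LINT x|N. (LINT s|lborel. indicator K (s, x) * h s) * b x) =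
         (LINT s|lborel. h s * (LINT x|N. indicator K (s, x) * b x))"
proof -
  interpret N: sigma_finite_measure N by (rule N)
  interpret P: pair_sigma_finite lborel N by unfold_locales
  interpret Q: pair_sigma_finite N "lborel :: real measure" by unfold_locales
  have [measurable]: "b \<in> borel_measurable N" using b by (rule borel_measurable_integrable)
  define F where "F = (\<lambda>(s, x). indicator K (s, x) * h s * b x)"
  have Fm[measurable]: "F \<in> borel_measurable (lborel \<Otimes>\<^sub>M N)" unfolding F_def by measurable
  have bK: "integrable N (\<lambda>x. indicator K (s, x) * b x)" for s
  proof (rule Bochner_Integration.integrable_bound[OF b])
    have [measurable]: "Pair s -` K \<in> sets N" using K by (rule sets_Pair1)
    have "(\<lambda>x. indicator K (s, x) * b x) = (\<lambda>x. indicator (Pair s -` K) x * b x)"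
      by (auto simp: indicator_def)
    then show "(\<lambda>x. indicator K (s, x) * b x) \<in> borel_measurable N" by simp
  qed (auto simp: indicator_def)
  have Fi: "integrable (lborel \<Otimes>\<^sub>M N) F"
  proof (rule P.Fubini_integrable)
    have "(\<lambda>s. LINT x|N. norm (F (s, x))) = (\<lambda>s. \<bar>h s * (LINT x|N. indicator K (s, x) * \<bar>b x\<bar>)\<bar>)"
    proof
      fix s
      have "(LINT x|N. norm (F (s, x))) = (LINT x|N. \<bar>h s\<bar> * (indicator K (s, x) * \<bar>b x\<bar>))"
        by (rule Bochner_Integration.integral_cong) (auto simp: F_def abs_mult)
      also have "\<dots> = \<bar>h s\<bar> * (LINT x|N. indicator K (s, x) * \<bar>b x\<bar>)" by simp
      also have "\<dots> = \<bar>h s * (LINT x|N. indicator K (s, x) * \<bar>b x\<bar>)\<bar>"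
        by (simp add: abs_mult integral_nonneg_AE)
      finally show "(LINT x|N. norm (F (s, x))) = \<bar>h s * (LINT x|N. indicator K (s, x) * \<bar>b x\<bar>)\<bar>" .
    qed
    then show "integrable lborel (\<lambda>s. LINT x|N. norm (F (s, x)))" using integrable_abs[OF int] by simp
    show "AE s in lborel. integrable N (\<lambda>x. F (s, x))"
    proof (rule AE_I2)
      fix s
      have "(\<lambda>x. F (s, x)) = (\<lambda>x. h s * (indicator K (s, x) * b x))" by (auto simp: F_def)
      then show "integrable N (\<lambda>x. F (s, x))" using integrable_mult_right[OF bK[of s], of "h s"] by simp
    qed
  qed (rule Fm)
  have Fe: "F (s, x) = indicator K (s, x) * h s * b x" for s x by (simp add: F_def)
  have in1: "(LINT x|N. F (s, x)) = h s * (LINT x|N. indicator K (s, x) * b x)" for s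
  proof -
    have "(LINT x|N. F (s, x)) = (LINT x|N. h s * (indicator K (s, x) * b x))"
      by (rule Bochner_Integration.integral_cong) (auto simp: Fe)
    then show ?thesis by simp
  qed
  have in2: "(LINT s|lborel. F (s, x)) = (LINT s|lborel. indicator K (s, x) * h s) * b x" for x
    unfolding Fe by simp
  show "integrable lborel (\<lambda>s. h s * (LINT x|N. indicator K (s, x) * b x))"
    using P.integrable_fst'[OF Fi] unfolding in1 .
  have "integrable (N \<Otimes>\<^sub>M lborel) (\<lambda>(x, s). F (s, x))" using P.integrable_product_swap[OF Fi] .
  from Q.integrable_fst'[OF this]
  show "integrable N (\<lambda>x. (LINT s|lborel. indicator K (s, x) * h s) * b x)"
    by (simp add: in2)
  have "(LINT x|N. LINT s|lborel. F (s, x)) = (LINT s|lborel. LINT x|N. F (s, x))"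
    using P.Fubini_integral[of "\<lambda>s x. F (s, x)"] Fi by simp
  then show "(LINT x|N. (LINT s|lborel. indicator K (s, x) * h s) * b x) =
         (LINT s|lborel. h s * (LINT x|N. indicator K (s, x) * b x))"
    unfolding in1 in2 .
qed

lemma integrable_mult_bounded:
  fixes f \<phi> :: "'b \<Rightarrow> real"
  assumes "integrable M f" "\<phi> \<in> borel_measurable M" "\<And>x. \<bar>\<phi> x\<bar> \<le> B"
  shows "integrable M (\<lambda>x. \<phi> x * f x)"
proof (rule Bochner_Integration.integrable_bound[of M "\<lambda>x. B * f x"])
  show "integrable M (\<lambda>x. B * f x)" using assms(1) by simp
  show "(\<lambda>x. \<phi> x * f x) \<in> borel_measurable M" using assms(1,2) by simp
  have "\<bar>\<phi> x\<bar> \<le> \<bar>B\<bar>" for x using assms(3)[of x] by linarith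
  then show "AE x in M. norm (\<phi> x * f x) \<le> norm (B * f x)"
    by (auto simp: abs_mult intro!: mult_right_mono)
qed

lemma kernel_sets_lebesgue:
  assumes "Measurable.pred (borel \<Otimes>\<^sub>M borel) (\<lambda>(s, r). P s r)"
  shows "{(s::real, x::'a::euclidean_space). P s (norm x)} \<in> sets (lborel \<Otimes>\<^sub>M lebesgue)"
proof -
  have "(\<lambda>z. (fst z, norm (snd z :: 'a))) \<in> (lborel \<Otimes>\<^sub>M lebesgue) \<rightarrow>\<^sub>M (borel \<Otimes>\<^sub>M borel)"
    by measurable
  from measurable_compose[OF this assms]
  have "{z \<in> space (lborel \<Otimes>\<^sub>M lebesgue). P (fst z) (norm (snd z :: 'a))} \<in> sets (lborel \<Otimes>\<^sub>M lebesgue)"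
    by (simp add: pred_def)
  moreover have "{z \<in> space (lborel \<Otimes>\<^sub>M lebesgue). P (fst z) (norm (snd z :: 'a))} = {(s, x). P s (norm x)}"
    by (auto simp: space_pair_measure)
  ultimately show ?thesis by simp
qed

lemma kernel_integral_measurable:
  assumes "sigma_finite_measure N" "K \<in> sets (lborel \<Otimes>\<^sub>M N)" "b \<in> borel_measurable N"
  shows "(\<lambda>s::real. LINT x|N. indicator K (s, x) * (b x :: real)) \<in> borel_measurable borel"
proof -
  interpret sigma_finite_measure N by fact
  have [measurable]: "K \<in> sets (borel \<Otimes>\<^sub>M N)"
    using assms(2) by (simp cong: sets_pair_measure_cong)
  have [measurable]: "b \<in> borel_measurable N" by fact
  show ?thesis by (intro borel_measurable_lebesgue_integral) measurable
qed

text \<open>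
  When \<open>h\<close> is integrable the sections need not help: the inner integrals are bounded.
\<close>

lemma integral_kernel_swap_integrable:
  fixes h :: "real \<Rightarrow> real" and b :: "'b \<Rightarrow> real"
  assumes N: "sigma_finite_measure N" and h: "integrable lborel h"
    and K: "K \<in> sets (lborel \<Otimes>\<^sub>M N)" and b: "integrable N b"
  shows "integrable N (\<lambda>x. (LINT s|lborel. indicator K (s, x) * h s) * b x)"
    and "integrable lborel (\<lambda>s. h s * (LINT x|N. indicator K (s, x) * b x))"
    and "(LINT x|N. (LINT s|lborel. indicator K (s, x) * h s) * b x) =
         (LINT s|lborel. h s * (LINT x|N. indicator K (s, x) * b x))"
proof -
  have hm: "h \<in> borel_measurable borel" using borel_measurable_integrable[OF h] by simp
  have "integrable lborel (\<lambda>s. (LINT x|N. indicator K (s, x) * \<bar>b x\<bar>) * h s)"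
  proof (rule integrable_mult_bounded[OF h])
    show "(\<lambda>s. LINT x|N. indicator K (s, x) * \<bar>b x\<bar>) \<in> borel_measurable lborel"
      using kernel_integral_measurable[OF N K, of "\<lambda>x. \<bar>b x\<bar>"] b by auto
    fix s
    have "(LINT x|N. indicator K (s, x) * \<bar>b x\<bar>) \<le> (LINT x|N. \<bar>b x\<bar>)"
      by (rule integral_mono_AE'[OF integrable_abs[OF b]]) (auto simp: indicator_def)
    moreover have "0 \<le> (LINT x|N. indicator K (s, x) * \<bar>b x\<bar>)" by (rule integral_nonneg_AE) simp
    ultimately show "\<bar>LINT x|N. indicator K (s, x) * \<bar>b x\<bar>\<bar> \<le> (LINT x|N. \<bar>b x\<bar>)" by simp
  qed
  then have int: "integrable lborel (\<lambda>s. h s * (LINT x|N. indicator K (s, x) * \<bar>b x\<bar>))"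
    by (simp add: mult.commute)
  show "integrable N (\<lambda>x. (LINT s|lborel. indicator K (s, x) * h s) * b x)"
    "integrable lborel (\<lambda>s. h s * (LINT x|N. indicator K (s, x) * b x))"
    "(LINT x|N. (LINT s|lborel. indicator K (s, x) * h s) * b x) =
         (LINT s|lborel. h s * (LINT x|N. indicator K (s, x) * b x))"
    by (rule integral_kernel_swap[OF N hm K b int])+
qed

lemma pos_test_integrable: "pos_test g dg \<Longrightarrow> integrable lborel g"
  using compact_C1_integrable(1)[of g dg] pos_test_continuous[of g dg]
  by (simp add: pos_test_def integrable_completion borel_measurable_continuous_onI)

lemma AE_lborel_eq_0_if_pos_test_orthogonal:
  fixes f :: "real \<Rightarrow> real"
  assumes f [measurable]: "f \<in> borel_measurable borel"
    and int: "\<And>a b. 0 < a \<Longrightarrow> integrable lborel (\<lambda>r. indicator {a..b} r * f r)"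
    and zero: "\<And>g dg. pos_test g dg \<Longrightarrow> (LINT r|lborel. f r * g r) = 0"
  shows "AE r in lborel. 0 < r \<longrightarrow> f r = 0"
proof -
  have "AE r in lebesgue. r \<in> {0<..} \<longrightarrow> f r = 0"
  proof (rule fundamental_lemma_of_variations)
    fix K :: "real set" assume K: "compact K" "K \<subseteq> {0<..}"
    obtain a b where ab: "0 < a" "K \<subseteq> {a..b}"
    proof (cases "K = {}")
      case True then show ?thesis using that[of 1 1] by simp
    next
      case False
      obtain a where "a \<in> K" "\<And>t. t \<in> K \<Longrightarrow> a \<le> t" using compact_attains_inf[OF K(1) False] by blast
      moreover obtain b where "b \<in> K" "\<And>t. t \<in> K \<Longrightarrow> t \<le> b" using compact_attains_sup[OF K(1) False] by blast
      moreover have "0 < a" using \<open>a \<in> K\<close> K(2) by auto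
      ultimately show ?thesis by (intro that[of a b]) auto
    qed
    have [measurable]: "K \<in> sets borel" using K(1) by (simp add: borel_compact)
    have "integrable lborel (\<lambda>r. indicator K r * f r)"
    proof (rule Bochner_Integration.integrable_bound[OF int[OF ab(1), of b]])
      show "AE r in lborel. norm (indicator K r * f r) \<le> norm (indicator {a..b} r * f r)"
        using ab(2) by (intro AE_I2) (auto simp: indicator_def)
    qed measurable
    then show "set_integrable lebesgue K f"
      unfolding set_integrable_def by (subst integrable_completion) auto
  next
    fix \<phi> d\<phi> assume \<phi>: "compact_C1 \<phi> d\<phi>" "closure {x. \<phi> x \<noteq> 0} \<subseteq> {0::real<..}"
    then have "pos_test \<phi> d\<phi>" by (simp add: pos_test_def)
    then have "(LINT r|lborel. f r * \<phi> r) = 0" by (rule zero)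
    moreover have "\<phi> \<in> borel_measurable borel"
      using compact_C1_continuous(1)[OF \<phi>(1)] by (rule borel_measurable_continuous_onI)
    ultimately show "(LINT r|lebesgue. f r * \<phi> r) = 0" by (subst integral_completion) auto
  qed simp
  then show ?thesis by (simp add: AE_completion_iff)
qed

lemma outer_integral_measurable:
  fixes b :: "'a::euclidean_space \<Rightarrow> real"
  assumes "b \<in> borel_measurable lebesgue"
  shows "(\<lambda>s. LINT x|lebesgue. indicator {x. s < norm x} x * b x) \<in> borel_measurable borel"
proof -
  interpret sigma_finite_measure "lebesgue :: 'a measure" by (rule sigma_finite_lebesgue)
  have [measurable]: "b \<in> borel_measurable lebesgue" using assms .
  have "(\<lambda>(s, x). indicator {x. s < norm x} x * b x) = (\<lambda>(s::real, x). (if s < norm x then b x else 0))"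
    by (auto simp: indicator_def)
  moreover have "(\<lambda>(s::real, x). (if s < norm x then b x else 0)) \<in> borel_measurable (borel \<Otimes>\<^sub>M lebesgue)"
    by measurable
  ultimately show ?thesis by (intro borel_measurable_lebesgue_integral) simp
qed

text \<open>
  The hypothesis \<open>star\<close> says, for smooth weights \<open>g\<close>, that the radial marginal \<open>q\<close> of \<open>a\<close> and the
  outer integrals \<open>B(s)\<close> of \<open>b\<close> over \<open>|x| > s\<close> satisfy \<open>q + B = 0\<close> when tested with \<open>g\<close>: exchanging
  integrals turns the primitive of \<open>g\<close> into \<open>B\<close>. By the fundamental lemma \<open>q = - B\<close> almost everywhere on the
  half-line, and then the identity holds for every weight \<open>h\<close> that is integrable
  against \<open>a\<close>, with no smoothness and no control at the origin.
\<close>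

lemma radial_transport:
  fixes a b :: "'a::euclidean_space \<Rightarrow> real"
  assumes a: "integrable lebesgue a" and b: "integrable lebesgue b"
    and star: "\<And>g dg \<xi>. pos_test g dg \<Longrightarrow> C1 \<xi> g \<Longrightarrow>
        (\<And>r. \<xi> r = (LINT s|lborel. indicator {0<..<r} s * g s)) \<Longrightarrow>
        (LINT x|lebesgue. g (norm x) * a x) + (LINT x|lebesgue. \<xi> (norm x) * b x) = 0"
    and h [measurable]: "h \<in> borel_measurable borel"
    and ha: "integrable lebesgue (\<lambda>x. h (norm x) * a x)"
  shows "(LINT x|lebesgue. h (norm x) * a x) =
       - (LINT s|lborel. h s * (indicator {0<..} s * (LINT x|lebesgue. indicator {x. s < norm x} x * b x)))"
proof -
  have am[measurable]: "a \<in> borel_measurable lebesgue" and bm[measurable]: "b \<in> borel_measurable lebesgue"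
    using a b by auto
  define B where "B s = (LINT x|lebesgue. indicator {x. s < norm x} x * b x)" for s
  have Bm[measurable]: "B \<in> borel_measurable borel"
    unfolding B_def by (rule outer_integral_measurable[OF bm])
  have afin: "set_integrable lebesgue (cball 0 R) a" for R
    unfolding set_integrable_def by (rule integrable_mult_indicator[OF _ a]) simp
  obtain q where q[measurable]: "q \<in> borel_measurable borel" and q':
    "\<And>\<psi>::real \<Rightarrow> real. \<psi> \<in> borel_measurable borel \<Longrightarrow> integrable lebesgue (\<lambda>x. \<psi> (norm x) * a x) \<Longrightarrow>
       integrable lborel (\<lambda>r. \<psi> r * q r) \<and>
       (LINT x|lebesgue. \<psi> (norm x) * a x) = (LINT r|lborel. \<psi> r * q r)"
    by (rule radial_marginal[OF am afin], rule that) blast+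
  have Bb: "\<bar>B s\<bar> \<le> (LINT x|lebesgue. \<bar>b x\<bar>)" for s
  proof -
    have "\<bar>B s\<bar> \<le> (LINT x|lebesgue. \<bar>indicator {x. s < norm x} x * b x\<bar>)"
      unfolding B_def by (rule integral_abs_bound)
    also have "\<dots> \<le> (LINT x|lebesgue. \<bar>b x\<bar>)"
      by (rule integral_mono_AE') (use b in \<open>auto simp: indicator_def\<close>)
    finally show ?thesis .
  qed
  have qB: "(LINT r|lborel. (q r + B r) * g r) = 0" if g: "pos_test g dg" for g dg
  proof -
    obtain \<xi> where \<xi>: "C1 \<xi> g" "\<And>r. \<xi> r = (LINT s|lborel. indicator {0<..<r} s * g s)"
      using pos_test_primitive[OF g] by metis
    have gm[measurable]: "g \<in> borel_measurable borel"
      using pos_test_continuous[OF g] by (rule borel_measurable_continuous_onI)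
    obtain C where C: "C \<ge> 0" "\<And>x. \<bar>g x\<bar> \<le> C"
      using compact_C1_bounded[of g dg] g unfolding pos_test_def by metis
    have gneg: "g s = 0" if "s \<le> 0" for s
      using pos_test_support[OF g] that by (metis le_less_trans)
    have gi: "integrable lborel g" by (rule pos_test_integrable[OF g])
    have ga: "integrable lborel (\<lambda>r. g r * q r)" "(LINT x|lebesgue. g (norm x) * a x) = (LINT r|lborel. g r * q r)"
      using q'[OF gm integrable_mult_bounded[OF a _ C(2)]] by auto
    let ?K = "{(s::real, x::'a). 0 < s \<and> s < norm x}"
    have K: "?K \<in> sets (lborel \<Otimes>\<^sub>M lebesgue)"
      using kernel_sets_lebesgue[of "\<lambda>s r. 0 < s \<and> s < r"] by measurable
    have e1: "(LINT s|lborel. indicator ?K (s, x) * g s) = \<xi> (norm x)" for x :: 'a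
      unfolding \<xi>(2) by (rule Bochner_Integration.integral_cong) (auto simp: indicator_def)
    have e2: "g s * (LINT x|lebesgue. indicator ?K (s, x) * b x) = g s * B s" for s
    proof (cases "s \<le> 0")
      case False
      have "(LINT x|lebesgue. indicator ?K (s, x) * b x) = B s" unfolding B_def
        by (rule Bochner_Integration.integral_cong) (use False in \<open>auto simp: indicator_def\<close>)
      then show ?thesis by simp
    qed (simp add: gneg)
    note sw = integral_kernel_swap_integrable[OF sigma_finite_lebesgue gi K b, unfolded e1 e2]
    have "(LINT r|lborel. (q r + B r) * g r) = (LINT r|lborel. g r * q r + g r * B r)"
      by (simp add: algebra_simps)
    also have "\<dots> = (LINT r|lborel. g r * q r) + (LINT r|lborel. g r * B r)"
      by (rule Bochner_Integration.integral_add[OF ga(1) sw(2)])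
    also have "\<dots> = 0" using star[OF g \<xi>] sw(3) ga(2) by simp
    finally show ?thesis .
  qed
  have AE: "AE r in lborel. 0 < r \<longrightarrow> q r + B r = 0"
  proof (rule AE_lborel_eq_0_if_pos_test_orthogonal[OF _ _ qB])
    fix c d :: real assume "0 < c"
    have "integrable lborel (\<lambda>r. indicator {c..d} r * q r)"
      using q'[of "indicator {c..d}"] integrable_mult_bounded[OF a, of "\<lambda>x. indicator {c..d} (norm x)" 1]
      by (auto simp: indicator_def)
    moreover have "integrable lborel (\<lambda>r. B r * indicator {c..d} r)"
      by (rule integrable_mult_bounded[OF _ _ Bb]) (auto simp: integrable_indicator_iff emeasure_lborel_Icc_eq)
    ultimately have "integrable lborel (\<lambda>r. indicator {c..d} r * q r + B r * indicator {c..d} r)"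
      by (rule Bochner_Integration.integrable_add)
    then show "integrable lborel (\<lambda>r. indicator {c..d} r * (q r + B r))"
      by (simp add: algebra_simps)
  qed simp
  \<comment> \<open>the marginal is known on the open half-line only; the origin is a null set\<close>
  have ae0: "AE x in lebesgue. indicator {0<..} (norm x) * h (norm x) * a x = h (norm x) * a x"
    using AE_nonzero_lebesgue by eventually_elim simp
  have i0: "integrable lebesgue (\<lambda>x. indicator {0<..} (norm x) * h (norm x) * a x)"
    by (rule integrable_cong_AE_imp[OF ha]) (use ae0 in \<open>auto elim: eventually_mono\<close>)
  have c: "integrable lborel (\<lambda>r. indicator {0<..} r * h r * q r)"
    "(LINT x|lebesgue. indicator {0<..} (norm x) * h (norm x) * a x) = (LINT r|lborel. indicator {0<..} r * h r * q r)"
    using q'[of "\<lambda>r. indicator {0<..} r * h r", OF _ i0] by auto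
  have ae1: "AE r in lborel. - (indicator {0<..} r * h r * q r) = h r * (indicator {0<..} r * B r)"
    using AE
  proof eventually_elim
    case (elim r)
    show ?case
    proof (cases "0 < r")
      case True
      then have "B r = - q r" using elim by linarith
      then show ?thesis by simp
    qed simp
  qed
  have "(LINT x|lebesgue. h (norm x) * a x) = (LINT x|lebesgue. indicator {0<..} (norm x) * h (norm x) * a x)"
    by (rule integral_cong_AE) (use ae0 in \<open>auto elim: eventually_mono\<close>)
  also have "\<dots> = - (LINT r|lborel. - (indicator {0<..} r * h r * q r))" using c(2) by simp
  also have "(LINT r|lborel. - (indicator {0<..} r * h r * q r)) = (LINT r|lborel. h r * (indicator {0<..} r * B r))"
    by (rule integral_cong_AE) (use ae1 in auto)
  finally show "(LINT x|lebesgue. h (norm x) * a x) =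
       - (LINT s|lborel. h s * (indicator {0<..} s * (LINT x|lebesgue. indicator {x. s < norm x} x * b x)))"
    unfolding B_def .
qed

section \<open>Weak gradients and fluxes of radial functions\<close>

lemma Lp_loc_1_iff:
  "Lp_loc 1 f \<longleftrightarrow> f \<in> borel_measurable lebesgue \<and> (\<forall>K. compact K \<longrightarrow> set_integrable lebesgue K f)"
proof -
  have "set_integrable lebesgue K (\<lambda>x. norm (f x) powr 1) \<longleftrightarrow> set_integrable lebesgue K f"
    if "f \<in> borel_measurable lebesgue" "compact K" for K
  proof -
    have K: "K \<in> sets lebesgue" using that(2) by (simp add: borel_compact)
    have "(\<lambda>x. indicator K x *\<^sub>R f x) \<in> borel_measurable lebesgue"
      using that(1) K by (intro borel_measurable_scaleR borel_measurable_indicator)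
    from integrable_norm_iff[OF this] show ?thesis by (simp add: set_integrable_def)
  qed
  then show ?thesis unfolding Lp_loc_def by auto
qed

lemma integrable_Lp_loc_bounded:
  fixes f :: "'a::euclidean_space \<Rightarrow> 'b::euclidean_space" and F :: "'a \<Rightarrow> 'c::euclidean_space"
  assumes f: "Lp_loc 1 f" and F: "F \<in> borel_measurable lebesgue"
    and bd: "\<And>x. norm (F x) \<le> B * norm (f x)" and out: "\<And>x. norm x \<ge> R \<Longrightarrow> F x = 0"
  shows "integrable lebesgue F"
proof (rule Bochner_Integration.integrable_bound[OF _ F])
  have "set_integrable lebesgue (cball 0 R) f" using f unfolding Lp_loc_1_iff by simp
  then show "integrable lebesgue (\<lambda>x. B *\<^sub>R (indicator (cball 0 R) x *\<^sub>R f x))"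
    unfolding set_integrable_def by (rule integrable_scaleR_right)
  show "AE x in lebesgue. norm (F x) \<le> norm (B *\<^sub>R (indicator (cball 0 R) x *\<^sub>R f x))"
  proof (intro AE_I2)
    fix x show "norm (F x) \<le> norm (B *\<^sub>R (indicator (cball 0 R) x *\<^sub>R f x))"
    proof (cases "norm x \<le> R")
      case True
      have "norm (F x) \<le> \<bar>B\<bar> * norm (f x)"
        by (rule order_trans[OF bd]) (intro mult_right_mono, auto)
      then show ?thesis using True by simp
    next
      case False
      then show ?thesis using out[of x] by simp
    qed
  qed
qed

text \<open>
  These are the two integrands in the definition of the weak gradient.
\<close>

lemma integrable_Lp_loc_test:
  assumes "Lp_loc 1 u" "Lp_loc 1 G" "compact_C1 \<phi> d\<phi>"
  shows "integrable lebesgue (\<lambda>x. u x *\<^sub>R d\<phi> x)" "integrable lebesgue (\<lambda>x. \<phi> x *\<^sub>R G x)"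
proof -
  obtain R where R: "R > 0" "\<And>x. norm x \<ge> R \<Longrightarrow> \<phi> x = 0 \<and> d\<phi> x = 0"
    using compact_C1_bounded_support[OF assms(3)] by blast
  obtain B where B: "B \<ge> 0" "\<And>x. \<bar>\<phi> x\<bar> \<le> B" "\<And>x. norm (d\<phi> x) \<le> B"
    using compact_C1_bounded[OF assms(3)] by blast
  have m: "\<phi> \<in> borel_measurable lebesgue" "d\<phi> \<in> borel_measurable lebesgue"
    using compact_C1_continuous[OF assms(3)] by (auto intro: continuous_measurable_lebesgue)
  have um: "u \<in> borel_measurable lebesgue" "G \<in> borel_measurable lebesgue"
    using assms(1,2) unfolding Lp_loc_def by auto
  show "integrable lebesgue (\<lambda>x. u x *\<^sub>R d\<phi> x)"
  proof (rule integrable_Lp_loc_bounded[OF assms(1)])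
    fix x show "norm (u x *\<^sub>R d\<phi> x) \<le> B * norm (u x)"
      using mult_left_mono[OF B(3), of "\<bar>u x\<bar>" x] by (simp add: mult.commute)
    show "u x *\<^sub>R d\<phi> x = 0" if "norm x \<ge> R" using R(2)[OF that] by simp
  qed (use m um in auto)
  show "integrable lebesgue (\<lambda>x. \<phi> x *\<^sub>R G x)"
  proof (rule integrable_Lp_loc_bounded[OF assms(2)])
    fix x show "norm (\<phi> x *\<^sub>R G x) \<le> B * norm (G x)"
      using mult_right_mono[OF B(2), of "norm (G x)" x] by simp
    show "\<phi> x *\<^sub>R G x = 0" if "norm x \<ge> R" using R(2)[OF that] by simp
  qed (use m um in auto)
qed

lemma radial_field_measurable:
  assumes [measurable]: "h \<in> borel_measurable borel"
  shows "(\<lambda>x::'a::euclidean_space. h (norm x) *\<^sub>R sgn x) \<in> borel_measurable lebesgue"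
proof (rule borel_measurable_lebesgueI)
  have "(sgn :: 'a \<Rightarrow> 'a) = (\<lambda>x. inverse (norm x) *\<^sub>R x)" by (simp add: sgn_div_norm fun_eq_iff)
  then show "(\<lambda>x::'a. h (norm x) *\<^sub>R sgn x) \<in> borel_measurable borel" by simp
qed

lemma sgn_measurable_lebesgue: "(sgn :: 'a::euclidean_space \<Rightarrow> 'a) \<in> borel_measurable lebesgue"
  using radial_field_measurable[of "\<lambda>_. 1"] by simp

lemma radial_local_integrable:
  assumes [measurable]: "h \<in> borel_measurable borel"
    and hloc: "set_integrable lebesgue (cball 0 R) (\<lambda>x::'a::euclidean_space. h (norm x))"
  shows "integrable lborel (\<lambda>r. sphere_density DIM('a) r * (indicator {..R} r * h r))"
proof -
  have "integrable lebesgue (\<lambda>x::'a. indicator {..R} (norm x) * h (norm x))"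
    using hloc unfolding set_integrable_def
    by (rule Bochner_Integration.integrable_cong[THEN iffD1, rotated 2]) (auto simp: indicator_def)
  then show ?thesis by (subst (asm) integrable_radial_iff) auto
qed

text \<open>
  Fix a direction \<open>e\<close> and a test function \<open>\<phi>\<close>. For radial cutoffs \<open>\<xi>(|x|)\<close> the claim is that the gradient of
  \<open>\<xi>(|x|) \<phi>\<close> integrates to 0, so \<open>radial_transport\<close> applies with \<open>a = \<phi> (sgn x \<bullet> e)\<close> and
  \<open>b = \<nabla>\<phi> \<bullet> e\<close>. It remains to recognise the right-hand side as the integral of \<open>V(|x|) b\<close>, by writing \<open>V\<close> as a
  primitive of \<open>h\<close> and exchanging integrals.

  Near the origin \<open>h\<close> is only integrable with the weight \<open>r\<^sup>N\<^sup>-\<^sup>1\<close>. Therefore \<open>V\<close> is expanded from a large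
  radius \<open>R\<close> inwards: the inner integrals of \<open>b\<close> over \<open>|x| \<le> s\<close> then appear, and these are of order \<open>s\<^sup>N\<close>.
\<close>

lemma has_weak_gradient_radial:
  fixes u :: "'a::euclidean_space \<Rightarrow> real"
  assumes u: "Lp_loc 1 u" and uV: "AE x in lebesgue. u x = V (norm x)"
    and h [measurable]: "h \<in> borel_measurable borel"
    and hloc: "\<And>R. set_integrable lebesgue (cball 0 R) (\<lambda>x::'a. h (norm x))"
    and V: "\<And>r R. 0 < r \<Longrightarrow> r \<le> R \<Longrightarrow> V R - V r = (LINT s|lborel. indicator {r..<R} s * h s)"
  shows "has_weak_gradient u (\<lambda>x. h (norm x) *\<^sub>R sgn x)"
proof -
  let ?G = "\<lambda>x::'a. h (norm x) *\<^sub>R sgn x"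
  have um[measurable]: "u \<in> borel_measurable lebesgue" using u by (simp add: Lp_loc_def)
  have sm[measurable]: "(sgn :: 'a \<Rightarrow> 'a) \<in> borel_measurable lebesgue" by (rule sgn_measurable_lebesgue)
  have hm[measurable]: "(\<lambda>x::'a. h (norm x)) \<in> borel_measurable lebesgue" by measurable
  have hL: "Lp_loc 1 (\<lambda>x::'a. h (norm x))" unfolding Lp_loc_1_iff
  proof (intro conjI allI impI)
    fix K :: "'a set" assume K: "compact K"
    obtain R where "K \<subseteq> cball 0 R"
      using bounded_subset_ballD[OF compact_imp_bounded[OF K], of 0] ball_subset_cball by blast
    then show "set_integrable lebesgue K (\<lambda>x. h (norm x))"
      using set_integrable_subset[OF hloc[of R], of K] K by (simp add: borel_compact)
  qed (rule hm)
  have GL: "Lp_loc 1 ?G" unfolding Lp_loc_1_iff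
  proof (intro conjI allI impI)
    show "?G \<in> borel_measurable lebesgue" by (rule radial_field_measurable[OF h])
    fix K :: "'a set" assume K: "compact K"
    have "set_integrable lebesgue K (\<lambda>x. h (norm x))" using hL K by (simp add: Lp_loc_1_iff)
    then show "set_integrable lebesgue K ?G"
    proof (rule set_integrable_bound)
      show "set_borel_measurable lebesgue K ?G" unfolding set_borel_measurable_def
        using K by (intro borel_measurable_scaleR borel_measurable_indicator radial_field_measurable[OF h]) (simp add: borel_compact)
      show "AE x in lebesgue. x \<in> K \<longrightarrow> norm (?G x) \<le> norm (h (norm x))"
        by (intro AE_I2) (simp add: norm_sgn)
    qed
  qed
  have key: "(LINT x|lebesgue. u x * (d\<phi> x \<bullet> e)) = - (LINT x|lebesgue. \<phi> x * (?G x \<bullet> e))"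
    if \<phi>: "compact_C1 \<phi> d\<phi>" for \<phi> d\<phi> e
  proof -
    obtain R where R: "R > 0" "\<And>x. norm x \<ge> R \<Longrightarrow> \<phi> x = 0 \<and> d\<phi> x = 0"
      using compact_C1_bounded_support[OF \<phi>] by blast
    obtain C where C: "C \<ge> 0" "\<And>x. \<bar>\<phi> x\<bar> \<le> C" "\<And>x. norm (d\<phi> x) \<le> C"
      using compact_C1_bounded[OF \<phi>] by blast
    have \<phi>m[measurable]: "\<phi> \<in> borel_measurable lebesgue" "d\<phi> \<in> borel_measurable lebesgue"
      using compact_C1_continuous[OF \<phi>] by (auto intro: continuous_measurable_lebesgue)
    define b where "b x = d\<phi> x \<bullet> e" for x
    define a where "a x = (sgn x \<bullet> e) * \<phi> x" for x
    have b: "integrable lebesgue b" unfolding b_def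
      using compact_C1_integrable(2)[OF \<phi>] by (rule integrable_inner_left)
    have sb: "\<bar>sgn x \<bullet> e\<bar> \<le> norm e" for x :: 'a
      using Cauchy_Schwarz_ineq2[of "sgn x" e] by (auto simp: norm_sgn split: if_splits)
    have a: "integrable lebesgue a" unfolding a_def
      by (rule integrable_mult_bounded[OF compact_C1_integrable(1)[OF \<phi>] _ sb]) simp
    have b0: "(LINT x|lebesgue. b x) = 0" unfolding b_def by (rule integral_gradient_eq_0[OF \<phi>])
    have bout: "b x = 0" if "norm x \<ge> R" for x using R(2)[OF that] by (simp add: b_def)
    have bbd: "\<bar>b x\<bar> \<le> C * norm e" for x unfolding b_def
      using Cauchy_Schwarz_ineq2[of "d\<phi> x" e] mult_right_mono[OF C(3)[of x] norm_ge_zero[of e]] by linarith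
    have ha: "integrable lebesgue (\<lambda>x. h (norm x) * a x)"
    proof (rule integrable_Lp_loc_bounded[OF hL])
      fix x :: 'a
      have "\<bar>a x\<bar> \<le> norm e * C" unfolding a_def abs_mult
        by (intro mult_mono sb C) auto
      then show "norm (h (norm x) * a x) \<le> (norm e * C) * norm (h (norm x))"
        using mult_left_mono[of "\<bar>a x\<bar>" "norm e * C" "\<bar>h (norm x)\<bar>"] by (simp add: abs_mult mult.commute)
      show "h (norm x) * a x = 0" if "norm x \<ge> R" using R(2)[OF that] by (simp add: a_def)
    qed (use a in auto)
    have T: "(LINT x|lebesgue. h (norm x) * a x) =
       - (LINT s|lborel. h s * (indicator {0<..} s * (LINT x|lebesgue. indicator {x. s < norm x} x * b x)))"
    proof (rule radial_transport[OF a b _ h ha])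
      fix g dg \<xi>
      assume g: "pos_test g dg" and \<xi>: "C1 \<xi> g" "\<And>r. \<xi> r = (LINT s|lborel. indicator {0<..<r} s * g s)"
      obtain \<delta> where \<delta>: "0 < \<delta>" "\<And>r. r < \<delta> \<Longrightarrow> g r = 0" using pos_test_support[OF g] by metis
      have c: "compact_C1 (\<lambda>x. \<xi> (norm x) * \<phi> x) (\<lambda>x. \<xi> (norm x) *\<^sub>R d\<phi> x + \<phi> x *\<^sub>R (g (norm x) *\<^sub>R sgn x))"
        by (rule compact_C1_mult[OF \<phi> C1_radial[OF \<xi>(1) \<delta>]])
      obtain D where D: "\<And>x. \<bar>g x\<bar> \<le> D" using compact_C1_bounded[of g dg] g unfolding pos_test_def by metis
      have cg: "continuous_on UNIV g" by (rule pos_test_continuous[OF g])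
      have gm: "(\<lambda>x::'a. g (norm x)) \<in> borel_measurable lebesgue"
        by (intro continuous_measurable_lebesgue continuous_on_compose2[OF cg]) (auto intro: continuous_intros)
      have i1: "integrable lebesgue (\<lambda>x. g (norm x) * a x)"
        by (rule integrable_mult_bounded[OF a gm D])
      have "integrable lebesgue (\<lambda>x. (\<xi> (norm x) *\<^sub>R d\<phi> x + \<phi> x *\<^sub>R (g (norm x) *\<^sub>R sgn x)) \<bullet> e)"
        using compact_C1_integrable(2)[OF c] by (rule integrable_inner_left)
      moreover have e: "(\<xi> (norm x) *\<^sub>R d\<phi> x + \<phi> x *\<^sub>R (g (norm x) *\<^sub>R sgn x)) \<bullet> e = g (norm x) * a x + \<xi> (norm x) * b x" for x
        by (simp add: a_def b_def inner_add_left)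
      ultimately have i2: "integrable lebesgue (\<lambda>x. g (norm x) * a x + \<xi> (norm x) * b x)" by simp
      have i3: "integrable lebesgue (\<lambda>x. \<xi> (norm x) * b x)"
        using Bochner_Integration.integrable_diff[OF i2 i1] by simp
      have "(LINT x|lebesgue. g (norm x) * a x + \<xi> (norm x) * b x) = 0"
        using integral_gradient_eq_0[OF c, of e] unfolding e .
      then show "(LINT x|lebesgue. g (norm x) * a x) + (LINT x|lebesgue. \<xi> (norm x) * b x) = 0"
        by (simp add: Bochner_Integration.integral_add[OF i1 i3])
    qed
    \<comment> \<open>the sections in \<open>x\<close> are balls, so that their size balances the singularity of \<open>h\<close> at 0\<close>
    let ?K = "{(s::real, x::'a). 0 < s \<and> norm x \<le> s \<and> s < R}"
    have K: "?K \<in> sets (lborel \<Otimes>\<^sub>M lebesgue)"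
      using kernel_sets_lebesgue[of "\<lambda>s r. 0 < s \<and> r \<le> s \<and> s < R"] by measurable
    have int: "integrable lborel (\<lambda>s. h s * (LINT x|lebesgue. indicator ?K (s, x) * \<bar>b x\<bar>))"
    proof (rule Bochner_Integration.integrable_bound[OF integrable_mult_right[OF radial_local_integrable[OF h hloc[of R]]]])
      show "(\<lambda>s. h s * (LINT x|lebesgue. indicator ?K (s, x) * \<bar>b x\<bar>)) \<in> borel_measurable lborel"
        using kernel_integral_measurable[OF sigma_finite_lebesgue K, of "\<lambda>x. \<bar>b x\<bar>"] b by auto
      show "AE s in lborel. norm (h s * (LINT x|lebesgue. indicator ?K (s, x) * \<bar>b x\<bar>)) \<le>
         norm (C * norm e * R * (sphere_density DIM('a) s * (indicator {..R} s * h s)))"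
      proof (intro AE_I2)
        fix s
        show "norm (h s * (LINT x|lebesgue. indicator ?K (s, x) * \<bar>b x\<bar>)) \<le>
          norm (C * norm e * R * (sphere_density DIM('a) s * (indicator {..R} s * h s)))"
        proof (cases "0 < s \<and> s < R")
          case True
          have "(LINT x|lebesgue. indicator ?K (s, x) * \<bar>b x\<bar>) \<le> (LINT x|lebesgue. C * norm e * indicator (cball (0::'a) s) x)"
          proof (rule integral_mono_AE')
            show "integrable lebesgue (\<lambda>x. C * norm e * indicator (cball (0::'a) s) x)"
              by (intro integrable_mult_right)
                (simp add: integrable_indicator_iff emeasure_lborel_cball_finite[unfolded infinity_ennreal_def])
            have "0 \<le> C * norm e" using C(1) by simp
            then show "AE x in lebesgue. indicator ?K (s, x) * \<bar>b x\<bar> \<le> C * norm e * indicator (cball (0::'a) s) x"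
              using bbd by (intro AE_I2) (auto simp: indicator_def)
          qed (use C(1) in \<open>auto intro!: AE_I2\<close>)
          also have "\<dots> = C * norm e * (unit_ball_vol (real DIM('a)) * s ^ DIM('a))"
            using content_cball[of s "0::'a"] True by simp
          also have "s ^ DIM('a) = s * s ^ (DIM('a) - 1)"
            using power_eq_if[of s "DIM('a)"] by simp
          also have "C * norm e * (unit_ball_vol (real DIM('a)) * (s * s ^ (DIM('a) - 1))) =
             C * norm e * s * (1 * unit_ball_vol (real DIM('a)) * s ^ (DIM('a) - 1))" by simp
          also have "\<dots> \<le> C * norm e * R * (real DIM('a) * unit_ball_vol (real DIM('a)) * s ^ (DIM('a) - 1))"
            using True C(1) DIM_positive[where 'a = 'a] by (intro mult_mono) (auto simp: Suc_leI)
          finally have le: "(LINT x|lebesgue. indicator ?K (s, x) * \<bar>b x\<bar>) \<le> C * norm e * R * sphere_density DIM('a) s"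
            using True by (simp add: sphere_density_def)
          have nn: "0 \<le> (LINT x|lebesgue. indicator ?K (s, x) * \<bar>b x\<bar>)" by (rule integral_nonneg_AE) simp
          have "\<bar>h s\<bar> * (LINT x|lebesgue. indicator ?K (s, x) * \<bar>b x\<bar>) \<le> \<bar>h s\<bar> * (C * norm e * R * sphere_density DIM('a) s)"
            by (intro mult_left_mono le) simp
          then show ?thesis using True nn C(1) R(1)
            by (simp add: abs_mult sphere_density_nonneg mult_ac)
        next
          case False
          then have "indicator ?K (s, x) = (0::real)" for x by (auto simp: indicator_def)
          then show ?thesis by simp
        qed
      qed
    qed
    note sw = integral_kernel_swap[OF sigma_finite_lebesgue h K b int]
    \<comment> \<open>inner and outer integrals are opposite because the total integral of \<open>b\<close> is 0\<close>
    have sw3: "h s * (LINT x|lebesgue. indicator ?K (s, x) * b x) =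
        - (h s * (indicator {0<..} s * (LINT x|lebesgue. indicator {x. s < norm x} x * b x)))" for s
    proof -
      consider "s \<le> 0" | "0 < s" "s < R" | "0 < s" "s \<ge> R" by linarith
      then show ?thesis
      proof cases
        case 1
        then have "indicator ?K (s, x) = (0::real)" for x by (auto simp: indicator_def)
        then show ?thesis using 1 by simp
      next
        case 2
        have i: "integrable lebesgue (\<lambda>x. indicator {x. s < norm x} x * b x)"
          by (rule integrable_mult_bounded[OF b, of _ 1]) (auto simp: indicator_def)
        have "indicator ?K (s, x) * b x = b x - indicator {x. s < norm x} x * b x" for x
          using 2 by (auto simp: indicator_def)
        then have "(LINT x|lebesgue. indicator ?K (s, x) * b x) = 0 - (LINT x|lebesgue. indicator {x. s < norm x} x * b x)"
          using Bochner_Integration.integral_diff[OF b i] b0 by simp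
        then show ?thesis using 2 by simp
      next
        case 3
        then have 1: "indicator ?K (s, x) = (0::real)" for x by (auto simp: indicator_def)
        have "(\<lambda>x. indicator {x. s < norm x} x * b x) = (\<lambda>_. 0)"
          using 3 bout by (auto simp: indicator_def)
        then show ?thesis unfolding 1 by simp
      qed
    qed
    have ub: "integrable lebesgue (\<lambda>x. u x * b x)"
    proof (rule integrable_Lp_loc_bounded[OF u])
      fix x show "norm (u x * b x) \<le> (C * norm e) * norm (u x)"
        using mult_left_mono[OF bbd, of "\<bar>u x\<bar>" x] by (simp add: abs_mult mult.commute)
      show "u x * b x = 0" if "norm x \<ge> R" using bout[OF that] by simp
    qed (use b in auto)
    \<comment> \<open>subtracting the constant \<open>V R\<close> is free for the same reason\<close>
    have "(LINT x|lebesgue. u x * b x) = (LINT x|lebesgue. u x * b x - V R * b x)"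
      using Bochner_Integration.integral_diff[OF ub integrable_mult_right[OF b, of "V R"]] b0 by simp
    also have "\<dots> = (LINT x|lebesgue. - ((LINT s|lborel. indicator ?K (s, x) * h s) * b x))"
    proof (rule integral_cong_AE)
      show "AE x in lebesgue. u x * b x - V R * b x = - ((LINT s|lborel. indicator ?K (s, x) * h s) * b x)"
        using uV AE_nonzero_lebesgue
      proof eventually_elim
        case (elim x)
        show ?case
        proof (cases "norm x < R")
          case False
          then show ?thesis using bout[of x] by simp
        next
          case True
          have "(LINT s|lborel. indicator ?K (s, x) * h s) = (LINT s|lborel. indicator {norm x..<R} s * h s)"
          proof (intro Bochner_Integration.integral_cong refl)
            fix s
            have "0 < norm x" using elim(2) by simp
            then have "norm x \<le> s \<Longrightarrow> 0 < s" by linarith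
            then show "indicator ?K (s, x) * h s = indicator {norm x..<R} s * h s"
              by (auto simp: indicator_def)
          qed
          also have "\<dots> = V R - u x" using V[of "norm x" R] True elim by simp
          finally have "(LINT s|lborel. indicator ?K (s, x) * h s) = V R - u x" .
          then show ?thesis by (simp only: left_diff_distrib minus_diff_eq)
        qed
      qed
      show "(\<lambda>x. u x * b x - V R * b x) \<in> borel_measurable lebesgue" using b by measurable
      show "(\<lambda>x. - ((LINT s|lborel. indicator ?K (s, x) * h s) * b x)) \<in> borel_measurable lebesgue"
        using sw(1) by (intro borel_measurable_uminus borel_measurable_integrable)
    qed
    also have "\<dots> = - (LINT s|lborel. h s * (LINT x|lebesgue. indicator ?K (s, x) * b x))"
      using sw(3) by simp
    also have "\<dots> = (LINT s|lborel. h s * (indicator {0<..} s * (LINT x|lebesgue. indicator {x. s < norm x} x * b x)))"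
      unfolding sw3 by simp
    also have "\<dots> = - (LINT x|lebesgue. h (norm x) * a x)" using T by simp
    also have "(LINT x|lebesgue. h (norm x) * a x) = (LINT x|lebesgue. \<phi> x * (?G x \<bullet> e))"
      by (simp add: a_def mult_ac)
    finally show ?thesis by (simp add: b_def)
  qed
  show ?thesis unfolding has_weak_gradient_def
  proof (intro conjI allI impI u GL)
    fix \<phi> d\<phi> assume \<phi>: "compact_C1 \<phi> (d\<phi> :: 'a \<Rightarrow> 'a)"
    note i = integrable_Lp_loc_test[OF u GL \<phi>]
    show "(LINT x|lebesgue. u x *\<^sub>R d\<phi> x) = - (LINT x|lebesgue. \<phi> x *\<^sub>R ?G x)"
    proof (rule euclidean_eqI)
      fix e :: 'a assume "e \<in> Basis"
      have "(LINT x|lebesgue. u x *\<^sub>R d\<phi> x) \<bullet> e = (LINT x|lebesgue. u x * (d\<phi> x \<bullet> e))"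
        using integral_inner_left[of e lebesgue "\<lambda>x. u x *\<^sub>R d\<phi> x"] i(1) by simp
      also have "\<dots> = - (LINT x|lebesgue. \<phi> x * (?G x \<bullet> e))" by (rule key[OF \<phi>])
      also have "(LINT x|lebesgue. \<phi> x * (?G x \<bullet> e)) = (LINT x|lebesgue. \<phi> x *\<^sub>R ?G x) \<bullet> e"
        using integral_inner_left[of e lebesgue "\<lambda>x. \<phi> x *\<^sub>R ?G x"] i(2) by (simp add: mult.assoc)
      finally show "(LINT x|lebesgue. u x *\<^sub>R d\<phi> x) \<bullet> e = (- (LINT x|lebesgue. \<phi> x *\<^sub>R ?G x)) \<bullet> e" by simp
    qed
  qed
qed

text \<open>
  A radial cutoff that vanishes near 0 may be multiplied by a function that is singular at 0,
  such as a negative power of the radius.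
\<close>

lemma C1_times_on_positive:
  fixes f df p dp :: "real \<Rightarrow> real"
  assumes f: "C1 f df" and "\<delta> > 0" and zero: "\<And>r. r < \<delta> \<Longrightarrow> f r = 0" "\<And>r. r < \<delta> \<Longrightarrow> df r = 0"
    and p: "\<And>r. 0 < r \<Longrightarrow> (p has_real_derivative dp r) (at r)" and dp: "\<And>r. 0 < r \<Longrightarrow> isCont dp r"
  shows "C1 (\<lambda>r. f r * p r) (\<lambda>r. df r * p r + f r * dp r)"
  unfolding C1_def
proof
  have D: "(f has_real_derivative df r) (at r)" for r using f unfolding C1_def by simp
  have cd: "isCont df r" for r using f unfolding C1_def by (simp add: continuous_on_eq_continuous_at)
  have near: "eventually (\<lambda>s. s < \<delta>) (nhds r)" if "r < \<delta>" for r
    using eventually_nhds_in_open[of "{..<\<delta>}" r] that by simp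
  show "\<forall>r. GDERIV (\<lambda>r. f r * p r) r :> df r * p r + f r * dp r"
  proof
    fix r
    show "GDERIV (\<lambda>r. f r * p r) r :> df r * p r + f r * dp r"
    proof (cases "0 < r")
      case True
      then show ?thesis by (auto intro!: derivative_eq_intros D p simp: algebra_simps)
    next
      case False
      then have r: "r < \<delta>" using \<open>\<delta> > 0\<close> by simp
      have "((\<lambda>r. f r * p r) has_real_derivative 0) (at r)"
        by (rule has_field_derivative_transform_within_open[where f = "\<lambda>_. 0" and S = "{..<\<delta>}"])
           (use r zero in auto)
      then show ?thesis using zero[OF r] by simp
    qed
  qed
  have "isCont (\<lambda>r. df r * p r + f r * dp r) r" for r
  proof (cases "0 < r")
    case True
    then show ?thesis
      by (intro continuous_intros cd dp DERIV_isCont[OF D] DERIV_isCont[OF p])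
  next
    case False
    then have r: "r < \<delta>" using \<open>\<delta> > 0\<close> by simp
    have "eventually (\<lambda>r. df r * p r + f r * dp r = 0) (nhds r)"
      using near[OF r] by eventually_elim (simp add: zero)
    then show ?thesis by (subst isCont_cong[where g = "\<lambda>_. 0"]) auto
  qed
  then show "continuous_on UNIV (\<lambda>r. df r * p r + f r * dp r)"
    by (simp add: continuous_on_eq_continuous_at)
qed

lemma C1_over_power:
  assumes f: "C1 f df" and \<delta>: "\<delta> > 0" and zero: "\<And>r. r < \<delta> \<Longrightarrow> f r = 0" "\<And>r. r < \<delta> \<Longrightarrow> df r = 0"
    and N: "N \<ge> 1"
  shows "C1 (\<lambda>r. f r * inverse (r ^ N)) (\<lambda>r. df r * inverse (r ^ N) + f r * (- real N * inverse (r ^ (N + 1))))"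
proof (rule C1_times_on_positive[OF f \<delta> zero])
  fix r :: real assume r: "0 < r"
  have "((\<lambda>r. inverse (r ^ N)) has_real_derivative - (inverse (r ^ N) * (real N * r ^ (N - 1)) * inverse (r ^ N))) (at r)"
    using r by (auto intro!: derivative_eq_intros)
  moreover have "- (inverse (r ^ N) * (real N * r ^ (N - 1)) * inverse (r ^ N)) = - real N * inverse (r ^ (N + 1))"
  proof -
    have "r ^ N = r * r ^ (N - 1)" using N power_eq_if[of r N] by simp
    then show ?thesis using r by (simp add: field_simps)
  qed
  ultimately show "((\<lambda>r. inverse (r ^ N)) has_real_derivative - real N * inverse (r ^ (N + 1))) (at r)"
    by (simp only:)
  show "isCont (\<lambda>r. - real N * inverse (r ^ (N + 1))) r"
    using r by (intro continuous_intros) auto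
qed auto

lemma integrable_over_norm_power:
  fixes F :: "'a::euclidean_space \<Rightarrow> real"
  assumes F: "F \<in> borel_measurable lebesgue" and k [measurable]: "k \<in> borel_measurable borel"
    and ki: "integrable lborel (\<lambda>s. indicator {0<..<R} s * k s)"
    and bd: "\<And>x. \<bar>F x\<bar> \<le> C * (\<bar>k (norm x)\<bar> / norm x ^ (DIM('a) - 1))"
    and out: "\<And>x. norm x \<ge> R \<Longrightarrow> F x = 0"
  shows "integrable lebesgue F"
proof (rule Bochner_Integration.integrable_bound[OF _ F])
  let ?f = "\<lambda>r. C * (indicator {..<R} r * (k r / r ^ (DIM('a) - 1)))"
  have "integrable lborel (\<lambda>r. C * real DIM('a) * unit_ball_vol (real DIM('a)) * (indicator {0<..<R} r * k r))"
    by (rule integrable_mult_right[OF ki])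
  moreover have "sphere_density DIM('a) r * ?f r = C * real DIM('a) * unit_ball_vol (real DIM('a)) * (indicator {0<..<R} r * k r)" for r
    by (auto simp: sphere_density_def indicator_def)
  ultimately show "integrable lebesgue (\<lambda>x::'a. ?f (norm x))"
    by (subst integrable_radial_iff) auto
  show "AE x in lebesgue. norm (F x) \<le> norm (?f (norm x))"
  proof (intro AE_I2)
    fix x
    show "norm (F x) \<le> norm (?f (norm x))"
    proof (cases "norm x < R")
      case True
      have "norm (F x) \<le> C * (\<bar>k (norm x)\<bar> / norm x ^ (DIM('a) - 1))" using bd by simp
      also have "\<dots> \<le> \<bar>C\<bar> * (\<bar>k (norm x)\<bar> / norm x ^ (DIM('a) - 1))"
        by (intro mult_right_mono) auto
      finally show ?thesis using True by (simp add: abs_mult)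
    next
      case False then show ?thesis using out[of x] by simp
    qed
  qed
qed

text \<open>
  The field \<open>x/|x|\<^sup>N\<close> is divergence free away from the origin. Hence the divergence of
  \<open>\<xi>(|x|) \<phi> x/|x|\<^sup>N\<close> consists of the two terms in which \<open>\<xi>\<close> or \<open>\<phi>\<close> is differentiated, and
  \<open>radial_transport\<close> applies with \<open>a = \<phi>/|x|\<^sup>N\<^sup>-\<^sup>1\<close> and \<open>b = (\<nabla>\<phi> \<bullet> x/|x|)/|x|\<^sup>N\<^sup>-\<^sup>1\<close>. For the flux
  \<open>- m(|x|) x/|x|\<^sup>N\<close> this is the weak form of the statement that its divergence
  is \<open>- h(|x|)/|x|\<^sup>N\<^sup>-\<^sup>1\<close>. There is no contribution of the origin because \<open>m\<close> is the integral of \<open>h\<close> from 0.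
\<close>

lemma flux_radial:
  fixes \<phi> :: "'a::euclidean_space \<Rightarrow> real"
  defines "N \<equiv> DIM('a)"
  assumes h [measurable]: "h \<in> borel_measurable borel"
    and hi: "\<And>R. integrable lborel (\<lambda>s. indicator {0<..<R} s * h s)"
    and m: "\<And>r. 0 < r \<Longrightarrow> m r = (LINT s|lborel. indicator {0<..<r} s * h s)"
    and mm [measurable]: "m \<in> borel_measurable borel"
    and \<phi>: "compact_C1 \<phi> d\<phi>"
  shows "integrable lebesgue (\<lambda>x. h (norm x) * (\<phi> x / norm x ^ (N - 1)))"
    and "integrable lebesgue (\<lambda>x. m (norm x) * ((d\<phi> x \<bullet> sgn x) / norm x ^ (N - 1)))"
    and "(LINT x|lebesgue. h (norm x) * (\<phi> x / norm x ^ (N - 1))) =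
       - (LINT x|lebesgue. m (norm x) * ((d\<phi> x \<bullet> sgn x) / norm x ^ (N - 1)))"
proof -
  have N: "N \<ge> 1" by (simp add: N_def Suc_leI)
  obtain R where R: "R > 0" "\<And>x. norm x \<ge> R \<Longrightarrow> \<phi> x = 0 \<and> d\<phi> x = 0"
    using compact_C1_bounded_support[OF \<phi>] by blast
  obtain C where C: "C \<ge> 0" "\<And>x. \<bar>\<phi> x\<bar> \<le> C" "\<And>x. norm (d\<phi> x) \<le> C"
    using compact_C1_bounded[OF \<phi>] by blast
  have [measurable]: "\<phi> \<in> borel_measurable lebesgue" "d\<phi> \<in> borel_measurable lebesgue"
    using compact_C1_continuous[OF \<phi>] by (auto intro: continuous_measurable_lebesgue)
  have [measurable]: "(sgn :: 'a \<Rightarrow> 'a) \<in> borel_measurable lebesgue" by (rule sgn_measurable_lebesgue)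
  define a where "a x = \<phi> x / norm x ^ (N - 1)" for x
  define b where "b x = (d\<phi> x \<bullet> sgn x) / norm x ^ (N - 1)" for x
  have am[measurable]: "a \<in> borel_measurable lebesgue" unfolding a_def by measurable
  have bm[measurable]: "b \<in> borel_measurable lebesgue" unfolding b_def by measurable
  have one: "integrable lborel (\<lambda>s. indicator {0<..<R} s * (1::real))"
    using R(1) by (simp add: integrable_indicator_iff)
  have ds: "\<bar>d\<phi> x \<bullet> sgn x\<bar> \<le> C" for x
  proof -
    have "\<bar>d\<phi> x \<bullet> sgn x\<bar> \<le> norm (d\<phi> x) * norm (sgn x)" by (rule Cauchy_Schwarz_ineq2)
    also have "\<dots> \<le> norm (d\<phi> x) * 1" by (intro mult_left_mono) (auto simp: norm_sgn)
    finally show ?thesis using C(3)[of x] by simp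
  qed
  have aout: "a x = 0" "b x = 0" if "norm x \<ge> R" for x using R(2)[OF that] by (auto simp: a_def b_def)
  have abd: "\<bar>a x\<bar> \<le> C / norm x ^ (N - 1)" "\<bar>b x\<bar> \<le> C / norm x ^ (N - 1)" for x
    using C(2) ds by (auto simp: a_def b_def intro!: divide_right_mono)
  have a: "integrable lebesgue a"
    by (rule integrable_over_norm_power[of _ "\<lambda>_. 1" R C, OF am _ one]) (use abd aout in \<open>auto simp: N_def\<close>)
  have b: "integrable lebesgue b"
    by (rule integrable_over_norm_power[of _ "\<lambda>_. 1" R C, OF bm _ one]) (use abd aout in \<open>auto simp: N_def\<close>)
  have ha: "integrable lebesgue (\<lambda>x. h (norm x) * a x)"
  proof (rule integrable_over_norm_power[of _ h R C, OF _ h hi])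
    fix x :: 'a
    show "\<bar>h (norm x) * a x\<bar> \<le> C * (\<bar>h (norm x)\<bar> / norm x ^ (DIM('a) - 1))"
      using mult_left_mono[OF abd(1), of "\<bar>h (norm x)\<bar>" x] by (simp add: abs_mult N_def mult.commute)
    show "h (norm x) * a x = 0" if "norm x \<ge> R" using aout[OF that] by simp
  qed measurable
  have T: "(LINT x|lebesgue. h (norm x) * a x) =
     - (LINT s|lborel. h s * (indicator {0<..} s * (LINT x|lebesgue. indicator {x. s < norm x} x * b x)))"
  proof (rule radial_transport[OF a b _ h ha])
    fix g dg \<xi>
    assume g: "pos_test g dg" and \<xi>: "C1 \<xi> g" "\<And>r. \<xi> r = (LINT s|lborel. indicator {0<..<r} s * g s)"
    obtain \<delta> where \<delta>: "0 < \<delta>" "\<And>r. r < \<delta> \<Longrightarrow> g r = 0" using pos_test_support[OF g] by metis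
    have \<xi>0: "\<xi> r = 0" if "r < \<delta>" for r
    proof -
      have "(\<lambda>s. indicator {0<..<r} s * g s) = (\<lambda>_. 0)" using \<delta>(2) that by (auto simp: indicator_def)
      then show ?thesis unfolding \<xi>(2) by simp
    qed
    \<comment> \<open>the radial factor of the field \<open>\<xi>(|x|) x/|x|\<^sup>N\<close>\<close>
    let ?\<eta> = "\<lambda>r. \<xi> r * inverse (r ^ N)"
    let ?d = "\<lambda>r. g r * inverse (r ^ N) + \<xi> r * (- real N * inverse (r ^ (N + 1)))"
    have \<eta>: "C1 ?\<eta> ?d"
      by (rule C1_over_power[OF \<xi>(1) \<delta>(1) \<xi>0 \<delta>(2) N])
    have \<eta>0: "?d r = 0" if "r < \<delta>" for r using that \<delta>(2) \<xi>0 by simp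
    have c: "compact_C1 (\<lambda>x. ?\<eta> (norm x) * \<phi> x) (\<lambda>x. ?\<eta> (norm x) *\<^sub>R d\<phi> x + \<phi> x *\<^sub>R (?d (norm x) *\<^sub>R sgn x))"
      by (rule compact_C1_mult[OF \<phi> C1_radial[OF \<eta> \<delta>(1) \<eta>0]])
    have e: "real N * (?\<eta> (norm x) * \<phi> x) + x \<bullet> (?\<eta> (norm x) *\<^sub>R d\<phi> x + \<phi> x *\<^sub>R (?d (norm x) *\<^sub>R sgn x)) =
        g (norm x) * a x + \<xi> (norm x) * b x" for x
    proof (cases "x = 0")
      case True
      then show ?thesis using \<xi>0[of 0] \<delta> by (simp add: a_def b_def)
    next
      case False
      define r where "r = norm x"
      have r: "r > 0" using False by (simp add: r_def)
      have x1: "x \<bullet> sgn x = r" using False by (simp add: sgn_div_norm r_def power2_norm_eq_inner[symmetric] power2_eq_square)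
      have x2: "x \<bullet> d\<phi> x = r * (d\<phi> x \<bullet> sgn x)" using False by (simp add: sgn_div_norm r_def inner_commute)
      define P where "P = r ^ (N - 1)"
      have P: "P > 0" using r by (simp add: P_def)
      have pN: "r ^ N = r * P" "r ^ (N + 1) = r * (r * P)" using N power_eq_if[of r N] by (simp_all add: P_def)
      have alg: "n * (\<xi>r * inverse (r * P) * p) + (\<xi>r * inverse (r * P) * (r * d) + p * ((gr * inverse (r * P) + \<xi>r * (- n * inverse (r * (r * P)))) * r))
          = gr * (p / P) + \<xi>r * (d / P)" for n \<xi>r p d gr :: real
        using r P by (simp add: field_simps)
      have "real N * (?\<eta> r * \<phi> x) + (?\<eta> r * (x \<bullet> d\<phi> x) + \<phi> x * (?d r * (x \<bullet> sgn x))) = g r * a x + \<xi> r * b x"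
        unfolding x1 x2 a_def b_def r_def[symmetric] pN P_def[symmetric] by (rule alg)
      then show ?thesis unfolding r_def by (simp add: inner_add_right)
    qed
    obtain D where D: "\<And>x. \<bar>g x\<bar> \<le> D" using compact_C1_bounded[of g dg] g unfolding pos_test_def by metis
    have cg: "continuous_on UNIV g" by (rule pos_test_continuous[OF g])
    have gm: "(\<lambda>x::'a. g (norm x)) \<in> borel_measurable lebesgue"
      by (intro continuous_measurable_lebesgue continuous_on_compose2[OF cg]) (auto intro: continuous_intros)
    have i1: "integrable lebesgue (\<lambda>x. g (norm x) * a x)"
      by (rule integrable_mult_bounded[OF a gm D])
    obtain E where E: "\<And>x. \<bar>\<xi> x\<bar> \<le> E"
    proof -
      have gi: "integrable lborel (\<lambda>s. \<bar>g s\<bar>)" using pos_test_integrable[OF g] by simp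
      have "\<bar>\<xi> r\<bar> \<le> (LINT s|lborel. \<bar>g s\<bar>)" for r
      proof -
        have "\<bar>\<xi> r\<bar> \<le> (LINT s|lborel. \<bar>indicator {0<..<r} s * g s\<bar>)"
          unfolding \<xi>(2) by (rule integral_abs_bound)
        also have "\<dots> \<le> (LINT s|lborel. \<bar>g s\<bar>)"
          by (rule integral_mono_AE') (use gi in \<open>auto simp: indicator_def\<close>)
        finally show ?thesis .
      qed
      then show ?thesis using that by blast
    qed
    have \<xi>m: "(\<lambda>x::'a. \<xi> (norm x)) \<in> borel_measurable lebesgue"
      by (intro continuous_measurable_lebesgue continuous_on_compose2[OF C1_continuous[OF \<xi>(1)]]) (auto intro: continuous_intros)
    have i3: "integrable lebesgue (\<lambda>x. \<xi> (norm x) * b x)"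
      by (rule integrable_mult_bounded[OF b \<xi>m E])
    have "(LINT x|lebesgue. g (norm x) * a x + \<xi> (norm x) * b x) = 0"
      using integral_divergence_position[OF c] unfolding N_def[symmetric] e .
    then show "(LINT x|lebesgue. g (norm x) * a x) + (LINT x|lebesgue. \<xi> (norm x) * b x) = 0"
      by (simp add: Bochner_Integration.integral_add[OF i1 i3])
  qed
  let ?K = "{(s::real, x::'a). 0 < s \<and> s < norm x}"
  have K: "?K \<in> sets (lborel \<Otimes>\<^sub>M lebesgue)"
    using kernel_sets_lebesgue[of "\<lambda>s r. 0 < s \<and> s < r"] by measurable
  have int: "integrable lborel (\<lambda>s. h s * (LINT x|lebesgue. indicator ?K (s, x) * \<bar>b x\<bar>))"
  proof (rule Bochner_Integration.integrable_bound[OF integrable_mult_right[OF hi[of R]]])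
    show "(\<lambda>s. h s * (LINT x|lebesgue. indicator ?K (s, x) * \<bar>b x\<bar>)) \<in> borel_measurable lborel"
      using kernel_integral_measurable[OF sigma_finite_lebesgue K, of "\<lambda>x. \<bar>b x\<bar>"] by auto
    show "AE s in lborel. norm (h s * (LINT x|lebesgue. indicator ?K (s, x) * \<bar>b x\<bar>)) \<le>
       norm ((LINT x|lebesgue. \<bar>b x\<bar>) * (indicator {0<..<R} s * h s))"
    proof (intro AE_I2)
      fix s
      show "norm (h s * (LINT x|lebesgue. indicator ?K (s, x) * \<bar>b x\<bar>)) \<le>
        norm ((LINT x|lebesgue. \<bar>b x\<bar>) * (indicator {0<..<R} s * h s))"
      proof (cases "0 < s \<and> s < R")
        case True
        have le: "(LINT x|lebesgue. indicator ?K (s, x) * \<bar>b x\<bar>) \<le> (LINT x|lebesgue. \<bar>b x\<bar>)"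
          by (rule integral_mono_AE') (use b in \<open>auto simp: indicator_def\<close>)
        have nn: "0 \<le> (LINT x|lebesgue. indicator ?K (s, x) * \<bar>b x\<bar>)" by (rule integral_nonneg_AE) simp
        have "\<bar>h s\<bar> * (LINT x|lebesgue. indicator ?K (s, x) * \<bar>b x\<bar>) \<le> \<bar>h s\<bar> * (LINT x|lebesgue. \<bar>b x\<bar>)"
          by (intro mult_left_mono le) simp
        then show ?thesis using True nn by (simp add: abs_mult mult_ac)
      next
        case False
        then have "(\<lambda>x. indicator ?K (s, x) * \<bar>b x\<bar>) = (\<lambda>_. 0)" using aout(2) by (force simp: indicator_def)
        then show ?thesis by simp
      qed
    qed
  qed
  note sw = integral_kernel_swap[OF sigma_finite_lebesgue h K b int]
  have sw3: "h s * (LINT x|lebesgue. indicator ?K (s, x) * b x) =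
      h s * (indicator {0<..} s * (LINT x|lebesgue. indicator {x. s < norm x} x * b x))" for s
  proof (cases "s \<le> 0")
    case True
    then have "indicator ?K (s, x) = (0::real)" for x by (auto simp: indicator_def)
    then show ?thesis using True by simp
  next
    case False
    then have "indicator ?K (s, x) = (indicator {x. s < norm x} x :: real)" for x by (auto simp: indicator_def)
    then show ?thesis using False by simp
  qed
  have ae: "AE x in lebesgue. (LINT s|lborel. indicator ?K (s, x) * h s) * b x = m (norm x) * b x"
    using AE_nonzero_lebesgue
  proof eventually_elim
    case (elim x)
    have "(LINT s|lborel. indicator ?K (s, x) * h s) = (LINT s|lborel. indicator {0<..<norm x} s * h s)"
      by (intro Bochner_Integration.integral_cong) (auto simp: indicator_def)
    then show ?case using m[of "norm x"] elim by simp
  qed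
  have mbm: "(\<lambda>x. m (norm x) * b x) \<in> borel_measurable lebesgue" by measurable
  show "integrable lebesgue (\<lambda>x. h (norm x) * (\<phi> x / norm x ^ (N - 1)))"
    using ha unfolding a_def .
  show "integrable lebesgue (\<lambda>x. m (norm x) * ((d\<phi> x \<bullet> sgn x) / norm x ^ (N - 1)))"
    using integrable_cong_AE_imp[OF sw(1) mbm ae] unfolding b_def .
  have "(LINT x|lebesgue. m (norm x) * b x) = (LINT x|lebesgue. (LINT s|lborel. indicator ?K (s, x) * h s) * b x)"
    by (rule integral_cong_AE[OF mbm borel_measurable_integrable[OF sw(1)]])
       (rule eventually_mono[OF ae], rule sym)
  also have "\<dots> = (LINT s|lborel. h s * (indicator {0<..} s * (LINT x|lebesgue. indicator {x. s < norm x} x * b x)))"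
    using sw(3) unfolding sw3 .
  finally show "(LINT x|lebesgue. h (norm x) * (\<phi> x / norm x ^ (N - 1))) =
       - (LINT x|lebesgue. m (norm x) * ((d\<phi> x \<bullet> sgn x) / norm x ^ (N - 1)))"
    using T unfolding a_def b_def by simp
qed

text \<open>
  The definition of the weak gradient with the test functions \<open>\<zeta>(x) (x \<bullet> i)\<close>, summed over the
  coordinates: the field \<open>\<zeta>(x) x\<close> is tested against \<open>u\<close>. For a radial \<open>u\<close> a
  radial test function gives only \<open>0 = 0\<close>, by oddness.
\<close>

lemma weak_gradient_divergence_position:
  fixes u :: "'a::euclidean_space \<Rightarrow> real"
  assumes G: "has_weak_gradient u G" and \<zeta>: "compact_C1 \<zeta> d\<zeta>"
  shows "(LINT x|lebesgue. u x * (real DIM('a) * \<zeta> x + x \<bullet> d\<zeta> x)) = - (LINT x|lebesgue. \<zeta> x * (x \<bullet> G x))"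
proof -
  have u1: "Lp_loc 1 u" and G1: "Lp_loc 1 G" using G unfolding has_weak_gradient_def by auto
  let ?d = "\<lambda>i x. (x \<bullet> i) *\<^sub>R d\<zeta> x + \<zeta> x *\<^sub>R i"
  have c: "compact_C1 (\<lambda>x. (x \<bullet> i) * \<zeta> x) (?d i)" for i :: 'a
    by (rule compact_C1_mult[OF \<zeta> C1_inner])
  note i = integrable_Lp_loc_test[OF u1 G1 c]
  have comp: "(LINT x|lebesgue. u x * (?d i x \<bullet> i)) = - (LINT x|lebesgue. (x \<bullet> i) * \<zeta> x * (G x \<bullet> i))" for i :: 'a
  proof -
    have eq: "(LINT x|lebesgue. u x *\<^sub>R ?d i x) = - (LINT x|lebesgue. ((x \<bullet> i) * \<zeta> x) *\<^sub>R G x)"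
      using G c unfolding has_weak_gradient_def by blast
    have "(LINT x|lebesgue. u x * (?d i x \<bullet> i)) = (LINT x|lebesgue. u x *\<^sub>R ?d i x) \<bullet> i"
      using integral_inner_left[OF i(1)] by simp
    also have "\<dots> = - ((LINT x|lebesgue. ((x \<bullet> i) * \<zeta> x) *\<^sub>R G x) \<bullet> i)" unfolding eq by simp
    also have "(LINT x|lebesgue. ((x \<bullet> i) * \<zeta> x) *\<^sub>R G x) \<bullet> i = (LINT x|lebesgue. (x \<bullet> i) * \<zeta> x * (G x \<bullet> i))"
      using integral_inner_left[OF i(2)] by simp
    finally show ?thesis .
  qed
  have ii: "integrable lebesgue (\<lambda>x. u x * (?d i x \<bullet> i))" "integrable lebesgue (\<lambda>x. (x \<bullet> i) * \<zeta> x * (G x \<bullet> i))" for i :: 'a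
    using integrable_inner_left[OF i(1)] integrable_inner_left[OF i(2)] by auto
  have "(LINT x|lebesgue. u x * (real DIM('a) * \<zeta> x + x \<bullet> d\<zeta> x)) = (LINT x|lebesgue. (\<Sum>i\<in>Basis. u x * (?d i x \<bullet> i)))"
    by (rule Bochner_Integration.integral_cong)
       (auto simp: inner_add_left sum.distrib euclidean_inner[of _ "d\<zeta> _"] sum_distrib_left[symmetric])
  also have "\<dots> = (\<Sum>i\<in>Basis. LINT x|lebesgue. u x * (?d i x \<bullet> i))"
    by (rule Bochner_Integration.integral_sum) (rule ii)
  also have "\<dots> = - (\<Sum>i\<in>Basis. LINT x|lebesgue. (x \<bullet> i) * \<zeta> x * (G x \<bullet> i))"
    unfolding comp by (simp add: sum_negf)
  also have "(\<Sum>i\<in>Basis. LINT x|lebesgue. (x \<bullet> i) * \<zeta> x * (G x \<bullet> i)) = (LINT x|lebesgue. (\<Sum>i\<in>Basis. (x \<bullet> i) * \<zeta> x * (G x \<bullet> i)))"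
    by (rule Bochner_Integration.integral_sum[symmetric]) (rule ii)
  also have "\<dots> = (LINT x|lebesgue. \<zeta> x * (x \<bullet> G x))"
    by (rule Bochner_Integration.integral_cong)
       (auto simp: euclidean_inner[of _ "G _"] sum_distrib_left mult_ac)
  finally show ?thesis .
qed

section \<open>The structure of radial weakly differentiable functions\<close>

lemma pos_test_unit_bump:
  obtains g dg where "pos_test g dg" "(LINT r|lborel. g r) = 1"
proof -
  have 1: "C1 (\<lambda>r::real. (r - 1) * (2 - r)) (\<lambda>r. 3 - 2 * r)"
    unfolding C1_def by (auto intro!: derivative_eq_intros continuous_intros simp: algebra_simps)
  define k where "k r = (max 0 ((r - 1) * (2 - r)))\<^sup>2" for r :: real
  define dk where "dk r = (2 * max 0 ((r - 1) * (2 - r))) *\<^sub>R (3 - 2 * r)" for r :: real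
  have k: "C1 k dk" unfolding k_def dk_def using C1_compose[OF 1 C1_max_square] .
  have out: "k r = 0" if "r < 1 \<or> r > 2" for r
  proof -
    have "(r - 1) * (2 - r) \<le> 0" using that by (auto simp: mult_le_0_iff)
    then show ?thesis by (simp add: k_def)
  qed
  have pk: "pos_test k dk" by (rule pos_testI[OF k, of 1 2]) (use out in auto)
  have nn: "k r \<ge> 0" for r by (simp add: k_def)
  have "(LINT r|lborel. k r) \<noteq> 0"
  proof
    assume "(LINT r|lborel. k r) = 0"
    then have "AE r in lborel. k r = 0"
      using integral_nonneg_eq_0_iff_AE[OF pos_test_integrable[OF pk]] nn by simp
    then have "AE r in lborel. r \<notin> {1<..<2::real}"
    proof eventually_elim
      case (elim r)
      have "k r > 0" if "r \<in> {1<..<2}"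
      proof -
        have "(r - 1) * (2 - r) > 0" using that by (intro mult_pos_pos) auto
        then show ?thesis unfolding k_def by (intro zero_less_power less_max_iff_disj[THEN iffD2, OF disjI2])
      qed
      then show ?case using elim by auto
    qed
    then have "emeasure lborel {1<..<2::real} = 0"
      using AE_iff_null_sets[of "{1<..<2::real}" lborel] by auto
    then show False by simp
  qed
  then obtain c where c: "c * (LINT r|lborel. k r) = 1" by (metis nonzero_divide_eq_eq)
  have "pos_test (\<lambda>r. c * k r) (\<lambda>r. c *\<^sub>R dk r + k r *\<^sub>R 0)"
    by (rule pos_testI[OF C1_mult[OF C1_const k], where \<delta> = 1 and R = 2]) (use out in auto)
  then show ?thesis using c by (intro that) auto
qed

lemma pos_test_diff_scaled:
  assumes "pos_test f df" "pos_test g dg"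
  shows "pos_test (\<lambda>r. f r - c * g r) (\<lambda>r. df r - c * dg r)"
proof -
  obtain \<delta> R where 1: "0 < \<delta>" "\<And>r. r < \<delta> \<Longrightarrow> f r = 0" "\<And>r. r > R \<Longrightarrow> f r = 0"
    using pos_test_support[OF assms(1)] by metis
  obtain \<delta>' R' where 2: "0 < \<delta>'" "\<And>r. r < \<delta>' \<Longrightarrow> g r = 0" "\<And>r. r > R' \<Longrightarrow> g r = 0"
    using pos_test_support[OF assms(2)] by metis
  have "C1 f df" "C1 g dg" using assms compact_C1_imp_C1 unfolding pos_test_def by auto
  then have "C1 (\<lambda>r. f r - c * g r) (\<lambda>r. df r - c * dg r)"
    unfolding C1_def by (auto intro!: derivative_eq_intros continuous_intros)
  then show ?thesis
    by (rule pos_testI[of _ _ "min \<delta> \<delta>'" "max R R'"]) (use 1 2 in auto)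
qed

lemma integrable_lborel_mult_pos_test:
  assumes f [measurable]: "f \<in> borel_measurable borel"
    and int: "\<And>a b. 0 < a \<Longrightarrow> integrable lborel (\<lambda>r. indicator {a..b} r * f r)"
    and g: "pos_test g dg"
  shows "integrable lborel (\<lambda>r. g r * f r)" "integrable lborel (\<lambda>r. dg r * f r)"
proof -
  obtain \<delta> R where dR: "0 < \<delta>" "\<delta> < R" "\<And>r. r < \<delta> \<Longrightarrow> g r = 0" "\<And>r. r > R \<Longrightarrow> g r = 0"
    "\<And>r. r < \<delta> \<Longrightarrow> dg r = 0" "\<And>r. r > R \<Longrightarrow> dg r = 0"
    using pos_test_support[OF g] by metis
  have c: "compact_C1 g dg" using g by (simp add: pos_test_def)
  obtain C where C: "\<And>x. \<bar>g x\<bar> \<le> C" "\<And>x. \<bar>dg x\<bar> \<le> C"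
    using compact_C1_bounded[OF c] by (metis real_norm_def)
  have m: "g \<in> borel_measurable lborel" "dg \<in> borel_measurable lborel"
    using compact_C1_continuous[OF c] by (auto intro: borel_measurable_continuous_onI)
  have e: "g r * (indicator {\<delta>..R} r * f r) = g r * f r" "dg r * (indicator {\<delta>..R} r * f r) = dg r * f r" for r
    by (cases "r < \<delta>"; cases "r > R"; simp add: dR not_less)+
  show "integrable lborel (\<lambda>r. g r * f r)"
    using integrable_mult_bounded[OF int[OF dR(1), of R] m(1) C(1)] unfolding e .
  show "integrable lborel (\<lambda>r. dg r * f r)"
    using integrable_mult_bounded[OF int[OF dR(1), of R] m(2) C(2)] unfolding e .
qed

text \<open>
  Subtracting from a test function \<open>g\<close> the multiple of a fixed bump \<open>g0\<close> with the same integral leaves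
  the derivative of a test function. So \<open>f - c\<close> is orthogonal to all test functions when \<open>c\<close> is the
  integral of \<open>f\<close> against \<open>g0\<close>.
\<close>

lemma du_bois_reymond:
  fixes f :: "real \<Rightarrow> real"
  assumes f [measurable]: "f \<in> borel_measurable borel"
    and int: "\<And>a b. 0 < a \<Longrightarrow> integrable lborel (\<lambda>r. indicator {a..b} r * f r)"
    and zero: "\<And>g dg. pos_test g dg \<Longrightarrow> (LINT r|lborel. dg r * f r) = 0"
  obtains c where "AE r in lborel. 0 < r \<longrightarrow> f r = c"
proof -
  obtain g0 dg0 where g0: "pos_test g0 dg0" "(LINT r|lborel. g0 r) = 1" by (rule pos_test_unit_bump)
  define c where "c = (LINT r|lborel. g0 r * f r)"
  have "AE r in lborel. 0 < r \<longrightarrow> f r - c = 0"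
  proof (rule AE_lborel_eq_0_if_pos_test_orthogonal)
    fix a b :: real assume "0 < a"
    have "integrable lborel (\<lambda>r. indicator {a..b} r * f r - c * indicator {a..b} r)"
      using int[OF \<open>0 < a\<close>] by (intro Bochner_Integration.integrable_diff integrable_mult_right)
        (auto simp: integrable_indicator_iff emeasure_lborel_Icc_eq)
    then show "integrable lborel (\<lambda>r. indicator {a..b} r * (f r - c))" by (simp add: algebra_simps)
  next
    fix g dg assume g: "pos_test g dg"
    define I where "I = (LINT r|lborel. g r)"
    define k where "k r = g r - I * g0 r" for r
    have k: "pos_test k (\<lambda>r. dg r - I * dg0 r)" unfolding k_def by (rule pos_test_diff_scaled[OF g g0(1)])
    have ki: "(LINT r|lborel. k r) = 0" unfolding k_def
      using pos_test_integrable[OF g] pos_test_integrable[OF g0(1)] g0(2) by (simp add: I_def)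
    obtain \<delta> R where dR: "0 < \<delta>" "\<delta> < R" "\<And>r. r < \<delta> \<Longrightarrow> k r = 0" "\<And>r. r > R \<Longrightarrow> k r = 0"
      using pos_test_support[OF k] by metis
    obtain \<xi> where \<xi>: "C1 \<xi> k" "\<And>r. \<xi> r = (LINT s|lborel. indicator {0<..<r} s * k s)"
      using pos_test_primitive[OF k] by metis
    have "pos_test \<xi> k"
    proof (rule pos_testI[OF \<xi>(1) dR(1), of R])
      fix r assume "r < \<delta>"
      then have "(\<lambda>s. indicator {0<..<r} s * k s) = (\<lambda>_. 0)" using dR(3) by (auto simp: indicator_def)
      then show "\<xi> r = 0" unfolding \<xi>(2) by simp
    next
      fix r assume r: "r > R"
      have "indicator {0<..<r} s * k s = k s" for s
        
      proof -
        consider "s < \<delta>" | "s > R" | "0 < s" "s < r" using dR(1,2) r by linarith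
        then show ?thesis by cases (auto simp: dR)
      qed
      then show "\<xi> r = 0" unfolding \<xi>(2) using ki by (simp only:)
    qed
    from zero[OF this] have z: "(LINT r|lborel. k r * f r) = 0" .
    note i1 = integrable_lborel_mult_pos_test(1)[OF f int g]
    note i2 = integrable_lborel_mult_pos_test(1)[OF f int g0(1)]
    have "(LINT r|lborel. k r * f r) = (LINT r|lborel. g r * f r - I * (g0 r * f r))"
      by (simp add: k_def algebra_simps)
    also have "\<dots> = (LINT r|lborel. g r * f r) - I * c" using i1 i2 by (simp add: c_def)
    finally have "(LINT r|lborel. g r * f r) = I * c" using z by simp
    moreover have "(LINT r|lborel. (f r - c) * g r) = (LINT r|lborel. g r * f r - c * g r)"
      by (simp add: algebra_simps)
    moreover have "\<dots> = (LINT r|lborel. g r * f r) - c * I"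
      using i1 pos_test_integrable[OF g] by (simp add: I_def)
    ultimately show "(LINT r|lborel. (f r - c) * g r) = 0" by simp
  qed simp
  then show ?thesis using that[of c] by simp
qed

text \<open>
  The base point is 1 rather than 0, since \<open>h\<close> need not be integrable at 0.
\<close>

lemma primitive_on_positive:
  fixes h :: "real \<Rightarrow> real"
  assumes h [measurable]: "h \<in> borel_measurable borel"
    and int: "\<And>a b. 0 < a \<Longrightarrow> integrable lborel (\<lambda>r. indicator {a..b} r * h r)"
  obtains V where "V \<in> borel_measurable borel"
    "\<And>r R. 0 < r \<Longrightarrow> r \<le> R \<Longrightarrow> V R - V r = (LINT s|lborel. indicator {r..<R} s * h s)"
proof -
  have hi: "integrable lborel (\<lambda>s. indicator {r..<R} s * h s)" if "0 < r" for r R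
  proof (rule Bochner_Integration.integrable_bound[OF int[OF that, of R]])
    show "AE s in lborel. norm (indicator {r..<R} s * h s) \<le> norm (indicator {r..R} s * h s)"
      by (intro AE_I2) (auto simp: indicator_def)
  qed measurable
  define V where "V r = (LINT s|lborel. indicator {1..<r} s * h s) - (LINT s|lborel. indicator {r..<1} s * h s)" for r
  show ?thesis
  proof (rule that)
    have 1: "(\<lambda>r. LINT s|lborel. (if 1 \<le> s \<and> s < r then h s else 0)) \<in> borel_measurable borel"
      by (rule lborel.borel_measurable_lebesgue_integral) measurable
    have 2: "(\<lambda>r. LINT s|lborel. (if r \<le> s \<and> s < 1 then h s else 0)) \<in> borel_measurable borel"
      by (rule lborel.borel_measurable_lebesgue_integral) measurable
    have e: "(if 1 \<le> s \<and> s < r then h s else 0) = indicator {1..<r} s * h s"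
      "(if r \<le> s \<and> s < 1 then h s else 0) = indicator {r..<1} s * h s" for r s
      by (auto simp: indicator_def)
    show "V \<in> borel_measurable borel" unfolding V_def using borel_measurable_diff[OF 1 2] unfolding e .
    fix r R :: real assume r: "0 < r" "r \<le> R"
    then have R: "0 < R" by simp
    have "V R - V r = (LINT s|lborel. indicator {1..<R} s * h s - indicator {R..<1} s * h s) -
       (LINT s|lborel. indicator {1..<r} s * h s - indicator {r..<1} s * h s)"
      unfolding V_def using hi[of 1] hi[OF r(1)] hi[OF R] by simp
    also have "\<dots> = (LINT s|lborel. (indicator {1..<R} s * h s - indicator {R..<1} s * h s) -
       (indicator {1..<r} s * h s - indicator {r..<1} s * h s))"
      using hi[of 1] hi[OF r(1)] hi[OF R] by (intro Bochner_Integration.integral_diff[symmetric]) auto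
    also have "\<dots> = (LINT s|lborel. indicator {r..<R} s * h s)"
      by (rule Bochner_Integration.integral_cong) (use r in \<open>auto simp: indicator_def\<close>)
    finally show "V R - V r = (LINT s|lborel. indicator {r..<R} s * h s)" .
  qed
qed

lemma primitive_locally_integrable:
  fixes h V :: "real \<Rightarrow> real"
  assumes h [measurable]: "h \<in> borel_measurable borel"
    and int: "\<And>a b. 0 < a \<Longrightarrow> integrable lborel (\<lambda>r. indicator {a..b} r * h r)"
    and [measurable]: "V \<in> borel_measurable borel"
    and V: "\<And>r R. 0 < r \<Longrightarrow> r \<le> R \<Longrightarrow> V R - V r = (LINT s|lborel. indicator {r..<R} s * h s)"
    and "0 < a"
  shows "integrable lborel (\<lambda>r. indicator {a..b} r * V r)"
proof -
  define C where "C = \<bar>V b\<bar> + (LINT s|lborel. \<bar>indicator {a..b} s * h s\<bar>)"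
  have bd: "\<bar>indicator {a..b} r * V r\<bar> \<le> C * indicator {a..b} r" for r
  proof (cases "r \<in> {a..b}")
    case True
    then have "V r = V b - (LINT s|lborel. indicator {r..<b} s * h s)" using V[of r b] \<open>0 < a\<close> by auto
    then have "\<bar>V r\<bar> \<le> \<bar>V b\<bar> + \<bar>LINT s|lborel. indicator {r..<b} s * h s\<bar>" by linarith
    also have "\<bar>LINT s|lborel. indicator {r..<b} s * h s\<bar> \<le> (LINT s|lborel. \<bar>indicator {r..<b} s * h s\<bar>)"
      by (rule integral_abs_bound)
    also have "\<dots> \<le> (LINT s|lborel. \<bar>indicator {a..b} s * h s\<bar>)"
      by (rule integral_mono_AE') (use integrable_abs[OF int[OF \<open>0 < a\<close>]] True in \<open>auto simp: indicator_def\<close>)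
    finally show ?thesis using True by (simp add: C_def)
  qed simp
  show ?thesis
  proof (rule Bochner_Integration.integrable_bound)
    show "integrable lborel (\<lambda>r. C * indicator {a..b} r)"
      by (intro integrable_mult_right) (auto simp: integrable_indicator_iff emeasure_lborel_Icc_eq)
    have "norm (indicator {a..b} r * V r) \<le> norm (C * indicator {a..b} r)" for r
      unfolding real_norm_def by (rule order_trans[OF bd[of r] abs_ge_self])
    then show "AE r in lborel. norm (indicator {a..b} r * V r) \<le> norm (C * indicator {a..b} r)" by simp
  qed measurable
qed

text \<open>
  Beyond the support of \<open>g\<close> the primitive may be replaced by its increment up to \<open>R\<close>; exchanging
  integrals then turns \<open>dg\<close> into its primitive \<open>g\<close>.
\<close>

lemma integral_primitive_by_parts:
  fixes h V :: "real \<Rightarrow> real"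
  assumes h [measurable]: "h \<in> borel_measurable borel"
    and int: "\<And>a b. 0 < a \<Longrightarrow> integrable lborel (\<lambda>r. indicator {a..b} r * h r)"
    and Vm [measurable]: "V \<in> borel_measurable borel"
    and V: "\<And>r R. 0 < r \<Longrightarrow> r \<le> R \<Longrightarrow> V R - V r = (LINT s|lborel. indicator {r..<R} s * h s)"
    and g: "pos_test g dg"
  shows "(LINT r|lborel. dg r * V r) = - (LINT r|lborel. g r * h r)"
proof -
  obtain \<delta> R where dR: "0 < \<delta>" "\<delta> < R" "\<And>r. r < \<delta> \<Longrightarrow> g r = 0" "\<And>r. r > R \<Longrightarrow> g r = 0"
    "\<And>r. r < \<delta> \<Longrightarrow> dg r = 0" "\<And>r. r > R \<Longrightarrow> dg r = 0"
    using pos_test_support[OF g] by metis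
  have c: "compact_C1 g dg" using g by (simp add: pos_test_def)
  have D: "(g has_real_derivative dg r) (at r)" for r
    using c unfolding compact_C1_def by simp
  have cdg: "continuous_on UNIV dg" using c unfolding compact_C1_def by simp
  have [measurable]: "dg \<in> borel_measurable borel" "g \<in> borel_measurable borel"
    using compact_C1_continuous[OF c] by (auto intro: borel_measurable_continuous_onI)
  have dgi: "integrable lborel dg"
    using compact_C1_integrable(2)[OF c] by (subst (asm) integrable_completion) auto
  have gR: "g R = 0"
  proof -
    have "(g \<longlongrightarrow> g R) (at_right R)"
      using C1_continuous[OF compact_C1_imp_C1[OF c]]
      by (simp add: continuous_on_eq_continuous_at isCont_def filterlim_at_split)
    moreover have "(g \<longlongrightarrow> 0) (at_right R)"
      by (rule tendsto_eventually) (use dR(4) in \<open>auto simp: eventually_at_filter\<close>)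
    ultimately show ?thesis by (rule tendsto_unique[rotated]) simp
  qed
  have FTC: "(LINT r|lborel. indicator {..s} r * dg r) = g s" if "s \<ge> \<delta>" for s
  proof -
    have "(LINT r|lborel. indicator {..s} r * dg r) = (LINT r|lborel. indicator {0..s} r * dg r)"
      by (rule Bochner_Integration.integral_cong) (use dR in \<open>auto simp: indicator_def\<close>)
    also have "\<dots> = g s - g 0"
      by (rule integral_FTC_C1(1)) (use that dR(1) D continuous_on_subset[OF cdg] in auto)
    finally show ?thesis using dR by simp
  qed
  have dg0: "(LINT r|lborel. dg r) = 0"
  proof -
    have "(LINT r|lborel. dg r) = (LINT r|lborel. indicator {..R} r * dg r)"
      by (rule Bochner_Integration.integral_cong) (use dR(6) in \<open>auto simp: indicator_def\<close>)
    also have "\<dots> = g R" using FTC[of R] dR by simp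
    finally show ?thesis using gR by simp
  qed
  \<comment> \<open>the truncation is harmless on the support of \<open>g\<close> and makes \<open>h\<close> integrable\<close>
  let ?h = "\<lambda>s. indicator {\<delta>..R} s * h s"
  let ?K = "{(s::real, r::real). r \<le> s \<and> s < R}"
  have K: "?K \<in> sets (lborel \<Otimes>\<^sub>M lborel)"
  proof -
    have "{z \<in> space (lborel \<Otimes>\<^sub>M lborel). snd z \<le> fst z \<and> fst z < (R::real)} \<in> sets (lborel \<Otimes>\<^sub>M lborel)"
      by measurable
    moreover have "{z \<in> space (lborel \<Otimes>\<^sub>M lborel). snd z \<le> fst z \<and> fst z < (R::real)} = ?K"
      by (auto simp: space_pair_measure)
    ultimately show ?thesis by simp
  qed
  note sw = integral_kernel_swap_integrable[OF sigma_finite_lborel int[OF dR(1)] K dgi]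
  note iV = integrable_lborel_mult_pos_test(2)[OF Vm primitive_locally_integrable[OF h int Vm V] g]
  have "(LINT r|lborel. dg r * V r) = (LINT r|lborel. dg r * V r - V R * dg r)"
    using Bochner_Integration.integral_diff[OF iV integrable_mult_right[OF dgi, of "V R"]] dg0 by simp
  also have "\<dots> = (LINT r|lborel. - ((LINT s|lborel. indicator ?K (s, r) * ?h s) * dg r))"
  proof (rule Bochner_Integration.integral_cong[OF refl])
    fix r
    show "dg r * V r - V R * dg r = - ((LINT s|lborel. indicator ?K (s, r) * ?h s) * dg r)"
    proof (cases "\<delta> \<le> r \<and> r \<le> R")
      case False
      then show ?thesis using dR(5,6)[of r] by auto
    next
      case True
      have "(LINT s|lborel. indicator ?K (s, r) * ?h s) = (LINT s|lborel. indicator {r..<R} s * h s)"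
        by (rule Bochner_Integration.integral_cong) (use True in \<open>auto simp: indicator_def\<close>)
      also have "\<dots> = V R - V r" using V[of r R] True dR(1) by simp
      finally have e: "(LINT s|lborel. indicator ?K (s, r) * ?h s) = V R - V r" .
      show ?thesis unfolding e by (simp add: algebra_simps)
    qed
  qed
  also have "\<dots> = - (LINT s|lborel. ?h s * (LINT r|lborel. indicator ?K (s, r) * dg r))"
    using sw(3) by simp
  also have "(LINT s|lborel. ?h s * (LINT r|lborel. indicator ?K (s, r) * dg r)) = (LINT s|lborel. g s * h s)"
  proof (rule Bochner_Integration.integral_cong[OF refl])
    fix s
    consider "s < \<delta>" | "s > R" | "s = R" | "\<delta> \<le> s" "s < R" by linarith
    then show "?h s * (LINT r|lborel. indicator ?K (s, r) * dg r) = g s * h s"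
    proof cases
      case 1 then show ?thesis using dR(3) by simp
    next
      case 2 then show ?thesis using dR(4) by simp
    next
      case 3
      then have "(\<lambda>r. indicator ?K (s, r) * dg r) = (\<lambda>_. 0)" by (auto simp: indicator_def)
      then show ?thesis using 3 gR by simp
    next
      case 4
      then have "(LINT r|lborel. indicator ?K (s, r) * dg r) = (LINT r|lborel. indicator {..s} r * dg r)"
        by (intro Bochner_Integration.integral_cong) (auto simp: indicator_def)
      then show ?thesis using FTC[of s] 4 by simp
    qed
  qed
  finally show ?thesis .
qed

text \<open>
  Sets of radii described by \<open>v\<close> may fail to be Borel; compactness supplies Borel ones. If \<open>f\<close> were positive on a set of positive measure, that
  set would contain a compact set \<open>T\<close> of positive measure. The set of radii \<open>norm ` T\<close> is compact, hence Borel,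
  and up to a null set \<open>f\<close> is positive on all spheres with these radii, because it is constant on
  each of them. This contradicts the vanishing of the integral over these spheres.
\<close>

lemma AE_nonpos_if_radial_marginal_zero:
  fixes f :: "'a::euclidean_space \<Rightarrow> real"
  assumes f [measurable]: "f \<in> borel_measurable lebesgue" and v: "AE x in lebesgue. f x = v (norm x)"
    and zero: "\<And>B. compact B \<Longrightarrow> integrable lebesgue (\<lambda>x. indicator B (norm x) * f x) \<and> (LINT x|lebesgue. indicator B (norm x) * f x) = 0"
  shows "AE x in lebesgue. f x \<le> 0"
proof -
  obtain N where N: "N \<in> null_sets lebesgue" "{x \<in> space lebesgue. \<not> f x = v (norm x)} \<subseteq> N"
    using v unfolding eventually_ae_filter by blast
  define S where "S n = ({x. f x > 0} - N) \<inter> cball 0 (real n)" for n :: nat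
  have Sm[measurable]: "S n \<in> sets lebesgue" for n
  proof -
    have "{x \<in> space lebesgue. f x > 0} \<in> sets lebesgue" by measurable
    then have "{x. f x > 0} \<in> sets lebesgue" by simp
    then show ?thesis unfolding S_def using N(1) by (intro sets.Int sets.Diff) auto
  qed
  have "emeasure lebesgue (S n) = 0" for n
  proof (rule ccontr)
    assume pos: "emeasure lebesgue (S n) \<noteq> 0"
    have "emeasure lebesgue (S n) \<le> emeasure lebesgue (cball (0::'a) (real n))"
      by (rule emeasure_mono) (auto simp: S_def)
    also have "\<dots> < \<infinity>" using emeasure_lborel_cball_finite[of "0::'a" "real n"] by simp
    finally have fin: "emeasure lebesgue (S n) < \<infinity>" .
    define e where "e = measure lebesgue (S n)"
    have e: "emeasure lebesgue (S n) = ennreal e" using fin by (simp add: e_def emeasure_eq_ennreal_measure less_top)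
    then have epos: "e > 0" using pos by (simp add: e_def order_less_le)
    obtain T where T: "closed T" "T \<subseteq> S n" "S n - T \<in> lmeasurable" "emeasure lebesgue (S n - T) < ennreal e"
      using sets_lebesgue_inner_closed[OF Sm epos] by metis
    have cT: "compact T"
    proof (rule compact_eq_bounded_closed[THEN iffD2], rule conjI)
      show "bounded T" using T(2) by (rule bounded_subset[rotated]) (auto simp: S_def intro: bounded_subset[OF bounded_cball[of 0 "real n"]])
    qed (rule T(1))
    define B where "B = norm ` T"
    have cB: "compact B" unfolding B_def using cT by (intro compact_continuous_image continuous_intros)
    have ge: "indicator B (norm x) * f x > 0" if x: "norm x \<in> B" "x \<notin> N" for x
    proof -
      obtain y where y: "y \<in> T" "norm y = norm x" using x(1) unfolding B_def by auto
      have yS: "f y > 0" "y \<notin> N" using y(1) T(2) by (auto simp: S_def)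
      have "f x = v (norm x)" using x(2) N(2) by auto
      also have "\<dots> = f y"
      proof -
        have "f y = v (norm y)" using yS(2) N(2) by auto
        then show ?thesis using y(2) by simp
      qed
      finally show ?thesis using yS x by simp
    qed
    have aeN: "AE x in lebesgue. x \<notin> N" using N(1) by (rule AE_not_in)
    have ae0: "AE x in lebesgue. 0 \<le> indicator B (norm x) * f x"
      using aeN
    proof eventually_elim
      case (elim x) then show ?case using ge[of x] by (cases "norm x \<in> B") auto
    qed
    have "AE x in lebesgue. indicator B (norm x) * f x = 0"
      using integral_nonneg_eq_0_iff_AE[OF _ ae0] zero[OF cB] by blast
    then have "AE x in lebesgue. x \<notin> T"
      using aeN
    proof eventually_elim
      case (elim x) then show ?case using ge[of x] by (auto simp: B_def)
    qed
    then have T0: "T \<in> null_sets lebesgue"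
      using T(1) by (intro AE_iff_null_sets[THEN iffD2]) auto
    have "emeasure lebesgue (S n - T) = emeasure lebesgue (S n)"
      by (rule emeasure_Diff_null_set[OF T0 Sm])
    then show False using T(4) e by simp
  qed
  then have "(\<Union>n. S n) \<in> null_sets lebesgue" using Sm by (intro null_sets_UN) auto
  then have "AE x in lebesgue. x \<notin> (\<Union>n. S n)" by (rule AE_not_in)
  moreover have "AE x in lebesgue. x \<notin> N" using N(1) by (rule AE_not_in)
  ultimately show ?thesis
  proof eventually_elim
    case (elim x)
    have "x \<in> cball 0 (real (nat \<lceil>norm x\<rceil>))" by (simp add: real_nat_ceiling_ge)
    then show ?case using elim unfolding S_def by (metis DiffI IntI UN_I UNIV_I mem_Collect_eq not_le)
  qed
qed

text \<open>
  The fundamental lemma, applied to the coordinates of the difference.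
\<close>

lemma has_weak_gradient_unique:
  fixes u :: "'a::euclidean_space \<Rightarrow> real"
  assumes "has_weak_gradient u G" "has_weak_gradient u G'"
  shows "AE x in lebesgue. G x = G' x"
proof -
  have L: "Lp_loc 1 u" "Lp_loc 1 G" "Lp_loc 1 G'" using assms unfolding has_weak_gradient_def by auto
  have "AE x in lebesgue. (G x - G' x) \<bullet> i = 0" for i :: 'a
  proof -
    have "AE x in lebesgue. x \<in> UNIV \<longrightarrow> (G x - G' x) \<bullet> i = 0"
    proof (rule fundamental_lemma_of_variations)
      fix K :: "'a set" assume "compact K"
      then have "set_integrable lebesgue K (\<lambda>x. G x - G' x)"
        using L unfolding Lp_loc_1_iff by (intro set_integral_diff(1)) auto
      from integrable_inner_left[OF this[unfolded set_integrable_def], of i]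
      show "set_integrable lebesgue K (\<lambda>x. (G x - G' x) \<bullet> i)" by (simp add: set_integrable_def)
    next
      fix \<phi> d\<phi> assume \<phi>: "compact_C1 \<phi> (d\<phi> :: 'a \<Rightarrow> 'a)"
      have i: "integrable lebesgue (\<lambda>x. \<phi> x *\<^sub>R G x)" "integrable lebesgue (\<lambda>x. \<phi> x *\<^sub>R G' x)"
        using integrable_Lp_loc_test(2)[OF L(1) _ \<phi>] L by auto
      have "(LINT x|lebesgue. u x *\<^sub>R d\<phi> x) = - (LINT x|lebesgue. \<phi> x *\<^sub>R G x)"
        "(LINT x|lebesgue. u x *\<^sub>R d\<phi> x) = - (LINT x|lebesgue. \<phi> x *\<^sub>R G' x)"
        using assms \<phi> unfolding has_weak_gradient_def by blast+
      then have "(LINT x|lebesgue. \<phi> x *\<^sub>R G x) = (LINT x|lebesgue. \<phi> x *\<^sub>R G' x)" by simp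
      then have "0 = (LINT x|lebesgue. \<phi> x *\<^sub>R G x - \<phi> x *\<^sub>R G' x) \<bullet> i"
        using i by simp
      also have "\<dots> = (LINT x|lebesgue. (\<phi> x *\<^sub>R G x - \<phi> x *\<^sub>R G' x) \<bullet> i)"
        by (rule integral_inner_left[symmetric]) (use i in auto)
      also have "\<dots> = (LINT x|lebesgue. (G x - G' x) \<bullet> i * \<phi> x)"
        by (rule Bochner_Integration.integral_cong) (auto simp: inner_diff_left algebra_simps)
      finally show "(LINT x|lebesgue. (G x - G' x) \<bullet> i * \<phi> x) = 0" by simp
    qed simp
    then show ?thesis by simp
  qed
  then have "AE x in lebesgue. \<forall>i\<in>(Basis::'a set). (G x - G' x) \<bullet> i = 0"
    by (intro AE_ball_countable[THEN iffD2]) (auto intro: countable_finite)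
  then show ?thesis
  proof eventually_elim
    case (elim x)
    then have "G x - G' x = 0" by (simp only: euclidean_all_zero_iff)
    then show ?case by simp
  qed
qed

lemma integrable_away_from_zero:
  fixes k :: "real \<Rightarrow> real"
  assumes [measurable]: "k \<in> borel_measurable borel" and N: "N \<ge> 1" and a: "0 < a"
    and int: "integrable lborel (\<lambda>r. sphere_density N r * (indicator {..b} r * k r))"
  shows "integrable lborel (\<lambda>r. indicator {a..b} r * k r)"
proof -
  let ?c = "real N * unit_ball_vol (real N)"
  have c: "?c > 0" using N by simp
  let ?p = "\<lambda>r. indicator {a..b} r / sphere_density N r"
  have bd: "\<bar>?p r\<bar> \<le> 1 / (?c * a ^ (N - 1))" for r
  proof (cases "r \<in> {a..b}")
    case True
    then have r: "a \<le> r" by simp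
    have "a ^ (N - 1) \<le> r ^ (N - 1)" using r a by (intro power_mono) auto
    then have "?c * a ^ (N - 1) \<le> ?c * r ^ (N - 1)" using c by (intro mult_left_mono) auto
    then have "?c * a ^ (N - 1) \<le> sphere_density N r"
      using r a unfolding sphere_density_def by auto
    moreover have "?c * a ^ (N - 1) > 0" using c a by simp
    ultimately show ?thesis using True by (simp add: frac_le)
  next
    case False
    then show ?thesis using c a by simp
  qed
  have "?p r * (sphere_density N r * (indicator {..b} r * k r)) = indicator {a..b} r * k r" for r
    using a c by (auto simp: indicator_def sphere_density_def)
  moreover have "integrable lborel (\<lambda>r. ?p r * (sphere_density N r * (indicator {..b} r * k r)))"
    by (rule integrable_mult_bounded[OF int _ bd]) measurable
  ultimately show ?thesis by simp
qed

text \<open>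
  The candidate is the marginal of \<open>u\<close> divided by the area of the sphere. The difference from \<open>u\<close> is
  again constant on spheres and has vanishing radial integrals, so it is 0 by \<open>AE_nonpos_if_radial_marginal_zero\<close>, applied with
  both signs.
\<close>

lemma radial_profile_exists:
  fixes u :: "'a::euclidean_space \<Rightarrow> real"
  assumes u: "Lp_loc 1 u" and rad: "radial u"
  obtains w where "w \<in> borel_measurable borel" "AE x in lebesgue. u x = w (norm x)"
proof -
  define \<sigma> where "\<sigma> = sphere_density DIM('a)"
  have um[measurable]: "u \<in> borel_measurable lebesgue" using u by (simp add: Lp_loc_def)
  have ufin: "set_integrable lebesgue (cball 0 R) u" for R using u unfolding Lp_loc_1_iff by simp
  obtain q where q[measurable]: "q \<in> borel_measurable borel" and q':
    "\<And>\<psi>::real \<Rightarrow> real. \<psi> \<in> borel_measurable borel \<Longrightarrow> integrable lebesgue (\<lambda>x. \<psi> (norm x) * u x) \<Longrightarrow>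
       integrable lborel (\<lambda>r. \<psi> r * q r) \<and>
       (LINT x|lebesgue. \<psi> (norm x) * u x) = (LINT r|lborel. \<psi> r * q r)"
    by (rule radial_marginal[OF um ufin], rule that) blast+
  define w where "w r = q r / \<sigma> r" for r
  have [measurable]: "\<sigma> \<in> borel_measurable borel" unfolding \<sigma>_def by measurable
  have wm[measurable]: "w \<in> borel_measurable borel" unfolding w_def by measurable
  have spos: "\<sigma> r > 0" if "r > 0" for r
    using that by (simp add: \<sigma>_def sphere_density_def)
  have sneg: "\<sigma> r = 0" if "\<not> r > 0" for r
    using that by (simp add: \<sigma>_def sphere_density_def)
  define f where "f x = u x - w (norm x)" for x
  have fm[measurable]: "f \<in> borel_measurable lebesgue" unfolding f_def by measurable
  obtain v where v: "AE x in lebesgue. u x = v (norm x)" using rad unfolding radial_def by blast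
  have fv: "AE x in lebesgue. f x = v (norm x) - w (norm x)"
    using v by eventually_elim (simp add: f_def)
  have zero: "integrable lebesgue (\<lambda>x. indicator B (norm x) * f x) \<and> (LINT x|lebesgue. indicator B (norm x) * f x) = 0"
    if B: "compact B" for B
  proof -
    have [measurable]: "B \<in> sets borel" using B by (simp add: borel_compact)
    obtain R where R: "B \<subseteq> ball 0 R" using bounded_subset_ballD[OF compact_imp_bounded[OF B], of 0] by blast
    define \<psi> where "\<psi> r = (indicator B r * indicator {0<..} r :: real)" for r
    have \<psi>m[measurable]: "\<psi> \<in> borel_measurable borel" unfolding \<psi>_def by measurable
    have iu: "integrable lebesgue (\<lambda>x. \<psi> (norm x) * u x)"
    proof (rule integrable_Lp_loc_bounded[OF u])
      fix x show "norm (\<psi> (norm x) * u x) \<le> 1 * norm (u x)" by (auto simp: \<psi>_def indicator_def)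
      show "\<psi> (norm x) * u x = 0" if "norm x \<ge> R" using R that by (auto simp: \<psi>_def indicator_def)
    qed measurable
    have "\<sigma> r * (\<psi> r * w r) = \<psi> r * q r" for r
      using spos[of r] by (auto simp: \<psi>_def w_def indicator_def)
    then have e: "(\<lambda>r. sphere_density DIM('a) r * (\<psi> r * w r)) = (\<lambda>r. \<psi> r * q r)" unfolding \<sigma>_def by (rule ext)
    have iq: "integrable lborel (\<lambda>r. \<psi> r * q r)" "(LINT x|lebesgue. \<psi> (norm x) * u x) = (LINT r|lborel. \<psi> r * q r)"
      using q'[OF \<psi>m iu] by auto
    have iw: "integrable lebesgue (\<lambda>x::'a. \<psi> (norm x) * w (norm x))"
      using integrable_radial_iff[of "\<lambda>r. \<psi> r * w r", where 'a = 'a] iq(1) unfolding e by simp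
    have ew: "(LINT x|lebesgue. \<psi> (norm (x::'a)) * w (norm x)) = (LINT r|lborel. \<psi> r * q r)"
      using integral_radial(2)[of "\<lambda>r. \<psi> r * w r", where 'a = 'a] unfolding e by simp
    have i: "integrable lebesgue (\<lambda>x. \<psi> (norm x) * u x - \<psi> (norm x) * w (norm x))"
      using iu iw by simp
    have ae: "AE x in lebesgue. \<psi> (norm x) * u x - \<psi> (norm x) * w (norm x) = indicator B (norm x) * f x"
      using AE_nonzero_lebesgue by eventually_elim (simp add: \<psi>_def f_def algebra_simps)
    have m: "(\<lambda>x. indicator B (norm x) * f x) \<in> borel_measurable lebesgue" by measurable
    have "(LINT x|lebesgue. indicator B (norm x) * f x) = (LINT x|lebesgue. \<psi> (norm x) * u x - \<psi> (norm x) * w (norm x))"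
      by (rule integral_cong_AE[OF m borel_measurable_integrable[OF i]]) (rule eventually_mono[OF ae], rule sym)
    also have "\<dots> = 0" using iu iw iq(2) ew by simp
    finally show ?thesis using integrable_cong_AE_imp[OF i m ae] by simp
  qed
  have "AE x in lebesgue. f x \<le> 0"
    by (rule AE_nonpos_if_radial_marginal_zero[OF fm fv zero])
  moreover have "AE x in lebesgue. - f x \<le> 0"
  proof (rule AE_nonpos_if_radial_marginal_zero[where v = "\<lambda>r. - (v r - w r)"])
    show "AE x in lebesgue. - f x = - (v (norm x) - w (norm x))" using fv by eventually_elim simp
  qed (use zero in auto)
  ultimately have "AE x in lebesgue. u x = w (norm x)" by eventually_elim (simp add: f_def)
  then show ?thesis using that[OF wm] by blast
qed

text \<open>
  For a test function \<open>g\<close> on the half-line the field \<open>g(|x|) x/|x|\<^sup>N\<close> has divergence \<open>g'(|x|)/|x|\<^sup>N\<^sup>-\<^sup>1\<close>, so in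
  polar coordinates testing with it gives exactly \<open>\<integral> g' w = - \<integral> g h\<close>: the profile \<open>w\<close> has the weak
  derivative \<open>h\<close>, the spherical mean of the radial component of \<open>G\<close>. Then \<open>w\<close> is a primitive of \<open>h\<close>, and
  \<open>has_weak_gradient_radial\<close> together with uniqueness shows that \<open>G\<close> is purely radial.
\<close>

lemma radial_weak_gradient_structure:
  fixes u :: "'a::euclidean_space \<Rightarrow> real"
  assumes G: "has_weak_gradient u G" and rad: "radial u"
  obtains V h where "V \<in> borel_measurable borel" "h \<in> borel_measurable borel"
    "\<And>r R. 0 < r \<Longrightarrow> r \<le> R \<Longrightarrow> V R - V r = (LINT s|lborel. indicator {r..<R} s * h s)"
    "AE x in lebesgue. u x = V (norm x)" "AE x in lebesgue. G x = h (norm x) *\<^sub>R sgn x"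
proof -
  define N where "N = DIM('a)"
  have N: "N \<ge> 1" by (simp add: N_def Suc_leI)
  define c where "c = real N * unit_ball_vol (real N)"
  have c: "c > 0" using N by (simp add: c_def)
  define \<sigma> where "\<sigma> = sphere_density N"
  have [measurable]: "\<sigma> \<in> borel_measurable borel" unfolding \<sigma>_def by measurable
  have s: "\<sigma> r = (if r > 0 then c * r ^ (N - 1) else 0)" for r by (simp add: \<sigma>_def sphere_density_def c_def)
  have L: "Lp_loc 1 u" "Lp_loc 1 G" using G unfolding has_weak_gradient_def by auto
  have [measurable]: "u \<in> borel_measurable lebesgue" "G \<in> borel_measurable lebesgue" using L by (auto simp: Lp_loc_def)
  have [measurable]: "(sgn :: 'a \<Rightarrow> 'a) \<in> borel_measurable lebesgue" by (rule sgn_measurable_lebesgue)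
  obtain w where w[measurable]: "w \<in> borel_measurable borel" and uw: "AE x in lebesgue. u x = w (norm x)"
    using radial_profile_exists[OF L(1) rad] by blast
  have wint: "integrable lborel (\<lambda>r. \<sigma> r * (indicator {..R} r * w r))" for R
  proof -
    have "set_integrable lebesgue (cball 0 R) u" using L(1) unfolding Lp_loc_1_iff by simp
    then have i: "integrable lebesgue (\<lambda>x. indicator (cball 0 R) x *\<^sub>R u x)"
      unfolding set_integrable_def .
    have ae: "AE x in lebesgue. indicator (cball 0 R) x *\<^sub>R u x = indicator {..R} (norm x) * w (norm x)"
      using uw
    proof eventually_elim
      case (elim x)
      then show ?case by (cases "norm x \<le> R") auto
    qed
    have "(\<lambda>x::'a. indicator {..R} (norm x) * w (norm x)) \<in> borel_measurable lebesgue" by measurable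
    from integrable_cong_AE_imp[OF i this ae] show ?thesis unfolding \<sigma>_def N_def by (subst (asm) integrable_radial_iff) auto
  qed
  define H where "H x = x \<bullet> G x" for x
  have Hm: "H \<in> borel_measurable lebesgue" unfolding H_def
    by (intro borel_measurable_inner borel_measurable_lebesgueI[of "\<lambda>x. x"]) auto
  note [measurable] = Hm
  have Hfin: "set_integrable lebesgue (cball 0 R) H" for R
    unfolding set_integrable_def
  proof (rule integrable_Lp_loc_bounded[OF L(2), where B = "\<bar>R\<bar>" and R = "R + 1"])
    fix x
    show "norm (indicator (cball 0 R) x *\<^sub>R H x) \<le> \<bar>R\<bar> * norm (G x)"
    proof (cases "norm x \<le> R")
      case True
      have "\<bar>H x\<bar> \<le> norm x * norm (G x)" unfolding H_def by (rule Cauchy_Schwarz_ineq2)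
      also have "\<dots> \<le> \<bar>R\<bar> * norm (G x)" using True by (intro mult_right_mono) auto
      finally show ?thesis using True by simp
    qed simp
  next
    show "(\<lambda>x. indicator (cball 0 R) x *\<^sub>R H x) \<in> borel_measurable lebesgue"
      by (intro borel_measurable_scaleR borel_measurable_indicator Hm) auto
  qed (auto simp: indicator_def)
  obtain q where q[measurable]: "q \<in> borel_measurable borel" and q':
    "\<And>\<psi>::real \<Rightarrow> real. \<psi> \<in> borel_measurable borel \<Longrightarrow> integrable lebesgue (\<lambda>x. \<psi> (norm x) * H x) \<Longrightarrow>
       integrable lborel (\<lambda>r. \<psi> r * q r) \<and>
       (LINT x|lebesgue. \<psi> (norm x) * H x) = (LINT r|lborel. \<psi> r * q r)"
    by (rule radial_marginal[OF Hm Hfin], rule that) blast+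
  \<comment> \<open>\<open>q\<close> is the marginal of \<open>x \<bullet> G\<close>, which carries an extra factor \<open>|x|\<close>\<close>
  define h where "h r = q r / (r * \<sigma> r)" for r
  have h[measurable]: "h \<in> borel_measurable borel" unfolding h_def by measurable
  have hint: "integrable lborel (\<lambda>r. \<sigma> r * (indicator {..R} r * h r))" for R
  proof -
    define \<psi> where "\<psi> r = (indicator {..R} r * indicator {0<..} r / r :: real)" for r
    have \<psi>m[measurable]: "\<psi> \<in> borel_measurable borel" unfolding \<psi>_def by measurable
    have "integrable lebesgue (\<lambda>x. \<psi> (norm x) * H x)"
    proof (rule integrable_Lp_loc_bounded[OF L(2), where B = 1 and R = "R + 1"])
      fix x
      show "norm (\<psi> (norm x) * H x) \<le> 1 * norm (G x)"
      proof (cases "x = 0")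
        case False
        have "\<bar>H x\<bar> \<le> norm x * norm (G x)" unfolding H_def by (rule Cauchy_Schwarz_ineq2)
        then have "\<bar>H x\<bar> / norm x \<le> norm (G x)" using False by (simp add: field_simps)
        then show ?thesis by (auto simp: \<psi>_def indicator_def abs_mult)
      qed (simp add: \<psi>_def)
      show "\<psi> (norm x) * H x = 0" if "norm x \<ge> R + 1" using that by (simp add: \<psi>_def)
    qed measurable
    from q'[OF \<psi>m this] have "integrable lborel (\<lambda>r. \<psi> r * q r)" by simp
    moreover have "\<psi> r * q r = \<sigma> r * (indicator {..R} r * h r)" for r
      using c by (auto simp: \<psi>_def h_def s indicator_def)
    ultimately show ?thesis by simp
  qed
  have hloc: "set_integrable lebesgue (cball 0 R) (\<lambda>x::'a. h (norm x))" for R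
  proof -
    have "integrable lebesgue (\<lambda>x::'a. indicator {..R} (norm x) * h (norm x))"
      using hint[of R] unfolding \<sigma>_def N_def by (subst integrable_radial_iff) auto
    then show ?thesis unfolding set_integrable_def
      by (rule Bochner_Integration.integrable_cong[THEN iffD1, rotated 2]) (auto simp: indicator_def)
  qed
  have hi: "integrable lborel (\<lambda>r. indicator {a..b} r * h r)" if "0 < a" for a b
    by (rule integrable_away_from_zero[OF h N that hint[unfolded \<sigma>_def]])
  have wi: "integrable lborel (\<lambda>r. indicator {a..b} r * w r)" if "0 < a" for a b
    by (rule integrable_away_from_zero[OF w N that wint[unfolded \<sigma>_def]])
  have test: "(LINT r|lborel. dg r * w r) = - (LINT r|lborel. g r * h r)" if g: "pos_test g dg" for g dg
  proof -
    obtain \<delta> R where dR: "0 < \<delta>" "\<delta> < R" "\<And>r. r < \<delta> \<Longrightarrow> g r = 0" "\<And>r. r > R \<Longrightarrow> g r = 0"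
      "\<And>r. r < \<delta> \<Longrightarrow> dg r = 0" "\<And>r. r > R \<Longrightarrow> dg r = 0"
      using pos_test_support[OF g] by metis
    have cg: "compact_C1 g dg" using g by (simp add: pos_test_def)
    obtain C where C: "\<And>x. \<bar>g x\<bar> \<le> C" "\<And>x. \<bar>dg x\<bar> \<le> C"
      using compact_C1_bounded[OF cg] by (metis real_norm_def)
    have [measurable]: "g \<in> borel_measurable borel" "dg \<in> borel_measurable borel"
      using compact_C1_continuous[OF cg] by (auto intro: borel_measurable_continuous_onI)
    let ?\<eta> = "\<lambda>r. g r * inverse (r ^ N)"
    let ?d = "\<lambda>r. dg r * inverse (r ^ N) + g r * (- real N * inverse (r ^ (N + 1)))"
    have \<eta>: "C1 ?\<eta> ?d"
      by (rule C1_over_power[OF compact_C1_imp_C1[OF cg] dR(1) dR(3) dR(5) N])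
    have \<zeta>: "compact_C1 (\<lambda>x::'a. ?\<eta> (norm x)) (\<lambda>x. ?d (norm x) *\<^sub>R sgn x)"
      by (rule compact_C1_radial[OF \<eta> dR(1), of R]) (use dR in auto)
    have e: "real N * ?\<eta> (norm x) + x \<bullet> (?d (norm x) *\<^sub>R sgn x) = dg (norm x) * inverse (norm x ^ (N - 1))" for x :: 'a
    proof (cases "x = 0")
      case True
      then show ?thesis using dR by simp
    next
      case False
      define r where "r = norm x"
      have r: "r > 0" using False by (simp add: r_def)
      have x1: "x \<bullet> sgn x = r" using False by (simp add: sgn_div_norm r_def power2_norm_eq_inner[symmetric] power2_eq_square)
      define P where "P = r ^ (N - 1)"
      have P: "P > 0" using r by (simp add: P_def)
      have pN: "r ^ N = r * P" "r ^ (N + 1) = r * (r * P)" using N power_eq_if[of r N] by (simp_all add: P_def)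
      have alg: "n * (y * inverse (r * P)) + (z * inverse (r * P) + y * (- n * inverse (r * (r * P)))) * r = z * inverse P" for n y z :: real
        using r P by (simp add: field_simps)
      have "real N * ?\<eta> r + ?d r * (x \<bullet> sgn x) = dg r * inverse (r ^ (N - 1))"
        unfolding x1 pN P_def[symmetric] by (rule alg)
      then show ?thesis by (simp only: inner_scaleR_right r_def)
    qed
    have eqn: "(LINT x|lebesgue. u x * (dg (norm x) * inverse (norm x ^ (N - 1)))) = - (LINT x|lebesgue. ?\<eta> (norm x) * H x)"
      using weak_gradient_divergence_position[OF G \<zeta>] unfolding N_def[symmetric] e H_def[symmetric] .
    have "(LINT x|lebesgue. u x * (dg (norm x) * inverse (norm x ^ (N - 1)))) =
        (LINT x|lebesgue. w (norm (x::'a)) * (dg (norm x) * inverse (norm x ^ (N - 1))))"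
    proof (rule integral_cong_AE)
      show "AE x in lebesgue. u x * (dg (norm x) * inverse (norm x ^ (N - 1))) =
          w (norm x) * (dg (norm x) * inverse (norm x ^ (N - 1)))"
        using uw by eventually_elim simp
    qed measurable
    also have "\<dots> = (LINT r|lborel. \<sigma> r * (w r * (dg r * inverse (r ^ (N - 1)))))"
      unfolding \<sigma>_def N_def by (rule integral_radial(2)) measurable
    also have "\<dots> = (LINT r|lborel. c * (dg r * w r))"
    proof (rule Bochner_Integration.integral_cong[OF refl])
      fix r show "\<sigma> r * (w r * (dg r * inverse (r ^ (N - 1)))) = c * (dg r * w r)"
        using dR(1) dR(5)[of r] by (cases "r > 0") (auto simp: s)
    qed
    finally have l: "(LINT x|lebesgue. u x * (dg (norm x) * inverse (norm x ^ (N - 1)))) = c * (LINT r|lborel. dg r * w r)" by simp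
    have \<eta>m: "?\<eta> \<in> borel_measurable borel" by measurable
    have "integrable lebesgue (\<lambda>x. ?\<eta> (norm x) * H x)"
    proof -
      obtain B where B: "\<And>x::'a. \<bar>?\<eta> (norm x)\<bar> \<le> B" using compact_C1_bounded[OF \<zeta>] by metis
      have B0: "B \<ge> 0" using order_trans[OF abs_ge_zero B] .
      show ?thesis
      proof (rule integrable_Lp_loc_bounded[OF L(2), where B = "B * R" and R = "R + 1"])
        fix x
        show "norm (?\<eta> (norm x) * H x) \<le> B * R * norm (G x)"
        proof (cases "norm x \<le> R")
          case True
          have "\<bar>H x\<bar> \<le> norm x * norm (G x)" unfolding H_def by (rule Cauchy_Schwarz_ineq2)
          also have "\<dots> \<le> R * norm (G x)" using True by (intro mult_right_mono) auto
          finally have "\<bar>?\<eta> (norm x)\<bar> * \<bar>H x\<bar> \<le> B * (R * norm (G x))"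
            using B0 by (intro mult_mono B) auto
          then show ?thesis by (simp only: real_norm_def abs_mult mult.assoc)
        next
          case False
          then have "g (norm x) = 0" using dR(4) by simp
          then show ?thesis using B0 dR(1,2) by simp
        qed
        show "?\<eta> (norm x) * H x = 0" if "norm x \<ge> R + 1" using dR(4)[of "norm x"] that by simp
      qed measurable
    qed
    from q'[OF \<eta>m this]
    have "(LINT x|lebesgue. ?\<eta> (norm x) * H x) = (LINT r|lborel. ?\<eta> r * q r)" by simp
    also have "\<dots> = (LINT r|lborel. c * (g r * h r))"
    proof (rule Bochner_Integration.integral_cong[OF refl])
      fix r show "?\<eta> r * q r = c * (g r * h r)"
      proof (cases "r > 0")
        case True
        have pN: "r ^ N = r * r ^ (N - 1)" using N power_eq_if[of r N] by simp
        show ?thesis using True c unfolding pN h_def s by (simp add: field_simps)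
      next
        case False
        then show ?thesis using dR(1) dR(3)[of r] by simp
      qed
    qed
    finally have "(LINT x|lebesgue. ?\<eta> (norm x) * H x) = c * (LINT r|lborel. g r * h r)" by simp
    then have "c * (LINT r|lborel. dg r * w r) = c * - (LINT r|lborel. g r * h r)" using eqn l by simp
    then show ?thesis using c by (metis mult_left_cancel less_irrefl)
  qed
  obtain V0 where V0m[measurable]: "V0 \<in> borel_measurable borel"
    and V0: "\<And>r R. 0 < r \<Longrightarrow> r \<le> R \<Longrightarrow> V0 R - V0 r = (LINT s|lborel. indicator {r..<R} s * h s)"
    using primitive_on_positive[OF h hi] by metis
  have V0i: "integrable lborel (\<lambda>r. indicator {a..b} r * V0 r)" if "0 < a" for a b
    by (rule primitive_locally_integrable[OF h hi V0m V0 that])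
  have wV: "(\<lambda>r. w r - V0 r) \<in> borel_measurable borel" by measurable
  obtain d where d: "AE r in lborel. 0 < r \<longrightarrow> w r - V0 r = d"
  proof (rule du_bois_reymond[OF wV])
    fix a b :: real assume a: "0 < a"
    show "integrable lborel (\<lambda>r. indicator {a..b} r * (w r - V0 r))"
      using Bochner_Integration.integrable_diff[OF wi[OF a, of b] V0i[OF a, of b]] by (simp add: right_diff_distrib)
  next
    fix g dg assume g: "pos_test g dg"
    note i1 = integrable_lborel_mult_pos_test(2)[OF w wi g]
    note i2 = integrable_lborel_mult_pos_test(2)[OF V0m V0i g]
    have "(LINT r|lborel. dg r * (w r - V0 r)) = (LINT r|lborel. dg r * w r) - (LINT r|lborel. dg r * V0 r)"
      using Bochner_Integration.integral_diff[OF i1 i2] by (simp add: right_diff_distrib)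
    then show "(LINT r|lborel. dg r * (w r - V0 r)) = 0"
      using test[OF g] integral_primitive_by_parts[OF h hi V0m V0 g] by simp
  qed blast
  define V where "V r = V0 r + d" for r
  have V: "V R - V r = (LINT s|lborel. indicator {r..<R} s * h s)" if "0 < r" "r \<le> R" for r R
    using V0[OF that] by (simp add: V_def)
  have uV: "AE x in lebesgue. u x = V (norm x)"
    using uw AE_norm[OF d] AE_nonzero_lebesgue
    by eventually_elim (simp add: V_def)
  have "has_weak_gradient u (\<lambda>x. h (norm x) *\<^sub>R sgn x)"
    by (rule has_weak_gradient_radial[OF L(1) uV h hloc V])
  then have Gh: "AE x in lebesgue. G x = h (norm x) *\<^sub>R sgn x"
    by (rule has_weak_gradient_unique[OF G])
  show ?thesis by (rule that[OF _ h V uV Gh]) (simp add: V_def[abs_def])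
qed

section \<open>The flux of a radial solution\<close>

lemma cball_bump:
  obtains \<phi> d\<phi> where "compact_C1 \<phi> (d\<phi> :: 'a::euclidean_space \<Rightarrow> 'a)" "\<And>x. \<phi> x \<ge> 0" "\<And>x. norm x \<le> R \<Longrightarrow> \<phi> x \<ge> 1"
proof -
  have 1: "C1 (\<lambda>x::'a. R\<^sup>2 + 1 - x \<bullet> x) (\<lambda>x. (- 2) *\<^sub>R x)"
    unfolding C1_def gderiv_def
    by (auto intro!: derivative_eq_intros continuous_intros simp: inner_commute)
  let ?f = "\<lambda>x::'a. (max 0 (R\<^sup>2 + 1 - x \<bullet> x))\<^sup>2"
  have c: "C1 ?f (\<lambda>x. (2 * max 0 (R\<^sup>2 + 1 - x \<bullet> x)) *\<^sub>R ((- 2) *\<^sub>R x))"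
    using C1_compose[OF 1 C1_max_square] .
  have "compact_C1 ?f (\<lambda>x. (2 * max 0 (R\<^sup>2 + 1 - x \<bullet> x)) *\<^sub>R ((- 2) *\<^sub>R x))"
  proof (rule compact_C1I(1)[OF c compact_cball[of 0 "\<bar>R\<bar> + 1"]])
    fix x :: 'a assume "x \<notin> cball 0 (\<bar>R\<bar> + 1)"
    then have "(\<bar>R\<bar> + 1)\<^sup>2 \<le> (norm x)\<^sup>2" by (intro power_mono) auto
    moreover have "(\<bar>R\<bar> + 1)\<^sup>2 = R\<^sup>2 + 2 * \<bar>R\<bar> + 1" by (simp add: power2_eq_square algebra_simps)
    ultimately have "R\<^sup>2 + 1 - x \<bullet> x \<le> 0" using abs_ge_zero[of R] by (simp add: power2_norm_eq_inner)
    then show "?f x = 0" by (simp add: max_def)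
  qed
  moreover have "?f x \<ge> 1" if "norm x \<le> R" for x
  proof -
    have "(norm x)\<^sup>2 \<le> R\<^sup>2" using that by (intro power_mono) auto
    then have "1 \<le> max 0 (R\<^sup>2 + 1 - x \<bullet> x)" by (simp add: power2_norm_eq_inner le_max_iff_disj)
    then show ?thesis by (rule one_le_power)
  qed
  ultimately show ?thesis using that[of ?f] by simp
qed

text \<open>
  The product of the distances to \<open>a/2\<close> and \<open>b + 1\<close> is at least \<open>a/2\<close> on the interval, which explains the
  normalising factor.
\<close>

lemma interval_bump:
  assumes "0 < (a::real)"
  obtains g dg where "pos_test g dg" "\<And>r. a \<le> r \<Longrightarrow> r \<le> b \<Longrightarrow> g r \<ge> 1"
proof -
  have 1: "C1 (\<lambda>r::real. (r - a / 2) * (b + 1 - r)) (\<lambda>r. (b + 1 - r) - (r - a / 2))"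
    unfolding C1_def by (auto intro!: derivative_eq_intros continuous_intros simp: algebra_simps)
  let ?f = "\<lambda>r. (max 0 ((r - a / 2) * (b + 1 - r)))\<^sup>2"
  let ?c = "(2 / a)\<^sup>2"
  have out: "?f r = 0" if "r < min (a / 2) (b + 1) \<or> r > max (b + 1) (a / 2)" for r
  proof -
    have "(r - a / 2) * (b + 1 - r) \<le> 0" using that by (auto simp: mult_le_0_iff)
    then show ?thesis by simp
  qed
  show ?thesis
  proof (cases "a \<le> b")
    case False
    obtain g dg where "pos_test g dg" using pos_test_unit_bump by metis
    then show ?thesis using that[of g dg] False by auto
  next
    case True
    have m: "min (a / 2) (b + 1) = a / 2" using True assms by auto
    have "pos_test (\<lambda>r. ?c * ?f r) (\<lambda>r. ?c *\<^sub>R ((2 * max 0 ((r - a / 2) * (b + 1 - r))) *\<^sub>R ((b + 1 - r) - (r - a / 2))) + ?f r *\<^sub>R 0)"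
      by (rule pos_testI[OF C1_mult[OF C1_const C1_compose[OF 1 C1_max_square]], where \<delta> = "a / 2" and R = "max (b + 1) (a / 2)"])
         (use out assms in \<open>auto simp: m\<close>)
    moreover have "?c * ?f r \<ge> 1" if r: "a \<le> r" "r \<le> b" for r
    proof -
      have "(a / 2) * 1 \<le> (r - a / 2) * (b + 1 - r)" using r assms by (intro mult_mono) auto
      then have "a / 2 \<le> max 0 ((r - a / 2) * (b + 1 - r))" by (simp add: le_max_iff_disj)
      then have "(2 / a) * (a / 2) \<le> (2 / a) * max 0 ((r - a / 2) * (b + 1 - r))"
        using assms by (intro mult_left_mono) auto
      then have "1 \<le> (2 / a) * max 0 ((r - a / 2) * (b + 1 - r))" using assms by simp
      then have "1 \<le> ((2 / a) * max 0 ((r - a / 2) * (b + 1 - r)))\<^sup>2" by (rule one_le_power)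
      then show ?thesis by (simp only: power_mult_distrib)
    qed
    ultimately show ?thesis by (rule that)
  qed
qed

text \<open>
  The test functions are \<open>\<eta>(|x|)\<close>, where \<open>\<eta>\<close> has derivative \<open>g\<close> and vanishes for large radii. In polar
  coordinates the weak equation reads \<open>\<integral> r\<^sup>N\<^sup>-\<^sup>1 k g = \<integral> r\<^sup>N\<^sup>-\<^sup>1 \<rho> \<eta>\<close>, and writing \<open>\<eta>\<close> as minus the
  integral of \<open>g\<close> over the larger radii turns the right-hand side into \<open>- \<integral> M g\<close>, with \<open>M\<close> the integral of
  \<open>r\<^sup>N\<^sup>-\<^sup>1 \<rho>\<close> from 0. Since \<open>\<eta>\<close> is in general not 0 at the origin, the identity determines the flux
  completely, without an additive constant.
\<close>

lemma radial_flux_identity: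
  fixes F :: "'a::euclidean_space \<Rightarrow> 'a" and \<rho>' :: "'a \<Rightarrow> real"
  defines "N \<equiv> DIM('a)"
  assumes k [measurable]: "k \<in> borel_measurable borel" and \<rho> [measurable]: "\<rho> \<in> borel_measurable borel"
    and weq: "\<And>\<phi> d\<phi>. compact_C1 \<phi> d\<phi> \<Longrightarrow> integrable lebesgue (\<lambda>x. F x \<bullet> d\<phi> x)"
      "\<And>\<phi> d\<phi>. compact_C1 \<phi> d\<phi> \<Longrightarrow> integrable lebesgue (\<lambda>x. \<rho>' x * \<phi> x)"
      "\<And>\<phi> d\<phi>. compact_C1 \<phi> d\<phi> \<Longrightarrow> (LINT x|lebesgue. F x \<bullet> d\<phi> x) = (LINT x|lebesgue. \<rho>' x * \<phi> x)"
    and F: "AE x in lebesgue. F x = k (norm x) *\<^sub>R sgn x" and \<rho>': "AE x in lebesgue. \<rho>' x = \<rho> (norm x)"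
  shows "integrable lborel (\<lambda>r. indicator {0<..<R} r * (r ^ (N - 1) * \<rho> r))"
    and "AE r in lborel. 0 < r \<longrightarrow> r ^ (N - 1) * k r = - (LINT s|lborel. indicator {0<..<r} s * (s ^ (N - 1) * \<rho> s))"
proof -
  have N: "N \<ge> 1" by (simp add: N_def Suc_leI)
  define c where "c = real N * unit_ball_vol (real N)"
  have c: "c > 0" using N by (simp add: c_def)
  define \<sigma> where "\<sigma> = sphere_density N"
  have [measurable]: "\<sigma> \<in> borel_measurable borel" unfolding \<sigma>_def by measurable
  have s: "\<sigma> r = (if r > 0 then c * r ^ (N - 1) else 0)" for r by (simp add: \<sigma>_def sphere_density_def c_def)
  have \<rho>int: "integrable lborel (\<lambda>r. indicator {..<R} r * (\<sigma> r * \<rho> r))" for R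
  proof -
    \<comment> \<open>local integrability of the source, read off from a test function that is at least 1 on a ball\<close>
    obtain \<phi> d\<phi> where \<phi>: "compact_C1 \<phi> (d\<phi> :: 'a \<Rightarrow> 'a)" "\<And>x. \<phi> x \<ge> 0" "\<And>x. norm x \<le> R \<Longrightarrow> \<phi> x \<ge> 1"
      by (rule cball_bump[of R]) blast
    have "integrable lebesgue (\<lambda>x::'a. indicator {..<R} (norm x) * \<rho> (norm x))"
    proof (rule Bochner_Integration.integrable_bound[OF weq(2)[OF \<phi>(1)]])
      show "AE x in lebesgue. norm (indicator {..<R} (norm x) * \<rho> (norm x)) \<le> norm (\<rho>' x * \<phi> x)"
        using \<rho>'
      proof eventually_elim
        case (elim x)
        show ?case
        proof (cases "norm x < R")
          case True
          have "\<bar>\<rho> (norm x)\<bar> * 1 \<le> \<bar>\<rho> (norm x)\<bar> * \<phi> x" using \<phi>(3)[of x] True by (intro mult_left_mono) auto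
          then show ?thesis using True elim \<phi>(2)[of x] by (simp add: abs_mult)
        qed simp
      qed
    qed measurable
    then have "integrable lborel (\<lambda>r. \<sigma> r * (indicator {..<R} r * \<rho> r))"
      unfolding \<sigma>_def N_def by (subst (asm) integrable_radial_iff) auto
    then show ?thesis by (simp add: mult_ac)
  qed
  show "integrable lborel (\<lambda>r. indicator {0<..<R} r * (r ^ (N - 1) * \<rho> r))"
  proof -
    have "(1 / c) * (indicator {..<R} r * (\<sigma> r * \<rho> r)) = indicator {0<..<R} r * (r ^ (N - 1) * \<rho> r)" for r
      using c by (auto simp: s indicator_def)
    then show ?thesis using integrable_mult_right[OF \<rho>int[of R], of "1 / c"] by simp
  qed
  define M where "M r = (LINT s|lborel. indicator {..<r} s * (\<sigma> s * \<rho> s))" for r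
  have Mm[measurable]: "M \<in> borel_measurable borel"
  proof -
    have "(\<lambda>r. LINT s|lborel. (if s < r then \<sigma> s * \<rho> s else 0)) \<in> borel_measurable borel"
      by (rule lborel.borel_measurable_lebesgue_integral) measurable
    moreover have "(if s < r then \<sigma> s * \<rho> s else 0) = indicator {..<r} s * (\<sigma> s * \<rho> s)" for s r
      by (auto simp: indicator_def)
    ultimately show ?thesis unfolding M_def by simp
  qed
  have radial_test: "integrable lborel (\<lambda>r. \<sigma> r * k r * g r) \<and> (LINT r|lborel. (\<sigma> r * k r + M r) * g r) = 0"
    if g: "pos_test g dg" and Mg: "integrable lborel (\<lambda>r. M r * g r)" for g dg
  proof -
    obtain \<delta> R where dR: "0 < \<delta>" "\<delta> < R" "\<And>r. r < \<delta> \<Longrightarrow> g r = 0" "\<And>r. r > R \<Longrightarrow> g r = 0"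
      using pos_test_support[OF g] by metis
    have gm[measurable]: "g \<in> borel_measurable borel"
      using pos_test_continuous[OF g] by (rule borel_measurable_continuous_onI)
    have gi: "integrable lborel g" by (rule pos_test_integrable[OF g])
    obtain \<xi> where \<xi>: "C1 \<xi> g" "\<And>r. \<xi> r = (LINT s|lborel. indicator {0<..<r} s * g s)"
      using pos_test_primitive[OF g] by metis
    define I where "I = (LINT s|lborel. g s)"
    \<comment> \<open>normalised to vanish at infinity instead of at 0\<close>
    define \<eta> where "\<eta> r = \<xi> r - I" for r
    have \<eta>: "C1 \<eta> g" using \<xi>(1) unfolding C1_def \<eta>_def by (auto intro!: derivative_eq_intros)
    have \<eta>m[measurable]: "\<eta> \<in> borel_measurable borel"
      using C1_continuous[OF \<eta>] by (rule borel_measurable_continuous_onI)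
    have tail: "(LINT t|lborel. indicator {r<..} t * g t) = - \<eta> r" if "0 \<le> r" for r
    proof -
      have i: "integrable lborel (\<lambda>t. indicator {0<..<r} t * g t)" "integrable lborel (\<lambda>t. indicator {r<..} t * g t)"
        using integrable_mult_indicator[OF _ gi, of "{0<..<r}"] integrable_mult_indicator[OF _ gi, of "{r<..}"] by auto
      have "I = (LINT t|lborel. indicator {0<..<r} t * g t + indicator {r<..} t * g t)" unfolding I_def
      proof (rule integral_cong_AE)
        show "AE t in lborel. g t = indicator {0<..<r} t * g t + indicator {r<..} t * g t"
          using AE_lborel_singleton[of r]
        proof eventually_elim
          case (elim t)
          consider "t < \<delta>" | "0 < t" "t < r" | "t > r" using dR(1) elim by linarith
          then show ?case
          proof cases
            case 1 then show ?thesis using dR(3) by simp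
          qed auto
        qed
      qed measurable
      also have "\<dots> = \<xi> r + (LINT t|lborel. indicator {r<..} t * g t)"
        using Bochner_Integration.integral_add[OF i] by (simp add: \<xi>(2))
      finally show ?thesis by (simp add: \<eta>_def)
    qed
    have \<eta>out: "\<eta> r = 0" if "r > R" for r
    proof -
      have "(\<lambda>t. indicator {r<..} t * g t) = (\<lambda>_. 0)" using that dR(4) by (auto simp: indicator_def)
      then show ?thesis using tail[of r] that dR(1,2) by simp
    qed
    have \<phi>: "compact_C1 (\<lambda>x::'a. \<eta> (norm x)) (\<lambda>x. g (norm x) *\<^sub>R sgn x)"
      by (rule compact_C1_radial[OF \<eta> dR(1) dR(3) \<eta>out])
    have ae1: "AE x in lebesgue. F x \<bullet> (g (norm x) *\<^sub>R sgn x) = k (norm x) * g (norm x)"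
      using F AE_nonzero_lebesgue
    proof eventually_elim
      case (elim x)
      have "sgn x \<bullet> sgn x = 1" using elim(2) by (simp add: power2_norm_eq_inner[symmetric] norm_sgn)
      then show ?case using elim(1) by simp
    qed
    have ae2: "AE x in lebesgue. \<rho>' x * \<eta> (norm x) = \<rho> (norm x) * \<eta> (norm x)"
      using \<rho>' by eventually_elim simp
    have m1: "(\<lambda>x::'a. k (norm x) * g (norm x)) \<in> borel_measurable lebesgue" by measurable
    have m2: "(\<lambda>x::'a. \<rho> (norm x) * \<eta> (norm x)) \<in> borel_measurable lebesgue" by measurable
    have i1: "integrable lebesgue (\<lambda>x::'a. k (norm x) * g (norm x))"
      by (rule integrable_cong_AE_imp[OF weq(1)[OF \<phi>] m1 ae1])
    have "(LINT x|lebesgue. k (norm (x::'a)) * g (norm x)) = (LINT x|lebesgue. F x \<bullet> (g (norm x) *\<^sub>R sgn x))"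
      by (rule integral_cong_AE[OF m1 borel_measurable_integrable[OF weq(1)[OF \<phi>]]]) (rule eventually_mono[OF ae1], rule sym)
    also have "\<dots> = (LINT x|lebesgue. \<rho>' x * \<eta> (norm x))" by (rule weq(3)[OF \<phi>])
    also have "\<dots> = (LINT x|lebesgue. \<rho> (norm (x::'a)) * \<eta> (norm x))"
      by (rule integral_cong_AE[OF borel_measurable_integrable[OF weq(2)[OF \<phi>]] m2 ae2])
    finally have eq: "(LINT r|lborel. \<sigma> r * (k r * g r)) = (LINT r|lborel. \<sigma> r * (\<rho> r * \<eta> r))"
      using integral_radial(2)[of "\<lambda>r. k r * g r", where 'a = 'a] integral_radial(2)[of "\<lambda>r. \<rho> r * \<eta> r", where 'a = 'a]
      by (simp add: \<sigma>_def N_def)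
    have i1': "integrable lborel (\<lambda>r. \<sigma> r * (k r * g r))"
      using integrable_radial_iff[of "\<lambda>r. k r * g r", where 'a = 'a] i1 by (simp add: \<sigma>_def N_def)
    let ?K = "{(t::real, r::real). r < t}"
    let ?b = "\<lambda>r. indicator {..<R} r * (\<sigma> r * \<rho> r)"
    have K: "?K \<in> sets (lborel \<Otimes>\<^sub>M lborel)"
    proof -
      have "{z \<in> space (lborel \<Otimes>\<^sub>M lborel). snd z < (fst z :: real)} \<in> sets (lborel \<Otimes>\<^sub>M lborel)"
        by measurable
      moreover have "{z \<in> space (lborel \<Otimes>\<^sub>M lborel). snd z < (fst z :: real)} = ?K"
        by (auto simp: space_pair_measure)
      ultimately show ?thesis by simp
    qed
    have bi: "integrable lborel ?b" by (rule \<rho>int)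
    note sw = integral_kernel_swap_integrable[OF sigma_finite_lborel gi K bi]
    have "(LINT r|lborel. \<sigma> r * (\<rho> r * \<eta> r)) = (LINT r|lborel. - ((LINT t|lborel. indicator ?K (t, r) * g t) * ?b r))"
    proof (rule integral_cong_AE)
      show "AE r in lborel. \<sigma> r * (\<rho> r * \<eta> r) = - ((LINT t|lborel. indicator ?K (t, r) * g t) * ?b r)"
        using AE_lborel_singleton[of R]
      proof eventually_elim
        case (elim r)
        consider "r \<le> 0" | "r > R" | "0 < r" "r < R" using elim by linarith
        then show ?case
        proof cases
          case 1 then show ?thesis by (simp add: s)
        next
          case 2 then show ?thesis using \<eta>out by simp
        next
          case 3
          have "(LINT t|lborel. indicator ?K (t, r) * g t) = (LINT t|lborel. indicator {r<..} t * g t)"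
            by (rule Bochner_Integration.integral_cong) (auto simp: indicator_def)
          then show ?thesis using tail[of r] 3 by simp
        qed
      qed
      show "(\<lambda>r. - ((LINT t|lborel. indicator ?K (t, r) * g t) * ?b r)) \<in> borel_measurable lborel"
        using sw(1) by (intro borel_measurable_uminus borel_measurable_integrable)
    qed measurable
    also have "\<dots> = - (LINT t|lborel. g t * (LINT r|lborel. indicator ?K (t, r) * ?b r))"
      using sw(3) by simp
    also have "(LINT t|lborel. g t * (LINT r|lborel. indicator ?K (t, r) * ?b r)) = (LINT t|lborel. M t * g t)"
    proof (rule Bochner_Integration.integral_cong[OF refl])
      fix t
      show "g t * (LINT r|lborel. indicator ?K (t, r) * ?b r) = M t * g t"
      proof (cases "t > R")
        case True then show ?thesis using dR(4) by simp
      next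
        case False
        have "(LINT r|lborel. indicator ?K (t, r) * ?b r) = M t" unfolding M_def
          by (rule Bochner_Integration.integral_cong) (use False in \<open>auto simp: indicator_def\<close>)
        then show ?thesis by simp
      qed
    qed
    finally have "(LINT r|lborel. \<sigma> r * (k r * g r)) = - (LINT t|lborel. M t * g t)" using eq by simp
    moreover have "(LINT r|lborel. (\<sigma> r * k r + M r) * g r) = (LINT r|lborel. \<sigma> r * (k r * g r) + M r * g r)"
      by (simp add: algebra_simps)
    moreover have "\<dots> = (LINT r|lborel. \<sigma> r * (k r * g r)) + (LINT r|lborel. M r * g r)"
      by (rule Bochner_Integration.integral_add[OF i1' Mg])
    ultimately show ?thesis using i1' by (simp add: mult.assoc)
  qed
  have Mloc: "integrable lborel (\<lambda>r. indicator {a..b} r * M r)" for a b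
  proof (rule Bochner_Integration.integrable_bound)
    let ?C = "LINT s|lborel. \<bar>indicator {..<b} s * (\<sigma> s * \<rho> s)\<bar>"
    show "integrable lborel (\<lambda>r. ?C * indicator {a..b} r)"
      by (intro integrable_mult_right) (auto simp: integrable_indicator_iff emeasure_lborel_Icc_eq)
    have "norm (indicator {a..b} r * M r) \<le> norm (?C * indicator {a..b} r)" for r
    proof (cases "r \<in> {a..b}")
      case True
      have "\<bar>M r\<bar> \<le> (LINT s|lborel. \<bar>indicator {..<r} s * (\<sigma> s * \<rho> s)\<bar>)"
        unfolding M_def by (rule integral_abs_bound)
      also have "\<dots> \<le> ?C"
        by (rule integral_mono_AE'[OF integrable_abs[OF \<rho>int]]) (use True in \<open>auto simp: indicator_def\<close>)
      finally show ?thesis using True by simp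
    qed simp
    then show "AE r in lborel. norm (indicator {a..b} r * M r) \<le> norm (?C * indicator {a..b} r)" by simp
  qed measurable
  have Mtest: "integrable lborel (\<lambda>r. M r * g r)" if g: "pos_test g dg" for g dg
    using integrable_lborel_mult_pos_test(1)[OF Mm Mloc g] by (simp add: mult.commute)
  have "AE r in lborel. 0 < r \<longrightarrow> \<sigma> r * k r + M r = 0"
  proof (rule AE_lborel_eq_0_if_pos_test_orthogonal)
    fix a b :: real assume a: "0 < a"
    obtain g dg where g: "pos_test g dg" "\<And>r. a \<le> r \<Longrightarrow> r \<le> b \<Longrightarrow> g r \<ge> 1"
      using interval_bump[OF a] by metis
    have "integrable lborel (\<lambda>r. indicator {a..b} r * (\<sigma> r * k r))"
    proof (rule Bochner_Integration.integrable_bound)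
      show "integrable lborel (\<lambda>r. \<sigma> r * k r * g r)" using radial_test[OF g(1) Mtest[OF g(1)]] by simp
      have "norm (indicator {a..b} r * (\<sigma> r * k r)) \<le> norm (\<sigma> r * k r * g r)" for r
      proof (cases "r \<in> {a..b}")
        case True
        then have "1 \<le> \<bar>g r\<bar>" using g(2)[of r] by auto
        then have "\<bar>\<sigma> r * k r\<bar> * 1 \<le> \<bar>\<sigma> r * k r\<bar> * \<bar>g r\<bar>" by (intro mult_left_mono) auto
        then show ?thesis using True by (simp add: abs_mult)
      qed simp
      then show "AE r in lborel. norm (indicator {a..b} r * (\<sigma> r * k r)) \<le> norm (\<sigma> r * k r * g r)" by simp
    qed measurable
    from Bochner_Integration.integrable_add[OF this Mloc[of a b]]
    show "integrable lborel (\<lambda>r. indicator {a..b} r * (\<sigma> r * k r + M r))" by (simp add: distrib_left)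
  next
    fix g dg assume g: "pos_test g dg"
    show "(LINT r|lborel. (\<sigma> r * k r + M r) * g r) = 0" using radial_test[OF g Mtest[OF g]] by simp
  qed measurable
  then show "AE r in lborel. 0 < r \<longrightarrow> r ^ (N - 1) * k r = - (LINT s|lborel. indicator {0<..<r} s * (s ^ (N - 1) * \<rho> s))"
  proof eventually_elim
    case (elim r)
    show ?case
    proof
      assume r: "0 < r"
      have "M r = (LINT s|lborel. c * (indicator {0<..<r} s * (s ^ (N - 1) * \<rho> s)))" unfolding M_def
        by (rule Bochner_Integration.integral_cong) (auto simp: s indicator_def)
      then have "M r = c * (LINT s|lborel. indicator {0<..<r} s * (s ^ (N - 1) * \<rho> s))" by simp
      then have "c * (r ^ (N - 1) * k r + (LINT s|lborel. indicator {0<..<r} s * (s ^ (N - 1) * \<rho> s))) = 0"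
        using elim r by (simp add: s algebra_simps)
      then show "r ^ (N - 1) * k r = - (LINT s|lborel. indicator {0<..<r} s * (s ^ (N - 1) * \<rho> s))"
        using c by (simp add: eq_neg_iff_add_eq_0)
    qed
  qed
qed

lemma isCont_integral_from_zero:
  fixes f :: "real \<Rightarrow> real"
  assumes f [measurable]: "f \<in> borel_measurable borel"
    and int: "\<And>R. integrable lborel (\<lambda>s. indicator {0<..<R} s * f s)"
  shows "isCont (\<lambda>r. LINT s|lborel. indicator {0<..<r} s * f s) r"
  unfolding continuous_at_sequentially comp_def
proof (intro allI impI)
  fix x :: "nat \<Rightarrow> real" assume x: "x \<longlonglongrightarrow> r"
  have "Bseq x" using x by (intro convergent_imp_Bseq) (auto simp: convergent_def)
  then obtain R where R: "\<And>n. \<bar>x n\<bar> \<le> R" unfolding Bseq_def by auto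
  show "(\<lambda>n. LINT s|lborel. indicator {0<..<x n} s * f s) \<longlonglongrightarrow> (LINT s|lborel. indicator {0<..<r} s * f s)"
  proof (rule integral_dominated_convergence[where w = "\<lambda>s. norm (indicator {0<..<R} s * f s)"])
    show "integrable lborel (\<lambda>s. norm (indicator {0<..<R} s * f s))" using int[of R] by (rule integrable_norm)
    show "AE s in lborel. norm (indicator {0<..<x n} s * f s) \<le> norm (indicator {0<..<R} s * f s)" for n
      using R[of n] by (intro AE_I2) (auto simp: indicator_def)
    show "AE s in lborel. (\<lambda>n. indicator {0<..<x n} s * f s) \<longlonglongrightarrow> indicator {0<..<r} s * f s"
      using AE_lborel_singleton[of r]
    proof eventually_elim
      case (elim s)
      have "eventually (\<lambda>n. indicator {0<..<x n} s * f s = indicator {0<..<r} s * f s) sequentially"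
      proof (cases "s < r")
        case True
        have "eventually (\<lambda>n. s < x n) sequentially" using order_tendstoD(1)[OF x True] .
        then show ?thesis by eventually_elim (use True in \<open>auto simp: indicator_def\<close>)
      next
        case False
        then have "r < s" using elim by simp
        from order_tendstoD(2)[OF x this] show ?thesis
          by eventually_elim (use False in \<open>auto simp: indicator_def\<close>)
      qed
      then show ?case by (rule tendsto_eventually)
    qed
  qed measurable
qed

text \<open>
  An absolutely continuous function whose derivative agrees almost everywhere with a continuous
  function is differentiable everywhere, with that derivative.
\<close>

lemma DERIV_from_increments:
  fixes F k g :: "real \<Rightarrow> real"
  assumes [measurable]: "k \<in> borel_measurable borel"
    and inc: "\<And>r R. 0 < r \<Longrightarrow> r \<le> R \<Longrightarrow> F R - F r = (LINT s|lborel. indicator {r..<R} s * k s)"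
    and kg: "AE s in lborel. 0 < s \<longrightarrow> k s = g s" and g: "\<And>s. 0 < s \<Longrightarrow> isCont g s" and r: "0 < r"
  shows "(F has_real_derivative g r) (at r)"
proof -
  have "\<exists>P. \<forall>x. ereal 0 < ereal x \<longrightarrow> ereal x < \<infinity> \<longrightarrow> (P has_vector_derivative g x) (at x)"
    using g by (intro einterval_antiderivative) auto
  then obtain P where P: "\<And>x. 0 < x \<Longrightarrow> (P has_real_derivative g x) (at x)"
    by (auto simp: has_real_derivative_iff_has_vector_derivative)
  have cg: "continuous_on {a..b} g" if "0 < a" for a b
    using g that by (intro continuous_at_imp_continuous_on) auto
  have step: "F R - F s = P R - P s" if s: "0 < s" "s \<le> R" for s R
  proof -
    have gi: "integrable lborel (\<lambda>t. indicator {s..R} t * g t)"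
      by (rule integral_FTC_C1(2)[OF s(2) P cg]) (use s in auto)
    have "(LINT t|lborel. indicator {s..<R} t * k t) = (LINT t|lborel. indicator {s..R} t * g t)"
    proof (rule integral_cong_AE)
      show "AE t in lborel. indicator {s..<R} t * k t = indicator {s..R} t * g t"
        using kg AE_lborel_singleton[of R] by eventually_elim (use s in \<open>auto simp: indicator_def\<close>)
      show "(\<lambda>t. indicator {s..R} t * g t) \<in> borel_measurable lborel" using gi by (rule borel_measurable_integrable)
    qed measurable
    also have "\<dots> = P R - P s"
      by (rule integral_FTC_C1(1)[OF s(2) P cg]) (use s in auto)
    finally show ?thesis using inc[OF s] by simp
  qed
  have eq: "P s + (F 1 - P 1) = F s" if "0 < s" for s
    using step[of s 1] step[of 1 s] that by (cases "s \<le> 1") auto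
  have "((\<lambda>s. P s + (F 1 - P 1)) has_real_derivative g r) (at r)"
    using P[OF r] by (auto intro!: derivative_eq_intros)
  then show ?thesis
    by (rule has_field_derivative_transform_within_open[where S = "{0<..}"]) (use r eq in auto)
qed

text \<open>
  Bootstrapping. The primitive \<open>m\<close> is continuous and positive, so the flux identity can be solved for \<open>h\<close>
  and shows that \<open>h\<close> agrees almost everywhere with a continuous function. Hence \<open>V\<close> is C1, which makes the
  integrand of \<open>m\<close> continuous, so \<open>m\<close> is C1 as well.
\<close>

lemma radial_profile_regularity:
  fixes V h \<alpha> and N :: nat
  defines "\<rho> \<equiv> \<lambda>r. r powr (real N * \<alpha>) * exp (V r)"
  defines "m \<equiv> \<lambda>r. LINT s|lborel. indicator {0<..<r} s * (s ^ (N - 1) * \<rho> s)"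
  assumes N: "N \<ge> 2"
    and Vm [measurable]: "V \<in> borel_measurable borel" and h [measurable]: "h \<in> borel_measurable borel"
    and inc: "\<And>r R. 0 < r \<Longrightarrow> r \<le> R \<Longrightarrow> V R - V r = (LINT s|lborel. indicator {r..<R} s * h s)"
    and \<rho>i: "\<And>R. integrable lborel (\<lambda>r. indicator {0<..<R} r * (r ^ (N - 1) * \<rho> r))"
    and flux: "AE r in lborel. 0 < r \<longrightarrow> r ^ (N - 1) * (\<bar>h r\<bar> ^ (N - 2) * h r) = - m r"
  shows "\<And>r. 0 < r \<Longrightarrow> (V has_real_derivative - ((m r / r ^ (N - 1)) powr (1 / (real N - 1)))) (at r)"
    and "\<And>r. 0 < r \<Longrightarrow> (m has_real_derivative r ^ (N - 1) * \<rho> r) (at r)"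
    and "\<And>r. 0 < r \<Longrightarrow> 0 < m r" and "(m \<longlongrightarrow> 0) (at_right 0)"
proof -
  let ?f = "\<lambda>r. r ^ (N - 1) * \<rho> r"
  have \<rho>m[measurable]: "\<rho> \<in> borel_measurable borel" unfolding \<rho>_def by measurable
  have fm: "?f \<in> borel_measurable borel" by measurable
  have fpos: "?f r > 0" if "0 < r" for r using that by (simp add: \<rho>_def)
  have mc: "isCont m r" for r unfolding m_def by (rule isCont_integral_from_zero[OF fm \<rho>i])
  have m0: "m 0 = 0" unfolding m_def by simp
  show "(m \<longlongrightarrow> 0) (at_right 0)"
    using mc[of 0] m0 unfolding isCont_def by (simp add: filterlim_at_split)
  have mpos: "0 < m r" if r: "0 < r" for r
  proof -
    have nn: "AE s in lborel. 0 \<le> indicator {0<..<r} s * ?f s"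
    proof (intro AE_I2)
      fix s
      show "0 \<le> indicator {0<..<r} s * ?f s"
      proof (cases "s \<in> {0<..<r}")
        case True
        then have "0 \<le> ?f s" using less_imp_le[OF fpos[of s]] by simp
        then show ?thesis using True by simp
      qed simp
    qed
    then have "0 \<le> m r" unfolding m_def by (rule integral_nonneg_AE)
    moreover have "m r \<noteq> 0"
    proof
      assume "m r = 0"
      then have "AE s in lborel. indicator {0<..<r} s * ?f s = 0"
        using integral_nonneg_eq_0_iff_AE[OF \<rho>i nn] unfolding m_def by simp
      then have "AE s in lborel. s \<notin> {0<..<r}"
      proof eventually_elim
        case (elim s)
        then show ?case using fpos[of s] by (auto simp: indicator_def)
      qed
      then have "emeasure lborel {0<..<r} = 0"
        using AE_iff_null_sets[of "{0<..<r}" lborel] by auto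
      then show False using r by simp
    qed
    ultimately show ?thesis by simp
  qed
  then show "\<And>r. 0 < r \<Longrightarrow> 0 < m r" .
  let ?H = "\<lambda>r. - ((m r / r ^ (N - 1)) powr (1 / (real N - 1)))"
  have hH: "AE r in lborel. 0 < r \<longrightarrow> h r = ?H r"
    using flux
  proof eventually_elim
    case (elim r)
    show ?case
    proof
      assume r: "0 < r"
      have e: "r ^ (N - 1) * (\<bar>h r\<bar> ^ (N - 2) * h r) = - m r" using elim r by simp
      \<comment> \<open>the sign of \<open>h\<close> is forced by \<open>m > 0\<close>, and then the power can be inverted\<close>
      have "h r < 0"
      proof (rule ccontr)
        assume "\<not> h r < 0"
        then have "0 \<le> r ^ (N - 1) * (\<bar>h r\<bar> ^ (N - 2) * h r)" using r by (intro mult_nonneg_nonneg) auto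
        then show False using e mpos[OF r] by simp
      qed
      then have hn: "- h r > 0" by simp
      have "(- h r) ^ (N - 1) = (- h r) ^ (N - 2) * (- h r)"
        using N by (metis Suc_diff_Suc Suc_1 Suc_le_lessD diff_Suc_1 diff_diff_left plus_1_eq_Suc power_Suc2)
      then have "(- h r) ^ (N - 1) * r ^ (N - 1) = m r" using e hn by (simp add: mult_ac)
      then have "(- h r) ^ (N - 1) = m r / r ^ (N - 1)" using r by (simp add: field_simps)
      then have "(m r / r ^ (N - 1)) powr (1 / (real N - 1)) = ((- h r) powr real (N - 1)) powr (1 / (real N - 1))"
        using hn by (simp add: powr_realpow)
      also have "\<dots> = - h r" using hn N by (simp add: powr_powr of_nat_diff)
      finally show "h r = ?H r" by simp
    qed
  qed
  have Hc: "isCont ?H r" if "0 < r" for r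
  proof -
    have "m r / r ^ (N - 1) > 0" using mpos[OF that] that by simp
    then show ?thesis using that by (intro continuous_intros mc) auto
  qed
  show V': "(V has_real_derivative ?H r) (at r)" if "0 < r" for r
    by (rule DERIV_from_increments[OF h inc hH Hc that])
  have Vc: "isCont V r" if "0 < r" for r using V'[OF that] by (rule DERIV_isCont)
  have fc: "isCont ?f r" if "0 < r" for r
    unfolding \<rho>_def using that by (intro continuous_intros Vc) auto
  have minc: "m R - m r = (LINT s|lborel. indicator {r..<R} s * ?f s)" if r: "0 < r" "r \<le> R" for r R
  proof -
    have "m R - m r = (LINT s|lborel. indicator {0<..<R} s * ?f s - indicator {0<..<r} s * ?f s)"
      unfolding m_def by (rule Bochner_Integration.integral_diff[OF \<rho>i \<rho>i, symmetric])
    also have "\<dots> = (LINT s|lborel. indicator {r..<R} s * ?f s)"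
      by (rule Bochner_Integration.integral_cong) (use r in \<open>auto simp: indicator_def\<close>)
    finally show ?thesis .
  qed
  show "(m has_real_derivative ?f r) (at r)" if "0 < r" for r
    by (rule DERIV_from_increments[OF fm minc _ fc that]) auto
qed

section \<open>The ordinary differential equation\<close>

text \<open>
  The system conserves \<open>E = e\<^sup>Y - \<kappa> m + (n - 1)/n m q\<close> with \<open>q = m\<^sup>1\<^sup>/\<^sup>(\<^sup>n\<^sup>-\<^sup>1\<^sup>)\<close>. Since \<open>m\<close> tends to 0 at
  \<open>-\<infinity>\<close>, \<open>e\<^sup>Y\<close> tends to the value of \<open>E\<close>; a positive value would make \<open>m\<close> grow at least linearly, which is
  impossible for a positive function on a half-line unbounded to the left. With \<open>E = 0\<close> the variable \<open>p = 1/q\<close>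
  satisfies \<open>p' = 1/n - k p\<close>.
\<close>

lemma autonomous_liouville_system:
  fixes m Y :: "real \<Rightarrow> real" and \<kappa> n :: real
  assumes n: "n > 1" and \<kappa>: "\<kappa> > 0"
    and dm: "\<And>t. (m has_real_derivative exp (Y t)) (at t)"
    and dY: "\<And>t. (Y has_real_derivative \<kappa> - m t powr (1 / (n - 1))) (at t)"
    and mpos: "\<And>t. m t > 0" and m0: "(m \<longlongrightarrow> 0) at_bot"
  defines "k \<equiv> \<kappa> / (n - 1)"
  obtains D where "D > 0" "\<And>t. m t powr (1 / (n - 1)) = n * k / (1 + n * k * D * exp (- k * t))"
    "\<And>t. exp (Y t) = m t * (\<kappa> - (n - 1) / n * m t powr (1 / (n - 1)))"
proof -
  define b where "b = 1 / (n - 1)"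
  have b: "b > 0" using n by (simp add: b_def)
  have k: "k > 0" "k = \<kappa> * b" using n \<kappa> by (auto simp: k_def b_def)
  have mb: "m t powr (1 + b) = m t * m t powr b" for t
    using mpos[of t] by (simp add: powr_add)
  define E where "E t = exp (Y t) - \<kappa> * m t + (n - 1) / n * m t powr (1 + b)" for t
  have dE: "(E has_real_derivative 0) (at t)" for t
  proof -
    have nz: "n \<noteq> 0" "n - 1 \<noteq> 0" using n by auto
    have "(E has_real_derivative exp (Y t) * (\<kappa> - m t powr b) - \<kappa> * exp (Y t)
        + (n - 1) / n * ((1 + b) * m t powr (1 + b - of_nat 1) * exp (Y t))) (at t)"
      unfolding E_def b_def
      by (auto intro!: derivative_eq_intros dm dY DERIV_fun_powr mpos simp: nz(1))
    moreover
    have "1 + b = n / (n - 1)" using nz(2) by (simp add: b_def add_divide_eq_iff)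
    then have "(n - 1) / n * (1 + b) = 1" using nz by simp
    then have "(n - 1) / n * ((1 + b) * m t powr (1 + b - of_nat 1) * exp (Y t)) = m t powr b * exp (Y t)"
      by (simp only: mult.assoc[symmetric]) simp
    ultimately show ?thesis by (simp add: algebra_simps)
  qed
  define C where "C = E 0"
  have EC: "E t = C" for t unfolding C_def by (rule DERIV_isconst_all) (use dE in blast)
  have limY: "((\<lambda>t. exp (Y t)) \<longlongrightarrow> C) at_bot"
  proof -
    have pw: "((\<lambda>t. m t powr (1 + b)) \<longlongrightarrow> 0 powr (1 + b)) at_bot"
    proof (rule tendsto_powr'[OF m0 tendsto_const])
      have "eventually (\<lambda>t. 0 \<le> m t) at_bot" using mpos by (intro always_eventually allI less_imp_le)
      then show "(0::real) \<noteq> 0 \<or> 0 < 1 + b \<and> eventually (\<lambda>t. 0 \<le> m t) at_bot" using b by simp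
    qed
    have "((\<lambda>t. C + \<kappa> * m t - (n - 1) / n * m t powr (1 + b)) \<longlongrightarrow> C + \<kappa> * 0 - (n - 1) / n * 0 powr (1 + b)) at_bot"
      by (intro tendsto_diff tendsto_add tendsto_mult tendsto_const m0 pw)
    moreover have "C + \<kappa> * m t - (n - 1) / n * m t powr (1 + b) = exp (Y t)" for t
      using EC[of t] by (simp add: E_def)
    ultimately show ?thesis by simp
  qed
  have C0: "C = 0"
  proof -
    have "C \<ge> 0"
      by (rule tendsto_lowerbound[OF limY]) (auto intro!: always_eventually less_imp_le)
    moreover have "\<not> C > 0"
    proof
      assume C: "C > 0"
      have "eventually (\<lambda>t. C / 2 < exp (Y t)) at_bot"
        by (rule order_tendstoD(1)[OF limY]) (use C in simp)
      then obtain T where T: "\<And>t. t \<le> T \<Longrightarrow> C / 2 < exp (Y t)" unfolding eventually_at_bot_linorder by blast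
      \<comment> \<open>far enough to the left for the linear bound to exhaust \<open>m T\<close>\<close>
      define t where "t = T - 2 * m T / C"
      have tT: "t < T" using C mpos[of T] by (simp add: t_def)
      obtain z where z: "t < z" "z < T" "m T - m t = (T - t) * exp (Y z)"
        using MVT2[OF tT, of m "\<lambda>s. exp (Y s)"] dm by blast
      have "(T - t) * (C / 2) \<le> (T - t) * exp (Y z)"
        using T[of z] z tT by (intro mult_left_mono) auto
      moreover have "(T - t) * (C / 2) = m T" using C by (simp add: t_def)
      ultimately have "m t \<le> 0" using z(3) by simp
      then show False using mpos[of t] by simp
    qed
    ultimately show ?thesis by simp
  qed
  have eY: "exp (Y t) = m t * (\<kappa> - (n - 1) / n * m t powr b)" for t
    using EC[of t] unfolding C0 E_def mb by (simp add: algebra_simps)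
  define p where "p t = m t powr (- b)" for t
  have ppos: "p t > 0" for t using mpos[of t] by (simp add: p_def)
  have pq: "p t * m t powr b = 1" for t using mpos[of t] by (simp add: p_def powr_minus)
  have dp: "(p has_real_derivative 1 / n - k * p t) (at t)" for t
  proof -
    have "(p has_real_derivative - b * m t powr (- b - of_nat 1) * exp (Y t)) (at t)"
      unfolding p_def by (rule DERIV_fun_powr[OF dm mpos])
    moreover have "m t powr (- b - of_nat 1) * exp (Y t) = p t * (\<kappa> - (n - 1) / n * m t powr b)"
    proof -
      have "m t powr (- b) = m t powr (- b - 1) * m t powr 1" by (simp only: powr_add[symmetric]) simp
      then have "m t powr (- b - of_nat 1) * m t = p t" using mpos[of t] by (simp add: p_def)
      then show ?thesis unfolding eY by (simp only: mult.assoc[symmetric])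
    qed
    moreover have "- b * (p t * (\<kappa> - (n - 1) / n * m t powr b)) = 1 / n - k * p t"
    proof -
      have "- b * (x * (\<kappa> - c * y)) = - (\<kappa> * b) * x + (b * c) * (x * y)" for x y c
        by (simp add: algebra_simps)
      then have "- b * (p t * (\<kappa> - (n - 1) / n * m t powr b)) = - (\<kappa> * b) * p t + (b * ((n - 1) / n)) * (p t * m t powr b)" .
      also have "b * ((n - 1) / n) = 1 / n" using n by (simp add: b_def)
      finally show ?thesis unfolding pq k(2) by simp
    qed
    ultimately show ?thesis by (simp only: mult.assoc)
  qed
  \<comment> \<open>the constant solution \<open>1/(n k)\<close> subtracted, times the integrating factor\<close>
  define Z where "Z t = exp (k * t) * (p t - 1 / (n * k))" for t
  have dZ: "(Z has_real_derivative 0) (at t)" for t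
  proof -
    have "(Z has_real_derivative exp (k * t) * (1 / n - k * p t) + (exp (k * t) * k) * (p t - 1 / (n * k))) (at t)"
      unfolding Z_def by (auto intro!: derivative_eq_intros dp)
    moreover have "exp (k * t) * (1 / n - k * p t) + (exp (k * t) * k) * (p t - 1 / (n * k)) = 0"
      using k(1) n by (simp add: field_simps)
    ultimately show ?thesis by simp
  qed
  define D where "D = Z 0"
  have ZD: "Z t = D" for t unfolding D_def by (rule DERIV_isconst_all) (use dZ in blast)
  have pD: "p t = (1 + n * k * D * exp (- k * t)) / (n * k)" for t
  proof -
    have "p t = 1 / (n * k) + exp (- (k * t)) * Z t" unfolding Z_def by (simp add: exp_minus_inverse mult.assoc[symmetric] mult.commute[of "exp (- _)"])
    then show ?thesis using ZD[of t] k(1) n by (simp add: field_simps)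
  qed
  \<comment> \<open>\<open>e\<^sup>Y > 0\<close> bounds \<open>q\<close> by the stationary value \<open>n k\<close>\<close>
  have Dpos: "D > 0"
  proof -
    have "0 < \<kappa> - (n - 1) / n * m 0 powr b"
      using eY[of 0] mpos[of 0] by (metis exp_gt_zero zero_less_mult_pos)
    then have "(n - 1) / n * m 0 powr b < \<kappa>" by simp
    then have "m 0 powr b < n * k" using n by (simp add: k_def field_simps)
    then have "p 0 * m 0 powr b < p 0 * (n * k)" using ppos[of 0] by simp
    then have "1 < p 0 * (n * k)" using pq[of 0] by simp
    then show ?thesis using k(1) n by (simp add: D_def Z_def field_simps)
  qed
  have "m t powr b = n * k / (1 + n * k * D * exp (- k * t))" for t
  proof -
    have "m t powr b = 1 / p t" using pq[of t] ppos[of t] by (simp add: field_simps)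
    then show ?thesis unfolding pD by simp
  qed
  then show ?thesis using that[OF Dpos] eY unfolding b_def by simp
qed

text \<open>
  The substitution \<open>t = ln r\<close> makes the equation autonomous, because it turns scalings into translations. The
  constant \<open>D\<close> of \<open>autonomous_liouville_system\<close> becomes the scaling parameter through
  \<open>N k D = \<mu>\<^sup>-\<^sup>k\<close>, with \<open>k = N (\<alpha> + 1)/(N - 1)\<close>.
\<close>

lemma liouville_profile_unique:
  fixes V m :: "real \<Rightarrow> real" and \<alpha> :: real and N :: nat
  assumes N: "N \<ge> 2" and \<alpha>: "\<alpha> > -1"
    and dV: "\<And>r. 0 < r \<Longrightarrow> (V has_real_derivative - ((m r / r ^ (N - 1)) powr (1 / (real N - 1)))) (at r)"
    and dm: "\<And>r. 0 < r \<Longrightarrow> (m has_real_derivative r ^ (N - 1) * (r powr (real N * \<alpha>) * exp (V r))) (at r)"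
    and mpos: "\<And>r. 0 < r \<Longrightarrow> 0 < m r" and m0: "(m \<longlongrightarrow> 0) (at_right 0)"
  obtains \<mu> where "\<mu> > 0"
    "\<And>r. 0 < r \<Longrightarrow> V r = ln (bubble_const N \<alpha> * \<mu> powr (real N * (\<alpha> + 1)) /
         (1 + (\<mu> * r) powr (real N * (\<alpha> + 1) / (real N - 1))) ^ N)"
proof -
  define n where "n = real N"
  have n: "n > 1" using N by (simp add: n_def)
  define \<kappa> where "\<kappa> = n * (\<alpha> + 1)"
  have \<kappa>: "\<kappa> > 0" using n \<alpha> by (simp add: \<kappa>_def)
  define k where "k = \<kappa> / (n - 1)"
  have k: "k > 0" using n \<kappa> by (simp add: k_def)
  define M where "M t = m (exp t)" for t
  define Y where "Y t = V (exp t) + \<kappa> * t" for t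
  have ex: "exp t ^ (N - 1) = exp ((n - 1) * t)" for t :: real
    using N by (simp add: exp_of_nat_mult[symmetric] n_def of_nat_diff)
  have dM: "(M has_real_derivative exp (Y t)) (at t)" for t
  proof -
    have "(M has_real_derivative (exp t ^ (N - 1) * (exp t powr (real N * \<alpha>) * exp (V (exp t)))) * exp t) (at t)"
      unfolding M_def by (rule DERIV_chain2[OF dm DERIV_exp]) simp
    moreover have "(exp t ^ (N - 1) * (exp t powr (real N * \<alpha>) * exp (V (exp t)))) * exp t = exp (Y t)"
      unfolding ex by (simp add: Y_def \<kappa>_def powr_def n_def exp_add[symmetric] algebra_simps)
    ultimately show ?thesis by simp
  qed
  have dY: "(Y has_real_derivative \<kappa> - M t powr (1 / (n - 1))) (at t)" for t
  proof -
    have "(Y has_real_derivative (- ((m (exp t) / exp t ^ (N - 1)) powr (1 / (real N - 1)))) * exp t + \<kappa>) (at t)"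
      unfolding Y_def by (auto intro!: derivative_eq_intros DERIV_chain2[OF dV DERIV_exp])
    moreover have "(m (exp t) / exp t ^ (N - 1)) powr (1 / (real N - 1)) * exp t = M t powr (1 / (n - 1))"
    proof -
      have "(exp t ^ (N - 1)) powr (1 / (n - 1)) = exp t"
        unfolding ex using n by (simp add: powr_def)
      then show ?thesis using mpos[of "exp t"] by (simp add: powr_divide M_def n_def[symmetric])
    qed
    ultimately show ?thesis by simp
  qed
  have M0: "(M \<longlongrightarrow> 0) at_bot"
  proof -
    have "filterlim exp (at_right 0) (at_bot :: real filter)"
      unfolding filterlim_at by (auto intro: exp_at_bot)
    then show ?thesis unfolding M_def by (rule filterlim_compose[OF m0])
  qed
  have Mpos: "M t > 0" for t using mpos by (simp add: M_def)
  obtain D where D: "D > 0" "\<And>t. M t powr (1 / (n - 1)) = n * k / (1 + n * k * D * exp (- k * t))"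
    "\<And>t. exp (Y t) = M t * (\<kappa> - (n - 1) / n * M t powr (1 / (n - 1)))"
    using autonomous_liouville_system[OF n \<kappa> dM dY Mpos M0] unfolding k_def by metis
  define L where "L = n * k * D"
  have L: "L > 0" using n k D by (simp add: L_def)
  define \<mu> where "\<mu> = L powr (- 1 / k)"
  have \<mu>: "\<mu> > 0" using L by (simp add: \<mu>_def)
  have "V r = ln (bubble_const N \<alpha> * \<mu> powr (real N * (\<alpha> + 1)) /
         (1 + (\<mu> * r) powr (real N * (\<alpha> + 1) / (real N - 1))) ^ N)" if r: "0 < r" for r
  proof -
    define t where "t = ln r"
    have et: "exp t = r" using r by (simp add: t_def)
    \<comment> \<open>the variable in which the bubbles are rational: \<open>q = n k X/(1 + X)\<close>\<close>
    define X where "X = (\<mu> * r) powr k"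
    have X: "X > 0" using \<mu> r by (simp add: X_def)
    have XL: "X = exp (k * t) / L"
    proof -
      have "X = \<mu> powr k * r powr k" unfolding X_def using \<mu> r by (simp add: powr_mult)
      also have "\<mu> powr k = 1 / L"
      proof -
        have "\<mu> powr k = L powr (- 1 / k * k)" unfolding \<mu>_def by (simp only: powr_powr)
        also have "- 1 / k * k = - 1" using k by simp
        finally show ?thesis using L by (simp add: powr_neg_one)
      qed
      also have "r powr k = exp (k * t)" using r by (simp add: powr_def t_def)
      finally show ?thesis by simp
    qed
    define q where "q = M t powr (1 / (n - 1))"
    have q: "q = n * k * X / (1 + X)"
    proof -
      have "L * exp (- k * t) = 1 / X" unfolding XL using L by (simp add: exp_minus field_simps)
      then have "q = n * k / (1 + 1 / X)" using D(2)[of t] by (simp add: q_def L_def)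
      also have "\<dots> = n * k * X / (1 + X)" using X by (simp add: field_simps)
      finally show ?thesis .
    qed
    have Mq: "M t = q ^ (N - 1)"
    proof -
      have "q ^ (N - 1) = q powr (n - 1)"
        using Mpos[of t] N by (simp add: q_def n_def powr_realpow[symmetric] of_nat_diff)
      also have "\<dots> = M t" unfolding q_def using Mpos[of t] n by (simp add: powr_powr)
      finally show ?thesis by simp
    qed
    have "exp (Y t) = M t * (\<kappa> - (n - 1) / n * q)" using D(3)[of t] by (simp add: q_def)
    also have "\<kappa> - (n - 1) / n * q = \<kappa> / (1 + X)"
    proof -
      have "(n - 1) * k = \<kappa>" using n by (simp add: k_def)
      then have "(n - 1) / n * q = \<kappa> * X / (1 + X)" unfolding q using n by (simp add: mult.assoc[symmetric])
      then show ?thesis using X by (simp add: field_simps)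
    qed
    also have "M t * (\<kappa> / (1 + X)) = \<kappa> * (n * k) ^ (N - 1) * X ^ (N - 1) / (1 + X) ^ N"
    proof -
      have pN: "(1 + X) ^ N = (1 + X) ^ (N - 1) * (1 + X)" using N power_eq_if[of "1 + X" N] by (simp add: mult.commute)
      show ?thesis unfolding Mq q power_divide power_mult_distrib pN by simp
    qed
    also have "X ^ (N - 1) = (\<mu> * r) powr \<kappa>"
    proof -
      have "X ^ (N - 1) = X powr (n - 1)" using X N by (simp add: powr_realpow[symmetric] n_def of_nat_diff)
      then show ?thesis unfolding X_def using n by (simp add: powr_powr k_def)
    qed
    also have "(\<mu> * r) powr \<kappa> = \<mu> powr \<kappa> * exp (\<kappa> * t)"
      using \<mu> r by (simp add: powr_mult powr_def[of r] t_def)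
    finally have "exp (Y t) = (\<kappa> * (n * k) ^ (N - 1) * \<mu> powr \<kappa> / (1 + X) ^ N) * exp (\<kappa> * t)" by simp
    moreover have "exp (Y t) = exp (V r) * exp (\<kappa> * t)" by (simp add: Y_def et exp_add)
    ultimately have "exp (V r) * exp (\<kappa> * t) = (\<kappa> * (n * k) ^ (N - 1) * \<mu> powr \<kappa> / (1 + X) ^ N) * exp (\<kappa> * t)"
      by (simp only:)
    then have "exp (V r) = \<kappa> * (n * k) ^ (N - 1) * \<mu> powr \<kappa> / (1 + X) ^ N"
      by (rule mult_right_cancel[THEN iffD1, rotated]) simp
    moreover have "\<kappa> * (n * k) ^ (N - 1) = bubble_const N \<alpha>"
      by (simp add: bubble_const_def \<kappa>_def k_def n_def power2_eq_square mult.assoc)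
    ultimately have "exp (V r) = bubble_const N \<alpha> * \<mu> powr \<kappa> / (1 + X) ^ N" by simp
    then have "V r = ln (bubble_const N \<alpha> * \<mu> powr \<kappa> / (1 + X) ^ N)" by (metis ln_exp)
    then show ?thesis unfolding X_def \<kappa>_def k_def n_def .
  qed
  then show ?thesis using that[OF \<mu>] by blast
qed

section \<open>The explicit solutions\<close>

lemma integrable_powr_at_zero:
  assumes "p > (-1::real)"
  shows "integrable lborel (\<lambda>r. indicator {0<..<R} r * r powr p)"
proof (cases "0 < R")
  case False
  then have "{0<..<R} = {}" by auto
  then show ?thesis by simp
next
  case True
  have "(\<lambda>r. r powr p) integrable_on {0..R}" using integrable_on_powr_from_0[OF assms, of R] True by simp
  then have "(\<lambda>r. r powr p) absolutely_integrable_on {0..R}"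
    by (rule nonnegative_absolutely_integrable_1) auto
  then have "integrable lborel (\<lambda>r. indicator {0..R} r * r powr p)"
    unfolding set_integrable_def by (subst (asm) integrable_completion) auto
  then show ?thesis
    by (rule Bochner_Integration.integrable_bound) (auto simp: indicator_def)
qed

text \<open>
  In polar coordinates the exponent becomes \<open>N - 1 + p > -1\<close>.
\<close>

lemma integrable_norm_powr:
  assumes "p > - real DIM('a::euclidean_space)"
  shows "integrable lebesgue (\<lambda>x::'a. indicator {..<R} (norm x) * norm x powr p)"
proof -
  define N where "N = DIM('a)"
  have N: "N \<ge> 1" by (simp add: N_def Suc_leI)
  have "sphere_density N r * (indicator {..<R} r * r powr p) =
      real N * unit_ball_vol (real N) * (indicator {0<..<R} r * r powr (real N - 1 + p))" for r
  proof (cases "0 < r")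
    case True
    have "r ^ (N - 1) = r powr (real N - 1)" using True N by (simp add: powr_realpow[symmetric] of_nat_diff)
    then show ?thesis using True by (simp add: sphere_density_def powr_add indicator_def)
  qed (simp add: sphere_density_def)
  moreover have "integrable lborel (\<lambda>r. real N * unit_ball_vol (real N) * (indicator {0<..<R} r * r powr (real N - 1 + p)))"
    using assms by (intro integrable_mult_right integrable_powr_at_zero) (simp add: N_def)
  ultimately show ?thesis by (subst integrable_radial_iff) (auto simp: N_def)
qed

lemma set_integrable_norm_powr_bound:
  fixes F :: "'a::euclidean_space \<Rightarrow> real"
  assumes F: "F \<in> borel_measurable lebesgue" and p: "p > - real DIM('a)"
    and bd: "\<And>x. \<bar>F x\<bar> \<le> C * norm x powr p" and K: "compact K"
  shows "set_integrable lebesgue K F"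
proof -
  obtain R where R: "K \<subseteq> ball 0 R" using bounded_subset_ballD[OF compact_imp_bounded[OF K], of 0] by blast
  show ?thesis unfolding set_integrable_def
  proof (rule Bochner_Integration.integrable_bound[OF integrable_mult_right[OF integrable_norm_powr[OF p, of R], of C]])
    show "(\<lambda>x. indicator K x *\<^sub>R F x) \<in> borel_measurable lebesgue"
      using F K by (intro borel_measurable_scaleR borel_measurable_indicator) (auto simp: borel_compact)
    show "AE x in lebesgue. norm (indicator K x *\<^sub>R F x) \<le> norm (C * (indicator {..<R} (norm x) * norm x powr p))"
    proof (intro AE_I2)
      fix x
      show "norm (indicator K x *\<^sub>R F x) \<le> norm (C * (indicator {..<R} (norm x) * norm x powr p))"
      proof (cases "x \<in> K")
        case True
        then have "norm x < R" using R by auto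
        moreover have "\<bar>F x\<bar> \<le> \<bar>C * norm x powr p\<bar>" by (rule order_trans[OF bd abs_ge_self])
        ultimately show ?thesis using True by simp
      qed simp
    qed
  qed
qed

lemma bubble_const_pos: "N \<ge> 2 \<Longrightarrow> \<alpha> > -1 \<Longrightarrow> bubble_const N \<alpha> > 0"
  unfolding bubble_const_def by (intro mult_pos_pos zero_less_power divide_pos_pos) auto

text \<open>
  The profile \<open>W\<close> of the bubble has derivative \<open>h = - q/r\<close> with \<open>q = N k X/(1 + X)\<close> and \<open>X = (\<mu> r)\<^sup>k\<close>. Near the
  origin \<open>h\<close> is of order \<open>r\<^sup>k\<^sup>-\<^sup>1\<close>, possibly unbounded, but \<open>|h|\<^sup>N\<close> is locally integrable on the space because \<open>k > 0\<close>. The mass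
  \<open>m = q\<^sup>N\<^sup>-\<^sup>1\<close> satisfies \<open>m' = r\<^sup>N\<^sup>-\<^sup>1 \<rho>\<close> and vanishes at 0, so it is the integral of the source, and
  \<open>|h|\<^sup>N\<^sup>-\<^sup>2 h = - m/r\<^sup>N\<^sup>-\<^sup>1\<close>. The weak equation is then \<open>flux_radial\<close>.
\<close>

lemma liouville_solution_bubble:
  fixes u :: "real ^ 'n \<Rightarrow> real"
  assumes N2: "CARD('n) \<ge> 2" and \<alpha>: "\<alpha> > -1" and \<mu>: "\<mu> > 0"
    and u: "AE x in lebesgue. u x = bubble \<mu> \<alpha> x"
  shows "liouville_solution \<alpha> u"
proof -
  define N where "N = CARD('n)"
  have DN: "DIM(real ^ 'n) = N" by (simp add: N_def)
  have N: "N \<ge> 2" using N2 by (simp add: N_def)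
  define n where "n = real N"
  have n: "n > 1" using N by (simp add: n_def)
  define \<kappa> where "\<kappa> = n * (\<alpha> + 1)"
  have \<kappa>: "\<kappa> > 0" using n \<alpha> by (simp add: \<kappa>_def)
  define k where "k = \<kappa> / (n - 1)"
  have k: "k > 0" using n \<kappa> by (simp add: k_def)
  have kn: "(n - 1) * k = \<kappa>" using n by (simp add: k_def)
  define Cb where "Cb = bubble_const N \<alpha>"
  have Cb: "Cb > 0" unfolding Cb_def by (rule bubble_const_pos[OF N \<alpha>])
  have Cb': "Cb = \<kappa> * (n * k) ^ (N - 1)"
    by (simp add: Cb_def bubble_const_def \<kappa>_def k_def n_def power2_eq_square mult.assoc)
  \<comment> \<open>\<open>X r = a r\<^sup>k\<close> separates the scaling from the radius, which keeps the derivatives simple\<close>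
  define a where "a = \<mu> powr k"
  have a: "a > 0" using \<mu> by (simp add: a_def)
  define X where "X r = a * r powr k" for r
  have Xpos: "X r > 0" if "r > 0" for r using that a by (simp add: X_def)
  have Xnn: "X r \<ge> 0" for r using a by (simp add: X_def)
  have X1: "1 + X r > 0" for r using Xnn[of r] by linarith
  define W where "W r = ln (Cb * \<mu> powr \<kappa> / (1 + X r) ^ N)" for r
  have bubbleW: "bubble \<mu> \<alpha> x = W (norm x)" for x :: "real ^ 'n"
    unfolding bubble_def W_def X_def Cb_def a_def N_def[symmetric] \<kappa>_def k_def n_def
    using \<mu> by (simp add: powr_mult)
  have Wln: "W r = ln (Cb * \<mu> powr \<kappa>) - n * ln (1 + X r)" for r
    unfolding W_def using Cb \<mu> X1[of r] by (simp add: ln_div ln_realpow n_def)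
  define h where "h r = - (n * (a * (k * r powr (k - 1))) / (1 + X r))" for r
  have hm[measurable]: "h \<in> borel_measurable borel" unfolding h_def X_def by measurable
  have dX: "(X has_real_derivative a * (k * r powr (k - 1))) (at r)" if "r > 0" for r
    unfolding X_def using that by (auto intro!: derivative_eq_intros)
  have dW: "(W has_real_derivative h r) (at r)" if r: "r > 0" for r
  proof -
    have "((\<lambda>r. ln (Cb * \<mu> powr \<kappa>) - n * ln (1 + X r)) has_real_derivative 0 - n * ((0 + a * (k * r powr (k - 1))) / (1 + X r))) (at r)"
      using dX[OF r] X1[of r] by (auto intro!: derivative_eq_intros)
    then show ?thesis unfolding Wln[abs_def] h_def by simp
  qed
  have ch: "isCont h r" if "r > 0" for r
    unfolding h_def X_def using that X1[of r] by (intro continuous_intros) (auto simp: X_def)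
  have cont: "continuous_on {s..R} h" if "0 < s" for s R
    using ch that by (intro continuous_at_imp_continuous_on) auto
  have inc: "W R - W r = (LINT s|lborel. indicator {r..<R} s * h s)" if r: "0 < r" "r \<le> R" for r R
  proof -
    have "(LINT s|lborel. indicator {r..<R} s * h s) = (LINT s|lborel. indicator {r..R} s * h s)"
    proof (rule integral_cong_AE)
      show "AE s in lborel. indicator {r..<R} s * h s = indicator {r..R} s * h s"
        using AE_lborel_singleton[of R] by eventually_elim (auto simp: indicator_def)
    qed measurable
    also have "\<dots> = W R - W r"
      by (rule integral_FTC_C1(1)[OF r(2) dW cont]) (use r in auto)
    finally show ?thesis by simp
  qed
  have hbd: "\<bar>h r\<bar> \<le> n * a * k * r powr (k - 1)" for r
  proof -
    have p: "0 \<le> n * (a * (k * r powr (k - 1)))" using n a k by simp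
    have "\<bar>h r\<bar> = n * (a * (k * r powr (k - 1))) / (1 + X r)" unfolding h_def using p X1[of r] by simp
    also have "\<dots> \<le> n * (a * (k * r powr (k - 1))) / 1" using p Xnn[of r] by (intro divide_left_mono) auto
    finally show ?thesis by (simp add: mult.assoc)
  qed
  let ?G = "\<lambda>x::real ^ 'n. h (norm x) *\<^sub>R sgn x"
  have Gm: "?G \<in> borel_measurable lebesgue" by (rule radial_field_measurable[OF hm])
  have cB: "continuous_on UNIV (bubble \<mu> \<alpha> :: real ^ 'n \<Rightarrow> real)"
  proof -
    have "continuous_on UNIV (\<lambda>x::real ^ 'n. X (norm x))" unfolding X_def using k
      by (intro continuous_intros continuous_on_powr') auto
    then have "continuous_on UNIV (\<lambda>x::real ^ 'n. ln (Cb * \<mu> powr \<kappa>) - n * ln (1 + X (norm x)))"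
      using X1 by (intro continuous_intros) (auto simp: less_imp_neq[OF X1, symmetric])
    then show ?thesis unfolding bubbleW[abs_def] Wln .
  qed
  have Bm: "(bubble \<mu> \<alpha> :: real ^ 'n \<Rightarrow> real) \<in> borel_measurable lebesgue"
    by (rule continuous_measurable_lebesgue[OF cB])
  have um: "u \<in> borel_measurable lebesgue"
    by (rule borel_measurable_AE[OF Bm]) (use u in \<open>auto elim: eventually_mono\<close>)
  have uLp: "Lp_loc p u" if "p > 0" for p unfolding Lp_loc_def
  proof (intro conjI allI impI um)
    fix K :: "(real ^ 'n) set" assume K: "compact K"
    have Kb: "K \<in> sets borel" using K by (simp add: borel_compact)
    have c: "continuous_on K (\<lambda>x. norm (bubble \<mu> \<alpha> x) powr p)"
      using that by (intro continuous_on_powr' continuous_on_norm continuous_on_subset[OF cB] continuous_on_const) auto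
    have cm: "(\<lambda>x::real ^ 'n. norm (bubble \<mu> \<alpha> x) powr p) \<in> borel_measurable borel"
      using borel_measurable_continuous_onI[OF cB] by measurable
    have "integrable lborel (\<lambda>x. indicator K x *\<^sub>R (norm (bubble \<mu> \<alpha> x) powr p))"
      by (rule borel_integrable_compact[OF K c])
    then have i: "integrable lebesgue (\<lambda>x. indicator K x *\<^sub>R (norm (bubble \<mu> \<alpha> x) powr p))"
      using cm Kb by (subst integrable_completion) auto
    show "set_integrable lebesgue K (\<lambda>x. norm (u x) powr p)" unfolding set_integrable_def
    proof (rule integrable_cong_AE_imp[OF i])
      show "(\<lambda>x. indicator K x *\<^sub>R (norm (u x) powr p)) \<in> borel_measurable lebesgue"
        using um Kb by (intro borel_measurable_scaleR borel_measurable_indicator) auto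
      show "AE x in lebesgue. indicator K x *\<^sub>R (norm (bubble \<mu> \<alpha> x) powr p) = indicator K x *\<^sub>R (norm (u x) powr p)"
        using u by eventually_elim simp
    qed
  qed
  have hloc: "set_integrable lebesgue (cball 0 R) (\<lambda>x::real ^ 'n. h (norm x))" for R
    by (rule set_integrable_norm_powr_bound[where p = "k - 1" and C = "n * a * k"])
       (use hbd k n DN in \<open>auto simp: n_def\<close>)
  have GL: "Lp_loc n ?G" unfolding Lp_loc_def
  proof (intro conjI allI impI Gm)
    fix K :: "(real ^ 'n) set" assume K: "compact K"
    show "set_integrable lebesgue K (\<lambda>x. norm (?G x) powr n)"
    proof (rule set_integrable_norm_powr_bound[where p = "(k - 1) * n" and C = "(n * a * k) powr n", OF _ _ _ K])
      show "(\<lambda>x. norm (?G x) powr n) \<in> borel_measurable lebesgue" using Gm by measurable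
      have "0 < k * n" using k n by simp
      then show "(k - 1) * n > - real DIM(real ^ 'n)" unfolding DN n_def[symmetric] by (simp add: left_diff_distrib)
      fix x :: "real ^ 'n"
      have "norm (?G x) \<le> \<bar>h (norm x)\<bar>" by (simp add: norm_sgn)
      also have "\<dots> \<le> n * a * k * norm x powr (k - 1)" by (rule hbd)
      finally have "norm (?G x) powr n \<le> (n * a * k * norm x powr (k - 1)) powr n"
        using n by (intro powr_mono2) auto
      also have "\<dots> = (n * a * k) powr n * norm x powr ((k - 1) * n)"
        using n a k by (simp add: powr_mult powr_powr)
      finally show "\<bar>norm (?G x) powr n\<bar> \<le> (n * a * k) powr n * norm x powr ((k - 1) * n)" by simp
    qed
  qed
  have uW: "AE x in lebesgue. u x = W (norm x)" using u by (simp add: bubbleW)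
  have wg: "has_weak_gradient u ?G"
    by (rule has_weak_gradient_radial[OF uLp uW hm hloc inc]) auto
  have uW1p: "u \<in> W1p_loc (real CARD('n))"
    unfolding W1p_loc_def using uLp[of n] n wg GL by (auto simp: n_def N_def)

  define \<rho> where "\<rho> r = r powr (real N * \<alpha>) * exp (W r)" for r
  define f where "f r = r ^ (N - 1) * \<rho> r" for r
  define q where "q r = n * k * (X r / (1 + X r))" for r
  define m where "m r = q r ^ (N - 1)" for r
  have [measurable]: "X \<in> borel_measurable borel" unfolding X_def by measurable
  have Wm[measurable]: "W \<in> borel_measurable borel" unfolding W_def by measurable
  have \<rho>m[measurable]: "\<rho> \<in> borel_measurable borel" unfolding \<rho>_def by measurable
  have fm[measurable]: "f \<in> borel_measurable borel" unfolding f_def by measurable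
  have mm[measurable]: "m \<in> borel_measurable borel" unfolding m_def q_def by measurable
  have pN: "y ^ N = y ^ (N - 1) * y" for y :: real using N power_eq_if[of y N] by (simp add: mult.commute)
  have pN2: "y ^ (N - 1) = y ^ (N - 2) * y" for y :: real
    using N by (metis Suc_diff_Suc Suc_1 Suc_le_lessD diff_Suc_1 diff_diff_left plus_1_eq_Suc power_Suc2)
  have rpow: "r ^ (N - 1) = r powr (n - 1)" if "r > 0" for r
    using that N by (simp add: powr_realpow[symmetric] n_def of_nat_diff)
  have fexp: "f r = r powr (\<kappa> - 1) * (Cb * \<mu> powr \<kappa> / (1 + X r) ^ N)" if r: "r > 0" for r
  proof -
    have "exp (W r) = Cb * \<mu> powr \<kappa> / (1 + X r) ^ N"
      unfolding W_def using Cb \<mu> X1[of r] by (intro exp_ln) simp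
    moreover have "r ^ (N - 1) * r powr (real N * \<alpha>) = r powr (\<kappa> - 1)"
      unfolding rpow[OF r] powr_add[symmetric] by (simp add: \<kappa>_def n_def algebra_simps)
    ultimately show ?thesis by (simp add: f_def \<rho>_def mult.assoc[symmetric])
  qed
  have fint: "integrable lborel (\<lambda>s. indicator {0<..<R} s * f s)" for R
  proof (rule Bochner_Integration.integrable_bound[OF integrable_mult_right[OF integrable_powr_at_zero[of "\<kappa> - 1" R], of "Cb * \<mu> powr \<kappa>"]])
    show "AE s in lborel. norm (indicator {0<..<R} s * f s) \<le> norm (Cb * \<mu> powr \<kappa> * (indicator {0<..<R} s * s powr (\<kappa> - 1)))"
    proof (intro AE_I2)
      fix s
      show "norm (indicator {0<..<R} s * f s) \<le> norm (Cb * \<mu> powr \<kappa> * (indicator {0<..<R} s * s powr (\<kappa> - 1)))"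
      proof (cases "s \<in> {0<..<R}")
        case True
        have "1 \<le> (1 + X s) ^ N" using Xnn[of s] by (intro one_le_power) simp
        then have "Cb * \<mu> powr \<kappa> / (1 + X s) ^ N \<le> Cb * \<mu> powr \<kappa> / 1"
          using Cb \<mu> by (intro divide_left_mono) auto
        then have "s powr (\<kappa> - 1) * (Cb * \<mu> powr \<kappa> / (1 + X s) ^ N) \<le> s powr (\<kappa> - 1) * (Cb * \<mu> powr \<kappa>)"
          by (intro mult_left_mono) auto
        moreover have "0 \<le> s powr (\<kappa> - 1) * (Cb * \<mu> powr \<kappa> / (1 + X s) ^ N)"
          using Cb \<mu> X1[of s] by (intro mult_nonneg_nonneg divide_nonneg_nonneg) auto
        ultimately show ?thesis using True fexp[of s] Cb \<mu> by (simp add: mult.commute)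
      qed simp
    qed
  qed (use \<kappa> in \<open>auto, measurable\<close>)
  have dm: "(m has_real_derivative f r) (at r)" if r: "r > 0" for r
  proof -
    let ?X' = "a * (k * r powr (k - 1))"
    have rX: "r * ?X' = k * X r"
      using r by (simp add: X_def powr_diff)
    have dq: "(q has_real_derivative n * k * ((?X' * (1 + X r) - X r * ?X') / ((1 + X r) * (1 + X r)))) (at r)"
      unfolding q_def
    proof (intro DERIV_cmult DERIV_divide)
      show "((\<lambda>r. 1 + X r) has_real_derivative ?X') (at r)"
        using dX[OF r] by (auto intro!: derivative_eq_intros)
    qed (use X1[of r] dX[OF r] in auto)
    have "(m has_real_derivative real (N - 1) * (n * k * ((?X' * (1 + X r) - X r * ?X') / ((1 + X r) * (1 + X r)))) * q r ^ (N - 1 - Suc 0)) (at r)"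
      unfolding m_def using DERIV_power[OF dq, of "N - 1"] by (simp only: mult.assoc)
    moreover have "real (N - 1) * (n * k * ((?X' * (1 + X r) - X r * ?X') / ((1 + X r) * (1 + X r)))) * q r ^ (N - 1 - Suc 0) = f r"
    proof -
      define Q where "Q = n * k * (X r / (1 + X r))"
      have qQ: "q r = Q" by (simp add: q_def Q_def)
      have X': "?X' = k * X r / r" using rX r by (simp add: field_simps)
      have "n * k * ((?X' * (1 + X r) - X r * ?X') / ((1 + X r) * (1 + X r))) = Q * k / (r * (1 + X r))"
        unfolding X' Q_def using r X1[of r] by (simp add: divide_simps) (simp add: algebra_simps)
      moreover have "N - 1 - Suc 0 = N - 2" by simp
      moreover have "real (N - 1) = n - 1" using N by (simp add: n_def of_nat_diff)
      ultimately have "real (N - 1) * (n * k * ((?X' * (1 + X r) - X r * ?X') / ((1 + X r) * (1 + X r)))) * q r ^ (N - 1 - Suc 0)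
          = ((n - 1) * k) * (Q ^ (N - 2) * Q) / (r * (1 + X r))"
        by (simp only: qQ) (simp add: mult_ac)
      also have "\<dots> = \<kappa> * ((n * k) ^ (N - 1) * X r ^ (N - 1)) / (r * (1 + X r) ^ N)"
      proof -
        have "Q ^ (N - 1) = (n * k) ^ (N - 1) * X r ^ (N - 1) / (1 + X r) ^ (N - 1)"
          by (simp add: Q_def power_mult_distrib power_divide)
        moreover have "A * (B / C) / (s * D) = A * B / (s * (C * D))" for A B C D s :: real by simp
        ultimately show ?thesis by (simp only: kn pN2[symmetric] pN)
      qed
      also have "X r ^ (N - 1) = \<mu> powr \<kappa> * r powr \<kappa>"
      proof -
        have "X r ^ (N - 1) = X r powr (n - 1)"
          using Xpos[OF r] N by (simp add: powr_realpow[symmetric] n_def of_nat_diff)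
        also have "\<dots> = (\<mu> powr k) powr (n - 1) * (r powr k) powr (n - 1)"
          unfolding X_def a_def using r \<mu> by (simp add: powr_mult)
        also have "\<dots> = \<mu> powr \<kappa> * r powr \<kappa>" using kn by (simp add: powr_powr mult.commute)
        finally show ?thesis .
      qed
      also have "\<kappa> * ((n * k) ^ (N - 1) * (\<mu> powr \<kappa> * r powr \<kappa>)) / (r * (1 + X r) ^ N) = f r"
        unfolding fexp[OF r] Cb' using r by (simp add: powr_diff mult_ac)
      finally show ?thesis .
    qed
    ultimately show ?thesis by simp
  qed
  have m0: "(m \<longlongrightarrow> 0) (at_right 0)"
  proof -
    have "((\<lambda>r. r powr k) \<longlongrightarrow> 0 powr k) (at_right 0)"
      by (rule tendsto_powr'[OF tendsto_ident_at tendsto_const]) (use k in \<open>auto simp: eventually_at_filter\<close>)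
    then have "(X \<longlongrightarrow> a * 0) (at_right 0)" unfolding X_def using k by (intro tendsto_mult tendsto_const) simp
    then have "(m \<longlongrightarrow> (n * k * (a * 0 / (1 + a * 0))) ^ (N - 1)) (at_right 0)"
      unfolding m_def q_def by (intro tendsto_intros) auto
    then show ?thesis using N by (simp add: zero_power)
  qed
  have mint: "m r = (LINT s|lborel. indicator {0<..<r} s * f s)" if r: "0 < r" for r
  proof -
    \<comment> \<open>the difference \<open>m - J\<close> is constant on the half-line and tends to 0 at 0\<close>
    define J where "J r = (LINT s|lborel. indicator {0<..<r} s * f s)" for r
    have Jc: "isCont J s" for s unfolding J_def by (rule isCont_integral_from_zero[OF fm fint])
    have fc: "isCont f s" if "0 < s" for s
    proof -
      have "isCont W s" by (rule DERIV_isCont[OF dW[OF that]])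
      then show ?thesis unfolding f_def \<rho>_def using that by (intro continuous_intros) auto
    qed
    have Jinc: "J R - J s = (LINT t|lborel. indicator {s..<R} t * f t)" if "0 < s" "s \<le> R" for s R
    proof -
      have "J R - J s = (LINT t|lborel. indicator {0<..<R} t * f t - indicator {0<..<s} t * f t)"
        unfolding J_def by (rule Bochner_Integration.integral_diff[OF fint fint, symmetric])
      also have "\<dots> = (LINT t|lborel. indicator {s..<R} t * f t)"
        by (rule Bochner_Integration.integral_cong) (use that in \<open>auto simp: indicator_def\<close>)
      finally show ?thesis .
    qed
    have dJ: "(J has_real_derivative f s) (at s)" if "0 < s" for s
      by (rule DERIV_from_increments[OF fm Jinc _ fc that]) auto
    have "\<exists>c. \<forall>s\<in>{0<..}. m s - J s = c"
    proof (rule has_field_derivative_zero_constant)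
      fix s :: real assume "s \<in> {0<..}"
      then have "((\<lambda>s. m s - J s) has_real_derivative f s - f s) (at s)"
        using dm dJ by (intro DERIV_diff) auto
      then show "((\<lambda>s. m s - J s) has_real_derivative 0) (at s within {0<..})"
        by (simp add: has_field_derivative_at_within)
    qed simp
    then obtain c where c: "\<And>s. 0 < s \<Longrightarrow> m s - J s = c" by auto
    have "(J \<longlongrightarrow> J 0) (at_right 0)" using Jc[of 0] unfolding isCont_def by (simp add: filterlim_at_split)
    moreover have "J 0 = 0" unfolding J_def by simp
    ultimately have "((\<lambda>s. m s - J s) \<longlongrightarrow> 0 - 0) (at_right 0)" using m0 by (intro tendsto_diff) auto
    moreover have "((\<lambda>s. m s - J s) \<longlongrightarrow> c) (at_right 0)"
      by (rule tendsto_eventually) (use c in \<open>auto simp: eventually_at_filter\<close>)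
    ultimately have "c = 0" using tendsto_unique[of "at_right (0::real)"] by auto
    then show ?thesis using c[OF r] by (simp add: J_def)
  qed
  have flux: "\<bar>h r\<bar> ^ (N - 2) * h r = - (m r / r ^ (N - 1))" if r: "r > 0" for r
  proof -
    have "r * h r = - q r"
      using r by (simp add: h_def q_def X_def powr_diff)
    then have hq: "h r = - (q r / r)" using r by (simp add: field_simps)
    have "q r \<ge> 0" unfolding q_def using n k Xnn[of r] by (intro mult_nonneg_nonneg divide_nonneg_nonneg) auto
    then have "\<bar>h r\<bar> = q r / r" using r by (simp add: hq)
    then have "\<bar>h r\<bar> ^ (N - 2) * h r = - ((q r / r) ^ (N - 2) * (q r / r))" by (simp add: hq)
    also have "(q r / r) ^ (N - 2) * (q r / r) = m r / r ^ (N - 1)"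
      unfolding pN2[symmetric] m_def by (simp add: power_divide)
    finally show ?thesis .
  qed
  show ?thesis unfolding liouville_solution_def
  proof (intro conjI uW1p exI[of _ ?G] wg allI impI)
    fix \<phi> d\<phi> assume \<phi>: "compact_C1 \<phi> (d\<phi> :: real ^ 'n \<Rightarrow> real ^ 'n)"
    have fl: "integrable lebesgue (\<lambda>x. f (norm x) * (\<phi> x / norm x ^ (N - 1)))"
      "integrable lebesgue (\<lambda>x. m (norm x) * ((d\<phi> x \<bullet> sgn x) / norm x ^ (N - 1)))"
      "(LINT x|lebesgue. f (norm x) * (\<phi> x / norm x ^ (N - 1))) =
        - (LINT x|lebesgue. m (norm x) * ((d\<phi> x \<bullet> sgn x) / norm x ^ (N - 1)))"
      by (rule flux_radial[OF fm fint mint mm \<phi>, unfolded DN]; assumption)+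
    have [measurable]: "\<phi> \<in> borel_measurable lebesgue" "d\<phi> \<in> borel_measurable lebesgue"
      using compact_C1_continuous[OF \<phi>] by (auto intro: continuous_measurable_lebesgue)
    have m1: "(\<lambda>x. (norm (?G x) ^ (CARD('n) - 2) *\<^sub>R ?G x) \<bullet> d\<phi> x) \<in> borel_measurable lebesgue"
      using Gm by measurable
    have m2: "(\<lambda>x. norm x powr (real CARD('n) * \<alpha>) * exp (u x) * \<phi> x) \<in> borel_measurable lebesgue"
      using um by measurable
    have ae1: "AE x in lebesgue. - (m (norm x) * ((d\<phi> x \<bullet> sgn x) / norm x ^ (N - 1))) = (norm (?G x) ^ (CARD('n) - 2) *\<^sub>R ?G x) \<bullet> d\<phi> x"
      using AE_nonzero_lebesgue
    proof eventually_elim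
      case (elim x)
      have ng: "norm (?G x) = \<bar>h (norm x)\<bar>" using elim by (simp add: norm_sgn)
      have "norm (?G x) ^ (CARD('n) - 2) *\<^sub>R ?G x = (\<bar>h (norm x)\<bar> ^ (N - 2) * h (norm x)) *\<^sub>R sgn x"
        unfolding ng N_def by simp
      also have "\<dots> = (- (m (norm x) / norm x ^ (N - 1))) *\<^sub>R sgn x" using flux[of "norm x"] elim by simp
      finally show ?case by (simp add: inner_commute)
    qed
    have ae2: "AE x in lebesgue. f (norm x) * (\<phi> x / norm x ^ (N - 1)) = norm x powr (real CARD('n) * \<alpha>) * exp (u x) * \<phi> x"
      using uW AE_nonzero_lebesgue
    proof eventually_elim
      case (elim x)
      then show ?case by (simp add: f_def \<rho>_def N_def)
    qed
    show i1: "integrable lebesgue (\<lambda>x. (norm (?G x) ^ (CARD('n) - 2) *\<^sub>R ?G x) \<bullet> d\<phi> x)"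
      by (rule integrable_cong_AE_imp[OF integrable_minus[OF fl(2)] m1 ae1])
    show i2: "integrable lebesgue (\<lambda>x. norm x powr (real CARD('n) * \<alpha>) * exp (u x) * \<phi> x)"
      by (rule integrable_cong_AE_imp[OF fl(1) m2 ae2])
    have "(LINT x|lebesgue. (norm (?G x) ^ (CARD('n) - 2) *\<^sub>R ?G x) \<bullet> d\<phi> x) =
        (LINT x|lebesgue. - (m (norm x) * ((d\<phi> x \<bullet> sgn x) / norm x ^ (N - 1))))"
      by (rule integral_cong_AE[OF m1 borel_measurable_integrable[OF integrable_minus[OF fl(2)]]])
         (rule eventually_mono[OF ae1], rule sym)
    also have "\<dots> = (LINT x|lebesgue. f (norm x) * (\<phi> x / norm x ^ (N - 1)))" using fl(3) by simp
    also have "\<dots> = (LINT x|lebesgue. norm x powr (real CARD('n) * \<alpha>) * exp (u x) * \<phi> x)"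
      by (rule integral_cong_AE[OF borel_measurable_integrable[OF fl(1)] m2 ae2])
    finally show "(LINT x|lebesgue. (norm (?G x) ^ (CARD('n) - 2) *\<^sub>R ?G x) \<bullet> d\<phi> x) =
        (LINT x|lebesgue. norm x powr (real CARD('n) * \<alpha>) * exp (u x) * \<phi> x)" .
  qed
qed

section \<open>Classification\<close>

lemma radial_solution_is_bubble:
  fixes u :: "real ^ 'n \<Rightarrow> real"
  assumes N2: "CARD('n) \<ge> 2" and \<alpha>: "\<alpha> > -1" and rad: "radial u" and sol: "liouville_solution \<alpha> u"
  obtains \<mu> where "\<mu> > 0" "AE x in lebesgue. u x = bubble \<mu> \<alpha> x"
proof -
  define N where "N = CARD('n)"
  have DN: "DIM(real ^ 'n) = N" by (simp add: N_def)
  have N: "N \<ge> 2" using N2 by (simp add: N_def)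
  have "\<exists>G. has_weak_gradient u G \<and> (\<forall>\<phi> d\<phi>. compact_C1 \<phi> d\<phi> \<longrightarrow>
      integrable lebesgue (\<lambda>x. (norm (G x) ^ (N - 2) *\<^sub>R G x) \<bullet> d\<phi> x) \<and>
      integrable lebesgue (\<lambda>x. norm x powr (real N * \<alpha>) * exp (u x) * \<phi> x) \<and>
      (LINT x|lebesgue. (norm (G x) ^ (N - 2) *\<^sub>R G x) \<bullet> d\<phi> x) =
      (LINT x|lebesgue. norm x powr (real N * \<alpha>) * exp (u x) * \<phi> x))"
    using sol unfolding liouville_solution_def N_def[symmetric] by (rule conjunct2)
  then obtain G where GG: "has_weak_gradient u G \<and> (\<forall>\<phi> d\<phi>. compact_C1 \<phi> d\<phi> \<longrightarrow>
      integrable lebesgue (\<lambda>x. (norm (G x) ^ (N - 2) *\<^sub>R G x) \<bullet> d\<phi> x) \<and>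
      integrable lebesgue (\<lambda>x. norm x powr (real N * \<alpha>) * exp (u x) * \<phi> x) \<and>
      (LINT x|lebesgue. (norm (G x) ^ (N - 2) *\<^sub>R G x) \<bullet> d\<phi> x) =
      (LINT x|lebesgue. norm x powr (real N * \<alpha>) * exp (u x) * \<phi> x))"
    by (rule exE)
  note G = GG[THEN conjunct1] and weak = GG[THEN conjunct2]
  note w = weak[THEN spec, THEN spec, THEN mp]
  note weq = w[THEN conjunct1] w[THEN conjunct2, THEN conjunct1] w[THEN conjunct2, THEN conjunct2]
  obtain V h where Vm[measurable]: "V \<in> borel_measurable borel" and hm[measurable]: "h \<in> borel_measurable borel"
    and inc: "\<And>r R. 0 < r \<Longrightarrow> r \<le> R \<Longrightarrow> V R - V r = (LINT s|lborel. indicator {r..<R} s * h s)"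
    and uV: "AE x in lebesgue. u x = V (norm x)" and Gh: "AE x in lebesgue. G x = h (norm x) *\<^sub>R sgn x"
  proof (rule radial_weak_gradient_structure[OF G rad])
    fix V h
    assume *: "V \<in> borel_measurable borel" "h \<in> borel_measurable borel"
      "\<And>r R. 0 < r \<Longrightarrow> r \<le> R \<Longrightarrow> V R - V r = (LINT s|lborel. indicator {r..<R} s * h s)"
      "AE x in lebesgue. u x = V (norm x)" "AE x in lebesgue. G x = h (norm x) *\<^sub>R sgn x"
    show thesis by (rule that[OF *])
  qed
  define \<rho> where "\<rho> r = r powr (real N * \<alpha>) * exp (V r)" for r
  define k where "k r = \<bar>h r\<bar> ^ (N - 2) * h r" for r
  have km: "k \<in> borel_measurable borel" unfolding k_def by measurable
  have \<rho>m: "\<rho> \<in> borel_measurable borel" unfolding \<rho>_def by measurable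
  have F: "AE x in lebesgue. norm (G x) ^ (N - 2) *\<^sub>R G x = k (norm x) *\<^sub>R sgn x"
    using Gh AE_nonzero_lebesgue by eventually_elim (simp add: k_def norm_sgn)
  have R: "AE x in lebesgue. norm x powr (real N * \<alpha>) * exp (u x) = \<rho> (norm x)"
    using uV by eventually_elim (simp add: \<rho>_def)
  define m where "m r = (LINT s|lborel. indicator {0<..<r} s * (s ^ (N - 1) * \<rho> s))" for r
  have \<rho>i: "integrable lborel (\<lambda>r. indicator {0<..<R} r * (r ^ (N - 1) * \<rho> r))" for R
    by (rule radial_flux_identity(1)[OF km \<rho>m weq F R, unfolded DN])
  have flux: "AE r in lborel. 0 < r \<longrightarrow> r ^ (N - 1) * (\<bar>h r\<bar> ^ (N - 2) * h r) = - m r"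
    unfolding m_def k_def[symmetric]
    by (rule radial_flux_identity(2)[OF km \<rho>m weq F R, unfolded DN])
  note reg = radial_profile_regularity[OF N Vm hm inc, of \<alpha>, folded \<rho>_def, folded m_def, OF _ _ \<rho>i flux]
  obtain \<mu> where \<mu>: "\<mu> > 0" "\<And>r. 0 < r \<Longrightarrow> V r = ln (bubble_const N \<alpha> * \<mu> powr (real N * (\<alpha> + 1)) /
         (1 + (\<mu> * r) powr (real N * (\<alpha> + 1) / (real N - 1))) ^ N)"
  proof (rule liouville_profile_unique[OF N \<alpha>])
    fix r :: real assume r: "0 < r"
    show "(V has_real_derivative - ((m r / r ^ (N - 1)) powr (1 / (real N - 1)))) (at r)"
      by (rule reg(1)) (use r in auto)
    show "(m has_real_derivative r ^ (N - 1) * (r powr (real N * \<alpha>) * exp (V r))) (at r)"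
      unfolding \<rho>_def[symmetric] by (rule reg(2)) (use r in auto)
    show "0 < m r" by (rule reg(3)) (use r in auto)
  next
    show "(m \<longlongrightarrow> 0) (at_right 0)" by (rule reg(4)) auto
  qed blast
  have "AE x in lebesgue. u x = bubble \<mu> \<alpha> x"
    using uV AE_nonzero_lebesgue
  proof eventually_elim
    case (elim x)
    then show ?case using \<mu>(2)[of "norm x"] by (simp add: bubble_def N_def)
  qed
  then show ?thesis using that \<mu>(1) by blast
qed

text \<open>
  Dilations preserve null sets. This is needed because \<open>rescale\<close> evaluates a function, known only almost
  everywhere, at the dilated point.
\<close>

lemma AE_lebesgue_scaleR:
  fixes P :: "'a::euclidean_space \<Rightarrow> bool"
  assumes "AE x in lebesgue. P x" and c: "c \<noteq> (0::real)"
  shows "AE x in lebesgue. P (c *\<^sub>R x)"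
proof -
  obtain A where A: "A \<in> null_sets lebesgue" "{x \<in> space lebesgue. \<not> P x} \<subseteq> A"
    using assms(1) unfolding eventually_ae_filter by blast
  have "negligible ((\<lambda>x. (1 / c) *\<^sub>R x) ` A)"
    using A(1) by (intro negligible_differentiable_image_negligible) (auto simp: negligible_iff_null_sets)
  then have "(\<lambda>x. (1 / c) *\<^sub>R x) ` A \<in> null_sets lebesgue" by (simp add: negligible_iff_null_sets)
  moreover have "{x \<in> space lebesgue. \<not> P (c *\<^sub>R x)} \<subseteq> (\<lambda>x. (1 / c) *\<^sub>R x) ` A"
  proof
    fix x assume "x \<in> {x \<in> space lebesgue. \<not> P (c *\<^sub>R x)}"
    then have "c *\<^sub>R x \<in> A" using A(2) by auto
    then show "x \<in> (\<lambda>x. (1 / c) *\<^sub>R x) ` A" using c by (intro image_eqI[of _ _ "c *\<^sub>R x"]) auto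
  qed
  ultimately show ?thesis unfolding eventually_ae_filter by blast
qed

lemma rescale_bubble:
  fixes x :: "real ^ 'n"
  assumes "CARD('n) \<ge> 2" "\<alpha> > -1" "\<mu> > 0" "\<nu> > 0"
  shows "rescale \<alpha> \<nu> (bubble \<mu> \<alpha>) x = bubble (\<mu> * \<nu>) \<alpha> x"
proof -
  let ?\<kappa> = "real CARD('n) * (\<alpha> + 1)"
  let ?q = "(1 + (\<mu> * \<nu> * norm x) powr (?\<kappa> / (real CARD('n) - 1))) ^ CARD('n)"
  have q: "?q > 0" by (intro zero_less_power add_pos_nonneg) auto
  have "rescale \<alpha> \<nu> (bubble \<mu> \<alpha>) x = ln (bubble_const CARD('n) \<alpha> * \<mu> powr ?\<kappa> / ?q) + ln (\<nu> powr ?\<kappa>)"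
    using assms by (simp add: rescale_def bubble_def mult.assoc ln_powr)
  also have "\<dots> = ln (bubble_const CARD('n) \<alpha> * \<mu> powr ?\<kappa> / ?q * \<nu> powr ?\<kappa>)"
    using assms q bubble_const_pos[OF assms(1,2)] by (intro ln_mult_pos[symmetric] divide_pos_pos mult_pos_pos) auto
  also have "\<dots> = bubble (\<mu> * \<nu>) \<alpha> x"
    using assms by (simp add: bubble_def powr_mult mult_ac)
  finally show ?thesis .
qed

theorem theorem1p1:
  fixes \<alpha> :: real
  assumes "CARD('n::finite) \<ge> 2" and "\<alpha> > -1"
  shows "(\<exists>u :: real ^ 'n \<Rightarrow> real. radial u \<and> liouville_solution \<alpha> u)
    \<and> (\<forall>u v :: real ^ 'n \<Rightarrow> real.
         radial u \<and> liouville_solution \<alpha> u \<and> radial v \<and> liouville_solution \<alpha> v \<longrightarrow>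
         (\<exists>\<mu>>0. AE x in lebesgue. v x = rescale \<alpha> \<mu> u x))
    \<and> (\<forall>u :: real ^ 'n \<Rightarrow> real.
         radial u \<and> liouville_solution \<alpha> u \<longleftrightarrow>
         (\<exists>\<mu>>0. AE x in lebesgue. u x = bubble \<mu> \<alpha> x))"
proof (intro conjI allI impI)
  have bub: "radial u \<and> liouville_solution \<alpha> u"
    if "\<mu> > 0" "AE x in lebesgue. u x = bubble \<mu> \<alpha> x" for u :: "real ^ 'n \<Rightarrow> real" and \<mu>
  proof
    show "liouville_solution \<alpha> u" by (rule liouville_solution_bubble[OF assms that])
    show "radial u" unfolding radial_def using that(2) unfolding bubble_def by (intro exI)
  qed
  show "\<exists>u :: real ^ 'n \<Rightarrow> real. radial u \<and> liouville_solution \<alpha> u"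
    using bub[of 1 "bubble 1 \<alpha>"] by auto
  show "radial u \<and> liouville_solution \<alpha> u \<longleftrightarrow> (\<exists>\<mu>>0. AE x in lebesgue. u x = bubble \<mu> \<alpha> x)"
    for u :: "real ^ 'n \<Rightarrow> real"
    using bub radial_solution_is_bubble[OF assms] by metis
  fix u v :: "real ^ 'n \<Rightarrow> real"
  assume uv: "radial u \<and> liouville_solution \<alpha> u \<and> radial v \<and> liouville_solution \<alpha> v"
  obtain \<mu> where \<mu>: "\<mu> > 0" "AE x in lebesgue. u x = bubble \<mu> \<alpha> x"
    using radial_solution_is_bubble[OF assms] uv by metis
  obtain \<nu> where \<nu>: "\<nu> > 0" "AE x in lebesgue. v x = bubble \<nu> \<alpha> x"
    using radial_solution_is_bubble[OF assms] uv by metis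
  have s: "\<nu> / \<mu> > 0" using \<mu> \<nu> by simp
  have "AE x in lebesgue. u ((\<nu> / \<mu>) *\<^sub>R x) = bubble \<mu> \<alpha> ((\<nu> / \<mu>) *\<^sub>R x)"
    using AE_lebesgue_scaleR[OF \<mu>(2) less_imp_neq[OF s, symmetric]] .
  then have "AE x in lebesgue. v x = rescale \<alpha> (\<nu> / \<mu>) u x"
    using \<nu>(2)
  proof eventually_elim
    case (elim x)
    have "rescale \<alpha> (\<nu> / \<mu>) u x = rescale \<alpha> (\<nu> / \<mu>) (bubble \<mu> \<alpha>) x"
      using elim(1) by (simp add: rescale_def)
    also have "\<dots> = bubble \<nu> \<alpha> x" using rescale_bubble[OF assms \<mu>(1) s] \<mu>(1) by simp
    finally show ?case using elim(2) by simp
  qed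
  then show "\<exists>\<mu>>0. AE x in lebesgue. v x = rescale \<alpha> \<mu> u x" using s by blast
qed

end
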